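(* Let $R$ be a standard graded algebra over a field and let $\mathfrak p$ be a homogeneous prime ideal of $R$ with $\dim R/\mathfrak p=1$. Then there is a homogeneous element $x\in R$ such that for all $n\ge 1$ $$\ell(\mathfrak p^{(n)}/\mathfrak p^n)=2\,\ell\!\left(\frac{R}{\mathfrak p^n+(x^n)}\right)-\ell\!\left(\frac{R}{\mathfrak p^n+(x^{2n})}\right).$$
   Context: $\ell(-)$ denotes length as an $R$-module. $\mathfrak p^{(n)}:=\mathfrak p^nR_{\mathfrak p}\cap R$ is the $n$-th symbolic power. *)

theory Defs
  imports "HOL-Algebra.Algebra" "HOL-Library.Extended_Nat"
begin

section \<open>Length of a module\<close>

definition module_length :: "('a, 'c) ring_scheme \<Rightarrow> ('a, 'b, 'd) module_scheme \<Rightarrow> enat" where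
  "module_length R M =
     Sup {enat n | n. \<exists>N :: nat \<Rightarrow> 'b set.
       (\<forall>i\<le>n. submodule (N i) R M) \<and> (\<forall>i<n. N i \<subset> N (Suc i))}"

text \<open>The record of modules extends the record of rings; the ring multiplication and unit of a
  module are irrelevant, and are left unspecified in quotients.\<close>

definition regular_module :: "('a, 'c) ring_scheme \<Rightarrow> ('a, 'a) module" where
  "regular_module R =
     \<lparr>carrier = carrier R, monoid.mult = monoid.mult R, one = one R, ring.zero = ring.zero R, ring.add = ring.add R,
      smult = monoid.mult R\<rparr>"

definition quotient_module :: "('a, 'b, 'd) module_scheme \<Rightarrow> 'b set \<Rightarrow> ('a, 'b set) module" where
  "quotient_module M N =
     \<lparr>carrier = a_rcosets\<^bsub>M\<^esub> N, monoid.mult = undefined, one = undefined, ring.zero = N, ring.add = set_add M,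
      smult = (\<lambda>r C. \<Union>x\<in>C. N +>\<^bsub>M\<^esub> (r \<odot>\<^bsub>M\<^esub> x))\<rparr>"

lemma (in cring) regular_module_is_module: "module R (regular_module R)"
proof (rule moduleI)
  show "abelian_group (regular_module R)"
  proof (rule abelian_groupI)
    fix x assume "x \<in> carrier (regular_module R)"
    then show "\<exists>y\<in>carrier (regular_module R). y \<oplus>\<^bsub>regular_module R\<^esub> x = \<zero>\<^bsub>regular_module R\<^esub>"
      by (intro bexI[of _ "\<ominus> x"]) (simp_all add: regular_module_def l_neg)
  qed (simp_all add: regular_module_def a_ac)
qed (simp_all add: regular_module_def l_distr r_distr m_assoc is_cring)

lemma (in cring) submodule_regular_module_iff: "submodule I R (regular_module R) \<longleftrightarrow> ideal I R"
proof
  interpret M: module R "regular_module R" by (rule regular_module_is_module)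
  have sg: "subgroup I (add_monoid (regular_module R)) \<longleftrightarrow> subgroup I (add_monoid R)"
    by (simp add: subgroup_def m_inv_def regular_module_def)
  { assume I: "submodule I R (regular_module R)"
    show "ideal I R"
    proof (rule idealI)
      show "subgroup I (add_monoid R)" using submodule.axioms(1)[OF I] sg by blast
      fix a x assume a: "a \<in> I" "x \<in> carrier R"
      show "x \<otimes> a \<in> I" using submodule.smult_closed[OF I a(2,1)] by (simp add: regular_module_def)
      moreover have "a \<in> carrier R"
        using M.submoduleE(1)[OF I] a(1) by (auto simp: regular_module_def)
      ultimately show "a \<otimes> x \<in> I" using a m_comm by simp
    qed (rule ring_axioms) }
  { assume "ideal I R"
    then interpret ideal I R .
    show "submodule I R (regular_module R)"
      by (intro submodule.intro submodule_axioms.intro)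
        (use a_subgroup sg I_l_closed in \<open>auto simp: regular_module_def\<close>) }
qed

lemma (in module) quotient_module_smult:
  assumes N: "submodule N R M" and r: "r \<in> carrier R" and x: "x \<in> carrier M"
  shows "r \<odot>\<^bsub>quotient_module M N\<^esub> (N +>\<^bsub>M\<^esub> x) = N +>\<^bsub>M\<^esub> (r \<odot>\<^bsub>M\<^esub> x)"
proof -
  interpret N: abelian_subgroup N M
    using submodule.axioms(1)[OF N] by (intro abelian_subgroupI3 additive_subgroup.intro M.abelian_group_axioms)
  have *: "N +>\<^bsub>M\<^esub> (r \<odot>\<^bsub>M\<^esub> y) = N +>\<^bsub>M\<^esub> (r \<odot>\<^bsub>M\<^esub> x)" if "y \<in> N +>\<^bsub>M\<^esub> x" for y
  proof -
    from that obtain h where h: "h \<in> N" "y = h \<oplus>\<^bsub>M\<^esub> x" unfolding a_r_coset_def' by blast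
    have "h \<in> carrier M" using h(1) N.a_subset by blast
    then have "r \<odot>\<^bsub>M\<^esub> y = r \<odot>\<^bsub>M\<^esub> h \<oplus>\<^bsub>M\<^esub> r \<odot>\<^bsub>M\<^esub> x" using h r x by (simp add: smult_r_distr)
    then have "r \<odot>\<^bsub>M\<^esub> y \<in> N +>\<^bsub>M\<^esub> (r \<odot>\<^bsub>M\<^esub> x)"
      unfolding a_r_coset_def' using submodule.smult_closed[OF N r h(1)] by blast
    then show ?thesis by (rule N.a_repr_independence'[OF _ smult_closed[OF r x], symmetric])
  qed
  have "x \<in> N +>\<^bsub>M\<^esub> x" by (rule N.a_rcos_self[OF x])
  then have "(\<Union>y\<in>N +>\<^bsub>M\<^esub> x. N +>\<^bsub>M\<^esub> (r \<odot>\<^bsub>M\<^esub> y)) = N +>\<^bsub>M\<^esub> (r \<odot>\<^bsub>M\<^esub> x)"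
    using * by blast
  then show ?thesis by (simp add: quotient_module_def)
qed

lemma (in module) quotient_module_is_module:
  assumes N: "submodule N R M"
  shows "module R (quotient_module M N)"
proof -
  let ?Q = "quotient_module M N"
  interpret N: abelian_subgroup N M
    using submodule.axioms(1)[OF N] by (intro abelian_subgroupI3 additive_subgroup.intro M.abelian_group_axioms)
  have car: "carrier ?Q = {N +>\<^bsub>M\<^esub> x | x. x \<in> carrier M}"
    by (auto simp: quotient_module_def A_RCOSETS_def')
  have coset: "\<exists>x\<in>carrier M. C = N +>\<^bsub>M\<^esub> x" if "C \<in> carrier ?Q" for C
    using that unfolding car by blast
  have closed: "N +>\<^bsub>M\<^esub> x \<in> carrier ?Q" if "x \<in> carrier M" for x
    using that unfolding car by blast
  have add: "(N +>\<^bsub>M\<^esub> x) \<oplus>\<^bsub>?Q\<^esub> (N +>\<^bsub>M\<^esub> y) = N +>\<^bsub>M\<^esub> (x \<oplus>\<^bsub>M\<^esub> y)"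
    if "x \<in> carrier M" "y \<in> carrier M" for x y
    using N.a_rcos_sum that by (simp add: quotient_module_def)
  note smult = quotient_module_smult[OF N]
  have zero: "\<zero>\<^bsub>?Q\<^esub> = N +>\<^bsub>M\<^esub> \<zero>\<^bsub>M\<^esub>"
    using M.a_coset_join2 N.zero_closed N.a_subgroup by (simp add: quotient_module_def)
  have ag: "abelian_group ?Q"
  proof (rule abelian_groupI)
    show "\<zero>\<^bsub>?Q\<^esub> \<in> carrier ?Q" by (simp add: zero closed)
    fix C assume "C \<in> carrier ?Q"
    then obtain x where x: "x \<in> carrier M" "C = N +>\<^bsub>M\<^esub> x" using coset by blast
    then show "\<zero>\<^bsub>?Q\<^esub> \<oplus>\<^bsub>?Q\<^esub> C = C" by (simp add: add zero)
    have "(N +>\<^bsub>M\<^esub> (\<ominus>\<^bsub>M\<^esub> x)) \<oplus>\<^bsub>?Q\<^esub> C = \<zero>\<^bsub>?Q\<^esub>"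
      using x by (simp add: add zero M.l_neg)
    with x show "\<exists>D\<in>carrier ?Q. D \<oplus>\<^bsub>?Q\<^esub> C = \<zero>\<^bsub>?Q\<^esub>"
      by (intro bexI[of _ "N +>\<^bsub>M\<^esub> (\<ominus>\<^bsub>M\<^esub> x)"]) (auto intro: closed)
    fix D assume "D \<in> carrier ?Q"
    then obtain y where y: "y \<in> carrier M" "D = N +>\<^bsub>M\<^esub> y" using coset by blast
    show "C \<oplus>\<^bsub>?Q\<^esub> D \<in> carrier ?Q" "C \<oplus>\<^bsub>?Q\<^esub> D = D \<oplus>\<^bsub>?Q\<^esub> C"
      using x y by (simp_all add: add closed M.a_comm)
    fix E assume "E \<in> carrier ?Q"
    then obtain z where "z \<in> carrier M" "E = N +>\<^bsub>M\<^esub> z" using coset by blast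
    then show "C \<oplus>\<^bsub>?Q\<^esub> D \<oplus>\<^bsub>?Q\<^esub> E = C \<oplus>\<^bsub>?Q\<^esub> (D \<oplus>\<^bsub>?Q\<^esub> E)"
      using x y by (simp add: add M.a_assoc)
  qed
  show ?thesis
  proof (rule moduleI)
    fix C assume C: "C \<in> carrier ?Q"
    obtain x where x: "x \<in> carrier M" "C = N +>\<^bsub>M\<^esub> x" using coset[OF C] by blast
    show "\<one> \<odot>\<^bsub>?Q\<^esub> C = C"
      using x by (simp add: smult)
    fix a assume a: "a \<in> carrier R"
    show "a \<odot>\<^bsub>?Q\<^esub> C \<in> carrier ?Q"
      using a x by (simp add: closed smult)
    { fix b assume "b \<in> carrier R"
      then show "(a \<oplus> b) \<odot>\<^bsub>?Q\<^esub> C = a \<odot>\<^bsub>?Q\<^esub> C \<oplus>\<^bsub>?Q\<^esub> b \<odot>\<^bsub>?Q\<^esub> C"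
        and "(a \<otimes> b) \<odot>\<^bsub>?Q\<^esub> C = a \<odot>\<^bsub>?Q\<^esub> (b \<odot>\<^bsub>?Q\<^esub> C)"
        using a x by (simp_all add: add smult smult_l_distr smult_assoc1) }
    { fix D assume D: "D \<in> carrier ?Q"
      obtain y where "y \<in> carrier M" "D = N +>\<^bsub>M\<^esub> y" using coset[OF D] by blast
      then show "a \<odot>\<^bsub>?Q\<^esub> (C \<oplus>\<^bsub>?Q\<^esub> D) = a \<odot>\<^bsub>?Q\<^esub> C \<oplus>\<^bsub>?Q\<^esub> a \<odot>\<^bsub>?Q\<^esub> D"
        using a x by (simp add: add smult smult_r_distr) }
  qed (rule R.is_cring, rule ag)
qed


section \<open>Krull dimension\<close>

definition krull_dim :: "('a, 'c) ring_scheme \<Rightarrow> enat" where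
  "krull_dim R =
     Sup {enat n | n. \<exists>P :: nat \<Rightarrow> 'a set.
       (\<forall>i\<le>n. primeideal (P i) R) \<and> (\<forall>i<n. P i \<subset> P (Suc i))}"


section \<open>Localization and symbolic powers\<close>

definition fraction_rel :: "('a, 'c) ring_scheme \<Rightarrow> 'a set \<Rightarrow> (('a \<times> 'a) \<times> ('a \<times> 'a)) set" where
  "fraction_rel R S =
     {((a, s), (b, t)). a \<in> carrier R \<and> b \<in> carrier R \<and> s \<in> S \<and> t \<in> S \<and>
        (\<exists>u\<in>S. u \<otimes>\<^bsub>R\<^esub> (a \<otimes>\<^bsub>R\<^esub> t) = u \<otimes>\<^bsub>R\<^esub> (b \<otimes>\<^bsub>R\<^esub> s))}"

definition fraction :: "('a, 'c) ring_scheme \<Rightarrow> 'a set \<Rightarrow> 'a \<Rightarrow> 'a \<Rightarrow> ('a \<times> 'a) set" where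
  "fraction R S a s = fraction_rel R S `` {(a, s)}"

definition localization :: "('a, 'c) ring_scheme \<Rightarrow> 'a set \<Rightarrow> ('a \<times> 'a) set ring" where
  "localization R S =
     \<lparr>carrier = (carrier R \<times> S) // fraction_rel R S,
      monoid.mult = (\<lambda>C D. \<Union>(a, s)\<in>C. \<Union>(b, t)\<in>D. fraction R S (a \<otimes>\<^bsub>R\<^esub> b) (s \<otimes>\<^bsub>R\<^esub> t)),
      one = fraction R S \<one>\<^bsub>R\<^esub> \<one>\<^bsub>R\<^esub>,
      ring.zero = fraction R S \<zero>\<^bsub>R\<^esub> \<one>\<^bsub>R\<^esub>,
      ring.add = (\<lambda>C D. \<Union>(a, s)\<in>C. \<Union>(b, t)\<in>D.
               fraction R S (a \<otimes>\<^bsub>R\<^esub> t \<oplus>\<^bsub>R\<^esub> b \<otimes>\<^bsub>R\<^esub> s) (s \<otimes>\<^bsub>R\<^esub> t))\<rparr>"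

locale multiplicative_subset = cring R for R :: "('a, 'c) ring_scheme" (structure) and S :: "'a set" +
  assumes subset: "S \<subseteq> carrier R"
    and one_in: "\<one> \<in> S"
    and mult_in: "\<lbrakk>s \<in> S; t \<in> S\<rbrakk> \<Longrightarrow> s \<otimes> t \<in> S"
begin

lemma in_carrier [simp]: "s \<in> S \<Longrightarrow> s \<in> carrier R"
  using subset by auto

lemma fraction_relI:
  "\<lbrakk>a \<in> carrier R; b \<in> carrier R; s \<in> S; t \<in> S; u \<in> S;
    u \<otimes> (a \<otimes> t) = u \<otimes> (b \<otimes> s)\<rbrakk> \<Longrightarrow> ((a, s), (b, t)) \<in> fraction_rel R S"
  unfolding fraction_rel_def by blast

lemma equiv_fraction_rel: "equiv (carrier R \<times> S) (fraction_rel R S)"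
proof (rule equivI)
  show "fraction_rel R S \<subseteq> (carrier R \<times> S) \<times> (carrier R \<times> S)"
    unfolding fraction_rel_def by auto
  show "refl_on (carrier R \<times> S) (fraction_rel R S)"
    unfolding refl_on_def fraction_rel_def using one_in by auto
  show "sym (fraction_rel R S)"
    by (rule symI) (auto simp: fraction_rel_def, metis)
  show "trans (fraction_rel R S)"
  proof (rule transI)
    fix x y z assume xy: "(x, y) \<in> fraction_rel R S" and yz: "(y, z) \<in> fraction_rel R S"
    obtain a s b t c w where x: "x = (a, s)" and y: "y = (b, t)" and z: "z = (c, w)"
      by (cases x, cases y, cases z) auto
    from xy obtain u where c1: "a \<in> carrier R" "b \<in> carrier R" "s \<in> S" "t \<in> S" "u \<in> S"
      and u: "u \<otimes> (a \<otimes> t) = u \<otimes> (b \<otimes> s)"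
      unfolding fraction_rel_def x y by auto
    from yz obtain v where c2: "c \<in> carrier R" "w \<in> S" "v \<in> S"
      and v: "v \<otimes> (b \<otimes> w) = v \<otimes> (c \<otimes> t)"
      unfolding fraction_rel_def y z by auto
    have "(u \<otimes> v \<otimes> t) \<otimes> (a \<otimes> w) = (v \<otimes> w) \<otimes> (u \<otimes> (a \<otimes> t))"
      using c1 c2 by (simp add: m_ac)
    also have "\<dots> = (u \<otimes> s) \<otimes> (v \<otimes> (b \<otimes> w))"
      unfolding u using c1 c2 by (simp add: m_ac)
    also have "\<dots> = (u \<otimes> v \<otimes> t) \<otimes> (c \<otimes> s)"
      unfolding v using c1 c2 by (simp add: m_ac)
    finally show "(x, z) \<in> fraction_rel R S"
      unfolding x z using c1 c2 by (intro fraction_relI[of _ _ _ _ "u \<otimes> v \<otimes> t"]) (auto intro: mult_in)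
  qed
qed

lemma fraction_eq_iff:
  assumes "a \<in> carrier R" "b \<in> carrier R" "s \<in> S" "t \<in> S"
  shows "fraction R S a s = fraction R S b t \<longleftrightarrow> (\<exists>u\<in>S. u \<otimes> (a \<otimes> t) = u \<otimes> (b \<otimes> s))"
proof -
  have "fraction R S a s = fraction R S b t \<longleftrightarrow> ((a, s), (b, t)) \<in> fraction_rel R S"
    unfolding fraction_def using assms by (intro eq_equiv_class_iff[OF equiv_fraction_rel]) auto
  also have "\<dots> \<longleftrightarrow> (\<exists>u\<in>S. u \<otimes> (a \<otimes> t) = u \<otimes> (b \<otimes> s))"
    unfolding fraction_rel_def using assms by simp
  finally show ?thesis .
qed

lemma fraction_eqI:
  "\<lbrakk>u \<in> S; u \<otimes> (a \<otimes> t) = u \<otimes> (b \<otimes> s);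
    a \<in> carrier R; b \<in> carrier R; s \<in> S; t \<in> S\<rbrakk> \<Longrightarrow> fraction R S a s = fraction R S b t"
  using fraction_eq_iff by blast

lemma carrier_localization: "carrier (localization R S) = {fraction R S a s | a s. a \<in> carrier R \<and> s \<in> S}"
  unfolding localization_def fraction_def quotient_def by auto

lemma fraction_in_carrier [simp, intro]:
  "\<lbrakk>a \<in> carrier R; s \<in> S\<rbrakk> \<Longrightarrow> fraction R S a s \<in> carrier (localization R S)"
  unfolding carrier_localization by blast

lemma localization_cases:
  assumes "x \<in> carrier (localization R S)"
  obtains a s where "a \<in> carrier R" "s \<in> S" "x = fraction R S a s"
  using assms unfolding carrier_localization by blast

lemma fraction_self: "\<lbrakk>a \<in> carrier R; s \<in> S\<rbrakk> \<Longrightarrow> (a, s) \<in> fraction R S a s"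
  unfolding fraction_def using equiv_class_self[OF equiv_fraction_rel] by auto

lemma fraction_memE:
  assumes "(b, t) \<in> fraction R S a s"
  obtains u where "a \<in> carrier R" "s \<in> S" "b \<in> carrier R" "t \<in> S" "u \<in> S"
    "u \<otimes> (a \<otimes> t) = u \<otimes> (b \<otimes> s)"
  using assms unfolding fraction_def fraction_rel_def by auto

lemma localization_mult:
  assumes "a \<in> carrier R" "s \<in> S" "b \<in> carrier R" "t \<in> S"
  shows "fraction R S a s \<otimes>\<^bsub>localization R S\<^esub> fraction R S b t = fraction R S (a \<otimes> b) (s \<otimes> t)"
proof -
  have *: "fraction R S (a' \<otimes> b') (s' \<otimes> t') = fraction R S (a \<otimes> b) (s \<otimes> t)"
    if "(a', s') \<in> fraction R S a s" "(b', t') \<in> fraction R S b t" for a' s' b' t'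
  proof -
    from that(1) obtain u where 1: "a' \<in> carrier R" "s' \<in> S" "u \<in> S" "u \<otimes> (a \<otimes> s') = u \<otimes> (a' \<otimes> s)"
      by (rule fraction_memE)
    from that(2) obtain v where 2: "b' \<in> carrier R" "t' \<in> S" "v \<in> S" "v \<otimes> (b \<otimes> t') = v \<otimes> (b' \<otimes> t)"
      by (rule fraction_memE)
    have "(u \<otimes> v) \<otimes> (a' \<otimes> b' \<otimes> (s \<otimes> t)) = (u \<otimes> (a' \<otimes> s)) \<otimes> (v \<otimes> (b' \<otimes> t))"
      using 1(1-3) 2(1-3) assms by (simp add: m_ac)
    also have "\<dots> = (u \<otimes> (a \<otimes> s')) \<otimes> (v \<otimes> (b \<otimes> t'))"
      by (simp only: 1(4) 2(4))
    also have "\<dots> = (u \<otimes> v) \<otimes> (a \<otimes> b \<otimes> (s' \<otimes> t'))"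
      using 1(1-3) 2(1-3) assms by (simp add: m_ac)
    finally show ?thesis
      using 1(1-3) 2(1-3) assms by (intro fraction_eqI[of "u \<otimes> v"]) (auto intro: mult_in)
  qed
  have "(\<Union>(a', s')\<in>fraction R S a s. \<Union>(b', t')\<in>fraction R S b t.
      fraction R S (a' \<otimes> b') (s' \<otimes> t')) = fraction R S (a \<otimes> b) (s \<otimes> t)"
  proof (intro equalityI subsetI)
    fix z assume "z \<in> (\<Union>(a', s')\<in>fraction R S a s. \<Union>(b', t')\<in>fraction R S b t.
      fraction R S (a' \<otimes> b') (s' \<otimes> t'))"
    then obtain a' s' b' t' where p: "(a', s') \<in> fraction R S a s" "(b', t') \<in> fraction R S b t"
      and "z \<in> fraction R S (a' \<otimes> b') (s' \<otimes> t')"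
      by blast
    then show "z \<in> fraction R S (a \<otimes> b) (s \<otimes> t)" using *[OF p] by blast
  next
    fix z assume "z \<in> fraction R S (a \<otimes> b) (s \<otimes> t)"
    with fraction_self[OF assms(1,2)] fraction_self[OF assms(3,4)]
    show "z \<in> (\<Union>(a', s')\<in>fraction R S a s. \<Union>(b', t')\<in>fraction R S b t.
      fraction R S (a' \<otimes> b') (s' \<otimes> t'))"
      by blast
  qed
  then show ?thesis
    unfolding localization_def by simp
qed

lemma localization_add:
  assumes "a \<in> carrier R" "s \<in> S" "b \<in> carrier R" "t \<in> S"
  shows "fraction R S a s \<oplus>\<^bsub>localization R S\<^esub> fraction R S b t
    = fraction R S (a \<otimes> t \<oplus> b \<otimes> s) (s \<otimes> t)"
proof -
  have *: "fraction R S (a' \<otimes> t' \<oplus> b' \<otimes> s') (s' \<otimes> t') = fraction R S (a \<otimes> t \<oplus> b \<otimes> s) (s \<otimes> t)"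
    if "(a', s') \<in> fraction R S a s" "(b', t') \<in> fraction R S b t" for a' s' b' t'
  proof -
    from that(1) obtain u where 1: "a' \<in> carrier R" "s' \<in> S" "u \<in> S" "u \<otimes> (a \<otimes> s') = u \<otimes> (a' \<otimes> s)"
      by (rule fraction_memE)
    from that(2) obtain v where 2: "b' \<in> carrier R" "t' \<in> S" "v \<in> S" "v \<otimes> (b \<otimes> t') = v \<otimes> (b' \<otimes> t)"
      by (rule fraction_memE)
    have "(u \<otimes> v) \<otimes> ((a' \<otimes> t' \<oplus> b' \<otimes> s') \<otimes> (s \<otimes> t))
        = (v \<otimes> t \<otimes> t') \<otimes> (u \<otimes> (a' \<otimes> s)) \<oplus> (u \<otimes> s \<otimes> s') \<otimes> (v \<otimes> (b' \<otimes> t))"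
      using 1(1-3) 2(1-3) assms by (simp add: m_ac l_distr r_distr)
    also have "\<dots> = (v \<otimes> t \<otimes> t') \<otimes> (u \<otimes> (a \<otimes> s')) \<oplus> (u \<otimes> s \<otimes> s') \<otimes> (v \<otimes> (b \<otimes> t'))"
      by (simp only: 1(4) 2(4))
    also have "\<dots> = (u \<otimes> v) \<otimes> ((a \<otimes> t \<oplus> b \<otimes> s) \<otimes> (s' \<otimes> t'))"
      using 1(1-3) 2(1-3) assms by (simp add: m_ac l_distr r_distr)
    finally show ?thesis
      using 1(1-3) 2(1-3) assms by (intro fraction_eqI[of "u \<otimes> v"]) (auto intro: mult_in)
  qed
  have "(\<Union>(a', s')\<in>fraction R S a s. \<Union>(b', t')\<in>fraction R S b t.
      fraction R S (a' \<otimes> t' \<oplus> b' \<otimes> s') (s' \<otimes> t')) = fraction R S (a \<otimes> t \<oplus> b \<otimes> s) (s \<otimes> t)"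
  proof (intro equalityI subsetI)
    fix z assume "z \<in> (\<Union>(a', s')\<in>fraction R S a s. \<Union>(b', t')\<in>fraction R S b t.
      fraction R S (a' \<otimes> t' \<oplus> b' \<otimes> s') (s' \<otimes> t'))"
    then obtain a' s' b' t' where p: "(a', s') \<in> fraction R S a s" "(b', t') \<in> fraction R S b t"
      and "z \<in> fraction R S (a' \<otimes> t' \<oplus> b' \<otimes> s') (s' \<otimes> t')"
      by blast
    then show "z \<in> fraction R S (a \<otimes> t \<oplus> b \<otimes> s) (s \<otimes> t)" using *[OF p] by blast
  next
    fix z assume "z \<in> fraction R S (a \<otimes> t \<oplus> b \<otimes> s) (s \<otimes> t)"
    with fraction_self[OF assms(1,2)] fraction_self[OF assms(3,4)]
    show "z \<in> (\<Union>(a', s')\<in>fraction R S a s. \<Union>(b', t')\<in>fraction R S b t.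
      fraction R S (a' \<otimes> t' \<oplus> b' \<otimes> s') (s' \<otimes> t'))"
      by blast
  qed
  then show ?thesis
    unfolding localization_def by simp
qed

lemma localization_one: "\<one>\<^bsub>localization R S\<^esub> = fraction R S \<one> \<one>"
  and localization_zero: "\<zero>\<^bsub>localization R S\<^esub> = fraction R S \<zero> \<one>"
  unfolding localization_def by auto

lemmas localization_simps = localization_mult localization_add localization_one localization_zero

lemma localization_is_cring: "cring (localization R S)"
proof (rule cringI)
  show "abelian_group (localization R S)"
  proof (rule abelian_groupI)
    show "\<zero>\<^bsub>localization R S\<^esub> \<in> carrier (localization R S)"
      by (simp add: localization_zero one_in fraction_in_carrier)
    fix x assume "x \<in> carrier (localization R S)"
    then obtain a s where x: "a \<in> carrier R" "s \<in> S" "x = fraction R S a s"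
      by (rule localization_cases)
    then show "\<zero>\<^bsub>localization R S\<^esub> \<oplus>\<^bsub>localization R S\<^esub> x = x"
      by (simp add: localization_simps one_in)
    have "\<ominus> a \<otimes> s \<oplus> a \<otimes> s = \<zero>"
      using x by (simp add: l_distr[symmetric] l_neg)
    then have "fraction R S (\<ominus> a) s \<oplus>\<^bsub>localization R S\<^esub> x = \<zero>\<^bsub>localization R S\<^esub>"
      using x one_in mult_in by (simp add: localization_simps) (intro fraction_eqI[of \<one>]; simp)
    with x show "\<exists>y\<in>carrier (localization R S). y \<oplus>\<^bsub>localization R S\<^esub> x = \<zero>\<^bsub>localization R S\<^esub>"
      by (intro bexI[of _ "fraction R S (\<ominus> a) s"]) auto
    fix y assume "y \<in> carrier (localization R S)"
    then obtain b t where y: "b \<in> carrier R" "t \<in> S" "y = fraction R S b t"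
      by (rule localization_cases)
    show "x \<oplus>\<^bsub>localization R S\<^esub> y \<in> carrier (localization R S)"
      using x y by (simp add: localization_simps mult_in fraction_in_carrier)
    show "x \<oplus>\<^bsub>localization R S\<^esub> y = y \<oplus>\<^bsub>localization R S\<^esub> x"
      using x y by (simp add: localization_simps m_comm a_comm)
    fix z assume "z \<in> carrier (localization R S)"
    then obtain c w where z: "c \<in> carrier R" "w \<in> S" "z = fraction R S c w"
      by (rule localization_cases)
    have "(a \<otimes> t \<oplus> b \<otimes> s) \<otimes> w \<oplus> c \<otimes> (s \<otimes> t) = a \<otimes> (t \<otimes> w) \<oplus> (b \<otimes> w \<oplus> c \<otimes> t) \<otimes> s"
      using x y z by (simp add: l_distr r_distr m_ac a_ac)
    then show "x \<oplus>\<^bsub>localization R S\<^esub> y \<oplus>\<^bsub>localization R S\<^esub> z = x \<oplus>\<^bsub>localization R S\<^esub> (y \<oplus>\<^bsub>localization R S\<^esub> z)"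
      using x y z by (simp add: localization_simps mult_in m_assoc)
  qed
  show "comm_monoid (localization R S)"
  proof (rule comm_monoidI)
    show "\<one>\<^bsub>localization R S\<^esub> \<in> carrier (localization R S)"
      by (simp add: localization_one one_in fraction_in_carrier)
    fix x assume "x \<in> carrier (localization R S)"
    then obtain a s where x: "a \<in> carrier R" "s \<in> S" "x = fraction R S a s"
      by (rule localization_cases)
    then show "\<one>\<^bsub>localization R S\<^esub> \<otimes>\<^bsub>localization R S\<^esub> x = x"
      by (simp add: localization_simps one_in)
    fix y assume "y \<in> carrier (localization R S)"
    then obtain b t where y: "b \<in> carrier R" "t \<in> S" "y = fraction R S b t"
      by (rule localization_cases)
    show "x \<otimes>\<^bsub>localization R S\<^esub> y \<in> carrier (localization R S)"
      using x y by (simp add: localization_simps mult_in fraction_in_carrier)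
    show "x \<otimes>\<^bsub>localization R S\<^esub> y = y \<otimes>\<^bsub>localization R S\<^esub> x"
      using x y by (simp add: localization_simps m_comm)
    fix z assume "z \<in> carrier (localization R S)"
    then obtain c w where z: "c \<in> carrier R" "w \<in> S" "z = fraction R S c w"
      by (rule localization_cases)
    show "x \<otimes>\<^bsub>localization R S\<^esub> y \<otimes>\<^bsub>localization R S\<^esub> z = x \<otimes>\<^bsub>localization R S\<^esub> (y \<otimes>\<^bsub>localization R S\<^esub> z)"
      using x y z by (simp add: localization_simps mult_in m_assoc)
  qed
  fix x y z
  assume "x \<in> carrier (localization R S)" "y \<in> carrier (localization R S)" "z \<in> carrier (localization R S)"
  then obtain a s b t c w where x: "a \<in> carrier R" "s \<in> S" "x = fraction R S a s"
    and y: "b \<in> carrier R" "t \<in> S" "y = fraction R S b t"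
    and z: "c \<in> carrier R" "w \<in> S" "z = fraction R S c w"
    by (metis localization_cases)
  have "fraction R S ((a \<otimes> t \<oplus> b \<otimes> s) \<otimes> c) (s \<otimes> t \<otimes> w)
      = fraction R S (a \<otimes> c \<otimes> (t \<otimes> w) \<oplus> b \<otimes> c \<otimes> (s \<otimes> w)) (s \<otimes> w \<otimes> (t \<otimes> w))"
    using x(1,2) y(1,2) z(1,2)
    by (intro fraction_eqI[of \<one>]) (simp_all add: one_in mult_in m_ac l_distr r_distr)
  then show "(x \<oplus>\<^bsub>localization R S\<^esub> y) \<otimes>\<^bsub>localization R S\<^esub> z
      = x \<otimes>\<^bsub>localization R S\<^esub> z \<oplus>\<^bsub>localization R S\<^esub> y \<otimes>\<^bsub>localization R S\<^esub> z"
    using x y z by (simp add: localization_simps mult_in)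
qed

end

lemma (in primeideal) multiplicative_subset_complement: "multiplicative_subset R (carrier R - I)"
  using I_prime one_imp_carrier I_notcarr by unfold_locales auto

definition symbolic_power :: "('a, 'c) ring_scheme \<Rightarrow> 'a set \<Rightarrow> nat \<Rightarrow> 'a set" where
  "symbolic_power R P n =
     (let S = carrier R - P; \<iota> = (\<lambda>r. fraction R S r \<one>\<^bsub>R\<^esub>)
      in {r \<in> carrier R. \<iota> r \<in> genideal (localization R S) (\<iota> ` (P [^]\<^bsub>ideals_set R\<^esub> n))})"


section \<open>Standard graded algebras\<close>

text \<open>A standard graded algebra over the field \<open>K\<close> is a commutative ring with a decomposition
  \<open>R = \<Oplus>\<^sub>i G i\<close> such that \<open>G 0 = K\<close>, generated over \<open>K\<close> by finitely many elements of degree one.\<close>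

locale standard_graded_algebra = cring R
  for K :: "'a set" and R :: "('a, 'c) ring_scheme" (structure) and G :: "nat \<Rightarrow> 'a set" +
  assumes subfield_K: "subfield K R"
    and degree_zero: "G 0 = K"
    and additive_subgroup_G: "additive_subgroup (G i) R"
    and mult_G: "\<lbrakk>a \<in> G i; b \<in> G j\<rbrakk> \<Longrightarrow> a \<otimes> b \<in> G (i + j)"
    and direct_sum: "r \<in> carrier R \<Longrightarrow>
      \<exists>!f. (\<forall>i. f i \<in> G i) \<and> finite {i. f i \<noteq> \<zero>} \<and> r = (\<Oplus>i\<in>{i. f i \<noteq> \<zero>}. f i)"
    and generated_in_degree_one:
      "\<exists>B. finite B \<and> B \<subseteq> G 1 \<and> generate_ring R (K \<union> B) = carrier R"

definition homogeneous :: "(nat \<Rightarrow> 'a set) \<Rightarrow> 'a \<Rightarrow> bool" where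
  "homogeneous G x \<longleftrightarrow> (\<exists>i. x \<in> G i)"

definition homogeneous_ideal :: "('a, 'c) ring_scheme \<Rightarrow> (nat \<Rightarrow> 'a set) \<Rightarrow> 'a set \<Rightarrow> bool" where
  "homogeneous_ideal R G I \<longleftrightarrow> (\<exists>H. (\<forall>h\<in>H. homogeneous G h) \<and> I = genideal R H)"

end

theory Submission
  imports Defs
begin

text \<open>Write \<open>H = P\<^sup>(\<^sup>n\<^sup>)\<close> and \<open>I = P\<^sup>n\<close>. If \<open>y \<notin> P\<close> and \<open>y H \<subseteq> I\<close>, then \<open>H/I\<close> is the annihilator of both
  \<open>y\<close> and \<open>y\<^sup>2\<close> in \<open>R/I\<close>, and comparing \<open>R/(I + y)\<close> with \<open>(I + y)/(I + y\<^sup>2)\<close> through multiplication by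
  \<open>y\<close> gives the length formula. So a single homogeneous \<open>x \<notin> P\<close> with \<open>x\<^sup>n P\<^sup>(\<^sup>n\<^sup>) \<subseteq> P\<^sup>n\<close> for all \<open>n\<close> is needed.
  The associated graded ring of \<open>P\<close> is noetherian, hence one \<open>x\<close> annihilates all of its torsion over
  \<open>R/P\<close>; such an \<open>x\<close> maps \<open>P\<^sup>(\<^sup>n\<^sup>) \<inter> P\<^sup>k\<close> into \<open>P\<^sup>k\<^sup>+\<^sup>1\<close> for \<open>k < n\<close>. The lengths are finite because
  \<open>dim R/P = 1\<close> forces every element of degree one to be nilpotent modulo \<open>I + (x\<^sup>m)\<close>.\<close>

section \<open>Lengths of intervals of ideals\<close>

text \<open>The obstacle is uniformity in \<open>n\<close>. For a single \<open>n\<close>, finite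
  generation of \<open>P^(n)\<close> gives some element outside \<open>P\<close> that carries it
  into \<open>P^n\<close>, but \<open>x\<close> must be fixed before \<open>n\<close>. The exponent
  of \<open>x^n\<close> is the price of one \<open>x\<close> for all \<open>n\<close>: each factor
  raises the \<open>P\<close>-adic order by one, and \<open>n\<close> factors lead from
  \<open>P^0\<close> to \<open>P^n\<close>. Homogeneity of \<open>x\<close> needs an argument of its
  own. The noetherian choice is made among homogeneous elements and controls homogeneous multipliers
  only, whereas the denominators behind \<open>P^(n)\<close> are arbitrary elements outside
  \<open>P\<close>; comparing top degree parts bridges the gap. In return \<open>P^n + (x^m)\<close>
  is a graded ideal, so that the finiteness proof can look for a graded prime above it. Lengths are
  measured by chains of ideals of \<open>R\<close> in an interval, which keeps the computation out
  of quotient modules. The formula is first proved as a sum in \<open>enat\<close>, where it holds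
  without finiteness, and is turned into a subtraction of integers at the very end.\<close>

definition ideal_chain :: "('a, 'c) ring_scheme \<Rightarrow> 'a set \<Rightarrow> 'a set \<Rightarrow> nat \<Rightarrow> (nat \<Rightarrow> 'a set) \<Rightarrow> bool" where
  "ideal_chain R I J n N \<longleftrightarrow>
     (\<forall>i\<le>n. ideal (N i) R \<and> I \<subseteq> N i \<and> N i \<subseteq> J) \<and> (\<forall>i<n. N i \<subset> N (Suc i))"

text \<open>The length of the module \<open>J/I\<close>, read off from the lattice of ideals of
  \<open>R\<close>; \<open>module_length_quotient\<close> makes the link.\<close>

definition ideal_length :: "('a, 'c) ring_scheme \<Rightarrow> 'a set \<Rightarrow> 'a set \<Rightarrow> enat" where
  "ideal_length R I J = Sup {enat n | n. \<exists>N. ideal_chain R I J n N}"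

lemma ideal_length_ge: "ideal_chain R I J n N \<Longrightarrow> enat n \<le> ideal_length R I J"
  unfolding ideal_length_def by (rule Sup_upper) blast

lemma ideal_length_le: "(\<And>n N. ideal_chain R I J n N \<Longrightarrow> enat n \<le> b) \<Longrightarrow> ideal_length R I J \<le> b"
  unfolding ideal_length_def by (rule Sup_least) blast

lemma ideal_length_interval_mono:
  assumes "I' \<subseteq> I" "J \<subseteq> J'"
  shows "ideal_length R I J \<le> ideal_length R I' J'"
proof (rule ideal_length_le)
  fix n N assume "ideal_chain R I J n N"
  then have "ideal_chain R I' J' n N"
    unfolding ideal_chain_def using assms by (meson subset_trans)
  then show "enat n \<le> ideal_length R I' J'" by (rule ideal_length_ge)
qed

text \<open>A finite supremum of naturals is a maximum. This supplies actual chains to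
  concatenate.\<close>

lemma ideal_length_attained:
  assumes "ideal I R" "I \<subseteq> J" "ideal_length R I J = enat n"
  obtains N where "ideal_chain R I J n N"
proof -
  let ?S = "{enat n | n. \<exists>N. ideal_chain R I J n N}"
  have "ideal_chain R I J 0 (\<lambda>_. I)" using assms by (simp add: ideal_chain_def)
  then have ne: "?S \<noteq> {}" by blast
  have S: "Sup ?S = enat n" using assms(3) by (simp add: ideal_length_def)
  have "?S \<subseteq> enat ` {..n}"
  proof
    fix z assume z: "z \<in> ?S"
    then have "z \<le> enat n" using S Sup_upper[OF z] by simp
    with z show "z \<in> enat ` {..n}" by auto
  qed
  then have "finite ?S" using finite_surj by blast
  then have "Sup ?S \<in> ?S" unfolding Sup_enat_def using ne by (simp only: if_False if_True simp_thms) (rule Max_in)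
  then show ?thesis using S that by auto
qed

text \<open>At the junction \<open>N 0\<close> is skipped: \<open>M m\<close> is followed by
  \<open>N 1\<close>, and the step is strict because \<open>M m\<close> lies in \<open>J\<close>,
  hence in \<open>N 0\<close>.\<close>

lemma ideal_chain_append:
  assumes "ideal_chain R I J m M" "ideal_chain R J L n N"
  shows "ideal_chain R I L (m + n) (\<lambda>i. if i \<le> m then M i else N (i - m))"
proof -
  have M: "ideal (M i) R" "I \<subseteq> M i" "M i \<subseteq> J" if "i \<le> m" for i
    using assms(1) that by (auto simp: ideal_chain_def)
  have N: "ideal (N i) R" "J \<subseteq> N i" "N i \<subseteq> L" if "i \<le> n" for i
    using assms(2) that by (auto simp: ideal_chain_def)
  have Ms: "M i \<subset> M (Suc i)" if "i < m" for i using assms(1) that by (auto simp: ideal_chain_def)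
  have Ns: "N i \<subset> N (Suc i)" if "i < n" for i using assms(2) that by (auto simp: ideal_chain_def)
  show ?thesis
    unfolding ideal_chain_def
  proof (intro conjI allI impI)
    fix i assume i: "i \<le> m + n"
    have IJ: "I \<subseteq> J" and JL: "J \<subseteq> L" and k: "i - m \<le> n" using M[of 0] N[of 0] i by auto
    show "ideal (if i \<le> m then M i else N (i - m)) R" using M(1) N(1)[OF k] by simp
    show "I \<subseteq> (if i \<le> m then M i else N (i - m))"
      using M(2) subset_trans[OF IJ N(2)[OF k]] by simp
    show "(if i \<le> m then M i else N (i - m)) \<subseteq> L"
      using subset_trans[OF M(3) JL] N(3)[OF k] by simp
  next
    fix i assume i: "i < m + n"
    consider "i < m" | "i = m" | "i > m" by linarith
    then show "(if i \<le> m then M i else N (i - m)) \<subset> (if Suc i \<le> m then M (Suc i) else N (Suc i - m))"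
    proof cases
      case 1 then show ?thesis using Ms by simp
    next
      case 2
      then have "M m \<subseteq> N 0" "N 0 \<subset> N 1" using M[of m] N[of 0] Ns[of 0] i by auto
      then show ?thesis using 2 by auto
    next
      case 3
      then show ?thesis using Ns[of "i - m"] i by (simp add: Suc_diff_le)
    qed
  qed
qed

lemma ideal_length_superadditive:
  assumes "ideal I R" "ideal J R" "I \<subseteq> J" "J \<subseteq> L"
  shows "ideal_length R I J + ideal_length R J L \<le> ideal_length R I L"
proof (cases "ideal_length R I L")
  case (enat l)
  have b1: "ideal_length R I J \<le> enat l"
    unfolding enat[symmetric]
    by (rule ideal_length_interval_mono) (use assms in auto)
  have b2: "ideal_length R J L \<le> enat l"
    unfolding enat[symmetric]
    by (rule ideal_length_interval_mono) (use assms in auto)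
  obtain m where m: "ideal_length R I J = enat m" using b1 enat_ile by blast
  obtain n where n: "ideal_length R J L = enat n" using b2 enat_ile by blast
  from ideal_length_attained[OF assms(1,3) m] obtain M where "ideal_chain R I J m M" .
  moreover from ideal_length_attained[OF assms(2,4) n] obtain N where "ideal_chain R J L n N" .
  ultimately have "enat (m + n) \<le> ideal_length R I L"
    by (rule ideal_length_ge[OF ideal_chain_append])
  then show ?thesis using m n by simp
qed simp

text \<open>Strictly increasing maps carry chains to chains. Equalities of lengths below come from
  using this twice, for two mutually inverse maps between intervals.\<close>

lemma ideal_length_mono:
  assumes "\<And>U. \<lbrakk>ideal U R; I \<subseteq> U; U \<subseteq> J\<rbrakk> \<Longrightarrow> ideal (f U) R \<and> I' \<subseteq> f U \<and> f U \<subseteq> J'"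
    and "\<And>U Y. \<lbrakk>ideal U R; I \<subseteq> U; ideal Y R; Y \<subseteq> J; U \<subset> Y\<rbrakk> \<Longrightarrow> f U \<subset> f Y"
  shows "ideal_length R I J \<le> ideal_length R I' J'"
proof (rule ideal_length_le)
  fix n N assume N: "ideal_chain R I J n N"
  have "ideal_chain R I' J' n (\<lambda>i. f (N i))"
    unfolding ideal_chain_def
  proof (intro conjI allI impI)
    fix i assume "i < n"
    then show "f (N i) \<subset> f (N (Suc i))"
      using N by (intro assms(2)) (auto simp: ideal_chain_def)
  qed (use N assms(1) in \<open>auto simp: ideal_chain_def\<close>)
  then show "enat n \<le> ideal_length R I' J'" by (rule ideal_length_ge)
qed

lemma ideal_length_strict_mono:
  assumes "ideal I R" "ideal U R" "ideal Y R" "I \<subseteq> U" "U \<subset> Y"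
  shows "ideal_length R I U + 1 \<le> ideal_length R I Y"
proof -
  have "ideal_chain R U Y 1 (\<lambda>i. if i = 0 then U else Y)"
    using assms by (auto simp: ideal_chain_def)
  then have "1 \<le> ideal_length R U Y" using ideal_length_ge by (metis one_enat_def)
  then have "ideal_length R I U + 1 \<le> ideal_length R I U + ideal_length R U Y"
    by (simp add: add_left_mono)
  also have "\<dots> \<le> ideal_length R I Y"
    using assms by (intro ideal_length_superadditive) auto
  finally show ?thesis .
qed

section \<open>Additivity of length, and the effect of multiplication by an element\<close>

context cring
begin

lemma set_add_mem_iff: "z \<in> I <+>\<^bsub>R\<^esub> J \<longleftrightarrow> (\<exists>a\<in>I. \<exists>b\<in>J. z = a \<oplus> b)"
  by (auto simp: set_add_def')

lemma set_addI: "\<lbrakk>a \<in> I; b \<in> J\<rbrakk> \<Longrightarrow> a \<oplus> b \<in> I <+>\<^bsub>R\<^esub> J"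
  unfolding set_add_mem_iff by blast

lemma set_addE:
  assumes "z \<in> I <+>\<^bsub>R\<^esub> J"
  obtains a b where "a \<in> I" "b \<in> J" "z = a \<oplus> b"
  using assms unfolding set_add_mem_iff by blast

lemma ideal_zero_closed: "ideal I R \<Longrightarrow> \<zero> \<in> I"
  by (simp add: additive_subgroup.zero_closed ideal.axioms(1))

lemma ideal_add_closed: "\<lbrakk>ideal I R; a \<in> I; b \<in> I\<rbrakk> \<Longrightarrow> a \<oplus> b \<in> I"
  by (simp add: additive_subgroup.a_closed ideal.axioms(1))

lemma ideal_neg_closed: "\<lbrakk>ideal I R; a \<in> I\<rbrakk> \<Longrightarrow> \<ominus> a \<in> I"
  by (simp add: additive_subgroup.a_inv_closed ideal.axioms(1))

lemma set_add_upper: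
  assumes "ideal I R" "ideal J R"
  shows "I \<subseteq> I <+>\<^bsub>R\<^esub> J" "J \<subseteq> I <+>\<^bsub>R\<^esub> J"
proof -
  have z: "\<zero> \<in> I" "\<zero> \<in> J" using assms by (auto simp: additive_subgroup.zero_closed ideal.axioms(1))
  show "I \<subseteq> I <+>\<^bsub>R\<^esub> J"
  proof
    fix a assume "a \<in> I"
    then show "a \<in> I <+>\<^bsub>R\<^esub> J"
      using set_addI[of a I \<zero> J] z assms by (simp add: ideal.Icarr)
  qed
  show "J \<subseteq> I <+>\<^bsub>R\<^esub> J"
  proof
    fix a assume "a \<in> J"
    then show "a \<in> I <+>\<^bsub>R\<^esub> J"
      using set_addI[of \<zero> I a J] z assms by (simp add: ideal.Icarr)
  qed
qed

lemma set_add_mono: "\<lbrakk>I \<subseteq> I'; J \<subseteq> J'\<rbrakk> \<Longrightarrow> I <+>\<^bsub>R\<^esub> J \<subseteq> I' <+>\<^bsub>R\<^esub> J'"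
  unfolding set_add_mem_iff subset_iff by blast

lemma set_add_least:
  assumes "ideal L R" "I \<subseteq> L" "J \<subseteq> L"
  shows "I <+>\<^bsub>R\<^esub> J \<subseteq> L"
  using assms ideal_add_closed[OF assms(1)] by (blast elim: set_addE)

lemma ideal_diff_mem:
  assumes "ideal I R" "a \<in> I" "a \<oplus> b \<in> I" "b \<in> carrier R"
  shows "b \<in> I"
proof -
  have a: "a \<in> carrier R" using assms by (simp add: ideal.Icarr)
  have "\<ominus> a \<oplus> (a \<oplus> b) \<in> I"
    using assms by (simp add: additive_subgroup.a_closed additive_subgroup.a_inv_closed ideal.axioms(1))
  then show ?thesis using a assms by (simp add: a_assoc[symmetric] l_neg)
qed

text \<open>The modular law: if \<open>y \<in> Y\<close> were \<open>a \<oplus> b\<close> with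
  \<open>a \<in> U\<close> and \<open>b \<in> J\<close>, then \<open>b\<close> would lie in
  \<open>Y \<inter> J = U \<inter> J\<close>, and \<open>y\<close> in \<open>U\<close>.\<close>

lemma ideal_modular_strict:
  assumes "ideal U R" "ideal Y R" "ideal J R" "U \<subset> Y"
    and "U \<inter> J = Y \<inter> J"
  shows "U <+>\<^bsub>R\<^esub> J \<subset> Y <+>\<^bsub>R\<^esub> J"
proof -
  from assms obtain y where y: "y \<in> Y" "y \<notin> U" by blast
  have yc: "y \<in> carrier R" using y assms ideal.Icarr by fast
  have "y \<notin> U <+>\<^bsub>R\<^esub> J"
  proof
    assume "y \<in> U <+>\<^bsub>R\<^esub> J"
    then obtain a b where ab: "a \<in> U" "b \<in> J" "y = a \<oplus> b" by (blast elim: set_addE)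
    then have "b \<in> Y"
      using assms y yc ideal_diff_mem[of Y a b] by (metis ideal.Icarr psubsetD)
    then have "b \<in> U" using assms ab by blast
    then show False using y ab assms(1) by (simp add: additive_subgroup.a_closed ideal.axioms(1))
  qed
  moreover have "y \<in> Y <+>\<^bsub>R\<^esub> J" using set_add_upper[OF assms(2,3)] y by blast
  moreover have "U <+>\<^bsub>R\<^esub> J \<subseteq> Y <+>\<^bsub>R\<^esub> J" using assms(4) by (intro set_add_mono) auto
  ultimately show ?thesis by blast
qed

text \<open>Every step of a chain from \<open>I\<close> to \<open>L\<close> is visible in its
  intersection with \<open>J\<close> or in its sum with \<open>J\<close>, so the lengths reached in
  the two intervals together grow by at least one per step. No composition series are needed, and
  the lengths may be infinite.\<close>

lemma ideal_length_subadditive: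
  assumes I: "ideal I R" and J: "ideal J R" and "ideal L R" and IJ: "I \<subseteq> J" and JL: "J \<subseteq> L"
  shows "ideal_length R I L \<le> ideal_length R I J + ideal_length R J L"
proof (rule ideal_length_le)
  fix n N assume N: "ideal_chain R I L n N"
  let ?a = "\<lambda>i. ideal_length R I (N i \<inter> J)" and ?b = "\<lambda>i. ideal_length R J (N i <+>\<^bsub>R\<^esub> J)"
  have Ni: "ideal (N i) R" "I \<subseteq> N i" "N i \<subseteq> L" if "i \<le> n" for i
    using N that by (auto simp: ideal_chain_def)
  have mono: "ideal_length R A U \<le> ideal_length R A Y" if "U \<subseteq> Y" for A U Y
    by (rule ideal_length_interval_mono) (use that in auto)
  have "enat i \<le> ?a i + ?b i" if "i \<le> n" for i
    using that
  proof (induction i)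
    case (Suc i)
    have st: "N i \<subset> N (Suc i)" using N Suc.prems by (auto simp: ideal_chain_def)
    note ids = Ni(1)[of i] Ni(1)[of "Suc i"]
    have ids2: "ideal (N i \<inter> J) R" "ideal (N (Suc i) \<inter> J) R" "ideal (N i <+>\<^bsub>R\<^esub> J) R" "ideal (N (Suc i) <+>\<^bsub>R\<^esub> J) R"
      using ids Suc.prems J by (auto intro: i_intersect add_ideals)
    have le: "?a i \<le> ?a (Suc i)" "?b i \<le> ?b (Suc i)"
      using st set_add_mono[of "N i" "N (Suc i)" J J] by (auto intro!: mono)
    have "?a i + ?b i + 1 \<le> ?a (Suc i) + ?b (Suc i)"
    proof (cases "N i \<inter> J = N (Suc i) \<inter> J")
      case True
      then have "N i <+>\<^bsub>R\<^esub> J \<subset> N (Suc i) <+>\<^bsub>R\<^esub> J"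
        using ids Suc.prems J st by (intro ideal_modular_strict) auto
      moreover have "J \<subseteq> N i <+>\<^bsub>R\<^esub> J" using set_add_upper ids J Suc.prems by auto
      ultimately have "?b i + 1 \<le> ?b (Suc i)" using ids2 J by (intro ideal_length_strict_mono)
      then show ?thesis using le(1) by (metis add.assoc add_mono)
    next
      case False
      then have "N i \<inter> J \<subset> N (Suc i) \<inter> J" using st by blast
      then have "?a i + 1 \<le> ?a (Suc i)" using ids2 I IJ Ni Suc.prems by (intro ideal_length_strict_mono) auto
      then show ?thesis using le(2) by (metis add.assoc add.commute add_mono)
    qed
    moreover have "enat i + 1 \<le> ?a i + ?b i + 1" using Suc by (simp add: add_right_mono)
    ultimately show ?case by (metis eSuc_enat order_trans plus_1_eSuc(2))
  qed (simp add: zero_enat_def[symmetric])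
  then have "enat n \<le> ?a n + ?b n" by simp
  also have "\<dots> \<le> ideal_length R I J + ideal_length R J L"
    using Ni[of n] JL assms(3) by (intro add_mono mono set_add_least) auto
  finally show "enat n \<le> ideal_length R I J + ideal_length R J L" .
qed

lemma ideal_length_add:
  assumes "ideal I R" "ideal J R" "ideal L R" "I \<subseteq> J" "J \<subseteq> L"
  shows "ideal_length R I L = ideal_length R I J + ideal_length R J L"
  using ideal_length_subadditive[OF assms] ideal_length_superadditive[OF assms(1,2,4,5)] by simp

text \<open>The second isomorphism theorem: by the modular law, \<open>U \<inter> H\<close> and
  \<open>U <+> J\<close> are mutually inverse maps between the two intervals.\<close>

lemma ideal_length_diamond:
  assumes H: "ideal H R" and J: "ideal J R"
  shows "ideal_length R J (H <+>\<^bsub>R\<^esub> J) = ideal_length R (H \<inter> J) H"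
proof (rule antisym)
  have 1: "U = (U \<inter> H) <+>\<^bsub>R\<^esub> J" if U: "ideal U R" "J \<subseteq> U" "U \<subseteq> H <+>\<^bsub>R\<^esub> J" for U
  proof
    show "U \<inter> H <+>\<^bsub>R\<^esub> J \<subseteq> U" using U by (intro set_add_least) auto
    show "U \<subseteq> U \<inter> H <+>\<^bsub>R\<^esub> J"
    proof
      fix x assume x: "x \<in> U"
      then obtain h j where hj: "h \<in> H" "j \<in> J" "x = h \<oplus> j" using U by (blast elim: set_addE)
      have c: "h \<in> carrier R" "j \<in> carrier R" using hj H J ideal.Icarr by fast+
      have "j \<oplus> h \<in> U" using x hj c by (simp add: a_comm)
      then have "h \<in> U" using ideal_diff_mem[OF U(1), of j h] hj c U(2) by auto
      then show "x \<in> U \<inter> H <+>\<^bsub>R\<^esub> J" using hj by (simp add: set_addI)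
    qed
  qed
  show "ideal_length R J (H <+>\<^bsub>R\<^esub> J) \<le> ideal_length R (H \<inter> J) H"
  proof (rule ideal_length_mono[where f = "\<lambda>U. U \<inter> H"])
    fix U Y assume UY: "ideal U R" "J \<subseteq> U" "ideal Y R" "Y \<subseteq> H <+>\<^bsub>R\<^esub> J" "U \<subset> Y"
    show "U \<inter> H \<subset> Y \<inter> H" using 1[of U] 1[of Y] UY by (metis Int_mono order.refl order.trans psubsetE psubsetI)
  qed (use H J in \<open>auto intro: i_intersect\<close>)
  have 2: "U = (U <+>\<^bsub>R\<^esub> J) \<inter> H" if U: "ideal U R" "H \<inter> J \<subseteq> U" "U \<subseteq> H" for U
  proof
    show "U \<subseteq> (U <+>\<^bsub>R\<^esub> J) \<inter> H" using U set_add_upper[OF U(1) J] by auto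
    show "(U <+>\<^bsub>R\<^esub> J) \<inter> H \<subseteq> U"
    proof
      fix z assume z: "z \<in> (U <+>\<^bsub>R\<^esub> J) \<inter> H"
      then obtain x j where xj: "x \<in> U" "j \<in> J" "z = x \<oplus> j" by (blast elim: set_addE)
      then have "j \<in> H" using ideal_diff_mem[OF H, of x j] U z J ideal.Icarr by fast
      then show "z \<in> U" using xj U by (auto simp: additive_subgroup.a_closed ideal.axioms(1))
    qed
  qed
  show "ideal_length R (H \<inter> J) H \<le> ideal_length R J (H <+>\<^bsub>R\<^esub> J)"
  proof (rule ideal_length_mono[where f = "\<lambda>U. U <+>\<^bsub>R\<^esub> J"])
    fix U assume "ideal U R" "H \<inter> J \<subseteq> U" "U \<subseteq> H"
    then show "ideal (U <+>\<^bsub>R\<^esub> J) R \<and> J \<subseteq> U <+>\<^bsub>R\<^esub> J \<and> U <+>\<^bsub>R\<^esub> J \<subseteq> H <+>\<^bsub>R\<^esub> J"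
      using J set_add_upper[of U J] set_add_mono[of U H J J] by (simp add: add_ideals)
  next
    fix U Y assume UY: "ideal U R" "H \<inter> J \<subseteq> U" "ideal Y R" "Y \<subseteq> H" "U \<subset> Y"
    have "U <+>\<^bsub>R\<^esub> J \<subseteq> Y <+>\<^bsub>R\<^esub> J" using UY by (intro set_add_mono) auto
    then show "U <+>\<^bsub>R\<^esub> J \<subset> Y <+>\<^bsub>R\<^esub> J" using 2[of U] 2[of Y] UY by (metis order.trans psubsetE psubsetI)
  qed
qed


text \<open>For \<open>I \<subseteq> H\<close> the last two assumptions say that \<open>H\<close> is
  the colon ideal \<open>I : y\<close>. Multiplication by \<open>y\<close> then induces an
  isomorphism of \<open>R/(H + (y))\<close> onto \<open>(I + (y))/(I + (y^2))\<close>;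
  \<open>f\<close> and \<open>g\<close> are its image and preimage maps on ideals.\<close>

lemma ideal_length_mult:
  assumes I: "ideal I R" and H: "ideal H R" and y: "y \<in> carrier R"
    and I_sub: "\<And>a. a \<in> carrier R \<Longrightarrow> y \<otimes> a \<in> I \<Longrightarrow> a \<in> H"
    and H_sub: "\<And>a. a \<in> H \<Longrightarrow> y \<otimes> a \<in> I"
  shows "ideal_length R (H <+>\<^bsub>R\<^esub> PIdl y) (carrier R)
       = ideal_length R (I <+>\<^bsub>R\<^esub> PIdl (y \<otimes> y)) (I <+>\<^bsub>R\<^esub> PIdl y)"
proof (rule antisym)
  have PI: "z \<in> PIdl u \<longleftrightarrow> (\<exists>r\<in>carrier R. z = r \<otimes> u)" for z u
    by (auto simp: cgenideal_def)
  define f where "f = (\<lambda>U. I <+>\<^bsub>R\<^esub> ((\<lambda>a. y \<otimes> a) ` U))"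
  define g where "g = (\<lambda>U. {a \<in> carrier R. y \<otimes> a \<in> U})"
  have f_mem: "z \<in> f U \<longleftrightarrow> (\<exists>i\<in>I. \<exists>a\<in>U. z = i \<oplus> y \<otimes> a)" for z U
    unfolding f_def by (auto simp: set_add_mem_iff)
  have f_ideal: "ideal (f U) R" if U: "ideal U R" for U
  proof -
    have "ideal ((\<lambda>a. y \<otimes> a) ` U) R"
    proof (rule idealI[OF ring_axioms])
      show "subgroup ((\<lambda>a. y \<otimes> a) ` U) (add_monoid R)"
      proof (rule add.subgroupI)
        show "(\<lambda>a. y \<otimes> a) ` U \<subseteq> carrier R" using y U ideal.Icarr by fastforce
        show "(\<lambda>a. y \<otimes> a) ` U \<noteq> {}" using ideal_zero_closed[OF U] by blast
        fix a assume "a \<in> (\<lambda>a. y \<otimes> a) ` U"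
        then obtain u where u: "u \<in> U" "a = y \<otimes> u" by blast
        have "\<ominus> a = y \<otimes> (\<ominus> u)" using u y U by (simp add: ideal.Icarr r_minus)
        then show "\<ominus> a \<in> (\<lambda>a. y \<otimes> a) ` U" using ideal_neg_closed[OF U u(1)] by blast
        fix b assume "b \<in> (\<lambda>a. y \<otimes> a) ` U"
        then obtain v where v: "v \<in> U" "b = y \<otimes> v" by blast
        have "a \<oplus> b = y \<otimes> (u \<oplus> v)" using u v y U by (simp add: ideal.Icarr r_distr)
        then show "a \<oplus> b \<in> (\<lambda>a. y \<otimes> a) ` U" using ideal_add_closed[OF U u(1) v(1)] by blast
      qed
      fix a x assume "a \<in> (\<lambda>a. y \<otimes> a) ` U" and x: "x \<in> carrier R"
      then obtain u where u: "u \<in> U" "a = y \<otimes> u" by blast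
      have uc: "u \<in> carrier R" using u U ideal.Icarr by fast
      have "x \<otimes> a = y \<otimes> (x \<otimes> u)" using u(2) uc x y by (simp add: m_ac)
      then show "x \<otimes> a \<in> (\<lambda>a. y \<otimes> a) ` U" using ideal.I_l_closed[OF U u(1) x] by blast
      then show "a \<otimes> x \<in> (\<lambda>a. y \<otimes> a) ` U" using u(2) uc x y m_comm by simp
    qed
    then show ?thesis unfolding f_def using I by (rule add_ideals[rotated])
  qed
  have g_ideal: "ideal (g U) R" if U: "ideal U R" for U
  proof (rule idealI[OF ring_axioms])
    show "subgroup (g U) (add_monoid R)"
      by (rule add.subgroupI)
        (use y U ideal_zero_closed[OF U] ideal_add_closed[OF U] ideal_neg_closed[OF U]
          in \<open>auto simp: g_def r_distr r_minus intro: exI[of _ \<zero>]\<close>)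
    fix a x assume a: "a \<in> g U" and x: "x \<in> carrier R"
    have "x \<otimes> (y \<otimes> a) \<in> U" using a x U by (simp add: g_def ideal.I_l_closed)
    then show "x \<otimes> a \<in> g U" "a \<otimes> x \<in> g U" using a x y by (simp_all add: g_def m_ac)
  qed
  have gf: "g (f U) = U" if U: "ideal U R" "H \<subseteq> U" for U
  proof
    show "U \<subseteq> g (f U)"
      using U y ideal_zero_closed[OF I] by (force simp: g_def f_mem ideal.Icarr)
    show "g (f U) \<subseteq> U"
    proof
      fix a assume "a \<in> g (f U)"
      then obtain i u where a: "a \<in> carrier R" and i: "i \<in> I" and u: "u \<in> U" and e: "y \<otimes> a = i \<oplus> y \<otimes> u"
        by (auto simp: g_def f_mem)
      have c: "i \<in> carrier R" "u \<in> carrier R" using i u I U ideal.Icarr by fast+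
      have "y \<otimes> (a \<ominus> u) = i" using e a y c by (simp add: a_minus_def r_distr r_minus a_assoc r_neg)
      then have "a \<ominus> u \<in> U" using I_sub[of "a \<ominus> u"] i a c U by auto
      then have "u \<oplus> (a \<ominus> u) \<in> U" using u U by (simp add: ideal_add_closed)
      moreover have "u \<oplus> (a \<ominus> u) = a" using a c by (simp add: a_minus_def a_lcomm r_neg)
      ultimately show "a \<in> U" by simp
    qed
  qed
  have fg: "f (g U) = U" if U: "ideal U R" "I \<subseteq> U" "U \<subseteq> I <+>\<^bsub>R\<^esub> PIdl y" for U
  proof
    show "f (g U) \<subseteq> U" using U(2) ideal_add_closed[OF U(1)] by (fastforce simp: g_def f_mem)
    show "U \<subseteq> f (g U)"
    proof
      fix a assume a: "a \<in> U"
      then obtain i r where i: "i \<in> I" "r \<in> carrier R" "a = i \<oplus> r \<otimes> y"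
        using U(3) by (fastforce simp: set_add_mem_iff PI)
      have "y \<otimes> r \<in> U"
        using ideal_diff_mem[OF U(1), of i "r \<otimes> y"] a i U(2) y by (auto simp: m_comm)
      then have "r \<in> g U" using i(2) by (simp add: g_def)
      moreover have "a = i \<oplus> y \<otimes> r" using i y by (simp add: m_comm)
      ultimately show "a \<in> f (g U)" using i(1) unfolding f_mem by blast
    qed
  qed
  show "ideal_length R (H <+>\<^bsub>R\<^esub> PIdl y) (carrier R)
      \<le> ideal_length R (I <+>\<^bsub>R\<^esub> PIdl (y \<otimes> y)) (I <+>\<^bsub>R\<^esub> PIdl y)"
  proof (rule ideal_length_mono[where f = f])
    fix U assume U: "ideal U R" "H <+>\<^bsub>R\<^esub> PIdl y \<subseteq> U" "U \<subseteq> carrier R"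
    have "PIdl y \<subseteq> U" using U set_add_upper[OF H cgenideal_ideal[OF y]] by blast
    then have "y \<in> U" using cgenideal_self[OF y] by blast
    have f_memI: "i \<oplus> y \<otimes> a \<in> f U" if "i \<in> I" "a \<in> U" for i a
      using that unfolding f_mem by blast
    have "PIdl (y \<otimes> y) \<subseteq> f U"
    proof
      fix z assume "z \<in> PIdl (y \<otimes> y)"
      then obtain r where r: "r \<in> carrier R" "z = r \<otimes> (y \<otimes> y)" by (auto simp: PI)
      then have "z = \<zero> \<oplus> y \<otimes> (r \<otimes> y)" using y by (simp add: m_ac)
      then show "z \<in> f U"
        using f_memI[OF ideal_zero_closed[OF I] ideal.I_l_closed[OF U(1) \<open>y \<in> U\<close> r(1)]] by simp
    qed
    moreover have "I \<subseteq> f U"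
    proof
      fix z assume z: "z \<in> I"
      then show "z \<in> f U"
        using f_memI[OF z ideal_zero_closed[OF U(1)]] y ideal.Icarr[OF I z] by simp
    qed
    moreover have "f U \<subseteq> I <+>\<^bsub>R\<^esub> PIdl y"
    proof
      fix z assume "z \<in> f U"
      then obtain i a where ia: "i \<in> I" "a \<in> U" "z = i \<oplus> y \<otimes> a" unfolding f_mem by blast
      then have "a \<in> carrier R" using U by blast
      then have "y \<otimes> a \<in> PIdl y" unfolding PI by (intro bexI[of _ a] m_comm y)
      then show "z \<in> I <+>\<^bsub>R\<^esub> PIdl y" using ia set_addI by blast
    qed
    ultimately show "ideal (f U) R \<and> I <+>\<^bsub>R\<^esub> PIdl (y \<otimes> y) \<subseteq> f U \<and> f U \<subseteq> I <+>\<^bsub>R\<^esub> PIdl y"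
      using f_ideal U by (simp add: set_add_least)
  next
    fix U Y assume UY: "ideal U R" "H <+>\<^bsub>R\<^esub> PIdl y \<subseteq> U" "ideal Y R" "U \<subset> Y"
    have "H \<subseteq> U" using UY set_add_upper(1)[OF H cgenideal_ideal[OF y]] by blast
    then have e: "g (f U) = U" "g (f Y) = Y" using gf UY(1,3,4) by blast+
    have "f U \<subseteq> f Y" using UY(4) unfolding f_def by (intro set_add_mono image_mono) auto
    moreover have "f U \<noteq> f Y" using e UY(4) by (metis psubset_eq)
    ultimately show "f U \<subset> f Y" by blast
  qed
  show "ideal_length R (I <+>\<^bsub>R\<^esub> PIdl (y \<otimes> y)) (I <+>\<^bsub>R\<^esub> PIdl y)
      \<le> ideal_length R (H <+>\<^bsub>R\<^esub> PIdl y) (carrier R)"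
  proof (rule ideal_length_mono[where f = g])
    fix U assume U: "ideal U R" "I <+>\<^bsub>R\<^esub> PIdl (y \<otimes> y) \<subseteq> U"
    have sub: "I \<subseteq> U" "PIdl (y \<otimes> y) \<subseteq> U"
      using U set_add_upper[OF I cgenideal_ideal[of "y \<otimes> y"]] y by auto
    have "H \<subseteq> g U" using H_sub sub(1) ideal.Icarr[OF H] by (auto simp: g_def)
    moreover have "PIdl y \<subseteq> g U"
    proof
      fix z assume "z \<in> PIdl y"
      then obtain r where r: "r \<in> carrier R" "z = r \<otimes> y" by (auto simp: PI)
      then have "y \<otimes> z = r \<otimes> (y \<otimes> y)" using y by (simp add: m_ac)
      moreover have "r \<otimes> (y \<otimes> y) \<in> PIdl (y \<otimes> y)" using r by (auto simp: PI)
      ultimately show "z \<in> g U" using r y sub(2) by (auto simp: g_def)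
    qed
    ultimately show "ideal (g U) R \<and> H <+>\<^bsub>R\<^esub> PIdl y \<subseteq> g U \<and> g U \<subseteq> carrier R"
      using g_ideal U by (simp add: set_add_least) (simp add: g_def)
  next
    fix U Y assume UY: "ideal U R" "I <+>\<^bsub>R\<^esub> PIdl (y \<otimes> y) \<subseteq> U" "ideal Y R" "Y \<subseteq> I <+>\<^bsub>R\<^esub> PIdl y" "U \<subset> Y"
    have "I \<subseteq> U" using UY set_add_upper(1)[OF I cgenideal_ideal[of "y \<otimes> y"]] y by auto
    then have "f (g U) = U" "f (g Y) = Y" using fg UY(1,3,4,5) by (blast dest: psubset_imp_subset)+
    then have "g U \<noteq> g Y" using UY(5) by (metis psubset_eq)
    moreover have "g U \<subseteq> g Y" using UY(5) by (auto simp: g_def)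
    ultimately show "g U \<subset> g Y" by blast
  qed
qed

text \<open>Here \<open>y\<close> is a nonzerodivisor modulo \<open>H\<close> and kills
  \<open>H/I\<close>. The cokernel of \<open>H/I \<rightarrow> R/(I + (y))\<close> is
  \<open>R/(H + (y))\<close>, which \<open>ideal_length_mult\<close> identifies with
  \<open>(I + (y))/(I + (y^2))\<close>. Written as a sum, the identity also covers infinite
  lengths.\<close>

lemma ideal_length_annihilator:
  assumes I: "ideal I R" and H: "ideal H R" and y: "y \<in> carrier R"
    and I_sub: "\<And>a. a \<in> carrier R \<Longrightarrow> y \<otimes> a \<in> H \<Longrightarrow> a \<in> H"
    and H_sub: "\<And>a. a \<in> H \<Longrightarrow> y \<otimes> a \<in> I"
    and IH: "I \<subseteq> H"
  shows "ideal_length R (I <+>\<^bsub>R\<^esub> PIdl (y \<otimes> y)) (carrier R) + ideal_length R I H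
     = 2 * ideal_length R (I <+>\<^bsub>R\<^esub> PIdl y) (carrier R)"
proof -
  let ?P = "PIdl y" and ?Q = "PIdl (y \<otimes> y)"
  have P: "ideal ?P R" and Q: "ideal ?Q R" using y by (auto intro: cgenideal_ideal)
  have car: "ideal (carrier R) R" by (rule oneideal)
  have sub: "L \<subseteq> carrier R" if "ideal L R" for L using that ideal.Icarr by fast
  have QP: "?Q \<subseteq> ?P" using y by (intro cgenideal_minimal P) (simp add: cgenideal_self ideal.I_l_closed[OF P])
  have IP: "ideal (I <+>\<^bsub>R\<^esub> ?P) R" and IQ: "ideal (I <+>\<^bsub>R\<^esub> ?Q) R" and HP: "ideal (H <+>\<^bsub>R\<^esub> ?P) R"
    using I P Q H by (auto intro: add_ideals)
  \<comment> \<open>This makes \<open>H/I\<close> embed in \<open>R/(I + (y))\<close>: if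
    \<open>i \<oplus> r \<otimes> y\<close> lies in \<open>H\<close>, then so does
    \<open>y \<otimes> r\<close>, hence \<open>r\<close> does, hence \<open>y \<otimes> r\<close>
    lies in \<open>I\<close>.\<close>
  have int: "H \<inter> (I <+>\<^bsub>R\<^esub> ?P) = I"
  proof
    show "I \<subseteq> H \<inter> (I <+>\<^bsub>R\<^esub> ?P)" using IH set_add_upper[OF I P] by blast
    show "H \<inter> (I <+>\<^bsub>R\<^esub> ?P) \<subseteq> I"
    proof
      fix z assume z: "z \<in> H \<inter> (I <+>\<^bsub>R\<^esub> ?P)"
      then obtain i r where i: "i \<in> I" "r \<in> carrier R" "z = i \<oplus> r \<otimes> y"
        by (fastforce simp: set_add_mem_iff cgenideal_def)
      then have "y \<otimes> r \<in> H" using ideal_diff_mem[OF H, of i "r \<otimes> y"] z IH y by (auto simp: m_comm)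
      then have "y \<otimes> r \<in> I" using I_sub H_sub i by blast
      then show "z \<in> I" using i y I by (auto simp: m_comm ideal_add_closed)
    qed
  qed
  have "H <+>\<^bsub>R\<^esub> (I <+>\<^bsub>R\<^esub> ?P) = H <+>\<^bsub>R\<^esub> ?P"
  proof
    show "H <+>\<^bsub>R\<^esub> (I <+>\<^bsub>R\<^esub> ?P) \<subseteq> H <+>\<^bsub>R\<^esub> ?P"
      using set_add_upper[OF H P] IH HP by (intro set_add_least) auto
    show "H <+>\<^bsub>R\<^esub> ?P \<subseteq> H <+>\<^bsub>R\<^esub> (I <+>\<^bsub>R\<^esub> ?P)"
      using set_add_upper[OF I P] by (intro set_add_mono) auto
  qed
  then have "ideal_length R (I <+>\<^bsub>R\<^esub> ?P) (H <+>\<^bsub>R\<^esub> ?P) = ideal_length R I H"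
    using ideal_length_diamond[OF H IP] int by simp
  moreover have "ideal_length R (I <+>\<^bsub>R\<^esub> ?P) (carrier R)
    = ideal_length R (I <+>\<^bsub>R\<^esub> ?P) (H <+>\<^bsub>R\<^esub> ?P) + ideal_length R (H <+>\<^bsub>R\<^esub> ?P) (carrier R)"
    using IH by (intro ideal_length_add IP HP car sub set_add_mono) auto
  moreover have "ideal_length R (I <+>\<^bsub>R\<^esub> ?Q) (carrier R)
    = ideal_length R (I <+>\<^bsub>R\<^esub> ?Q) (I <+>\<^bsub>R\<^esub> ?P) + ideal_length R (I <+>\<^bsub>R\<^esub> ?P) (carrier R)"
    using QP by (intro ideal_length_add IP IQ car sub set_add_mono) auto
  moreover have "ideal_length R (H <+>\<^bsub>R\<^esub> ?P) (carrier R)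
       = ideal_length R (I <+>\<^bsub>R\<^esub> ?Q) (I <+>\<^bsub>R\<^esub> ?P)"
    using I_sub H_sub IH by (intro ideal_length_mult I H y) auto
  ultimately show ?thesis by (simp add: mult_2 ac_simps)
qed

text \<open>The extension of \<open>P^n\<close> to the localization lies in \<open>E\<close>, the
  fractions with numerator in \<open>P^n\<close>, since \<open>E\<close> is an ideal. Clearing
  denominators then turns the contraction into a saturation inside \<open>R\<close>.\<close>

lemma symbolic_power_eq:
  assumes P: "primeideal P R" and N: "ideal (P [^]\<^bsub>ideals_set R\<^esub> n) R"
  shows "symbolic_power R P n = {r \<in> carrier R. \<exists>s\<in>carrier R - P. s \<otimes> r \<in> P [^]\<^bsub>ideals_set R\<^esub> n}"
proof -
  interpret P: primeideal P R by (rule P)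
  define S where "S = carrier R - P"
  define N where "N = P [^]\<^bsub>ideals_set R\<^esub> n"
  have N: "ideal N R" using assms N_def by simp
  interpret S: multiplicative_subset R S
    unfolding S_def by (rule P.multiplicative_subset_complement)
  interpret L: cring "localization R S" by (rule S.localization_is_cring)
  define E where "E = {fraction R S a s | a s. a \<in> N \<and> s \<in> S}"
  have Nc: "a \<in> carrier R" if "a \<in> N" for a using N that ideal.Icarr by fast
  have E_ideal: "ideal E (localization R S)"
  proof (rule idealI[OF L.ring_axioms])
    show "subgroup E (add_monoid (localization R S))"
    proof (rule L.add.subgroupI)
      show "E \<subseteq> carrier (localization R S)" using Nc by (auto simp: E_def)
      show "E \<noteq> {}" using ideal_zero_closed[OF N] S.one_in by (auto simp: E_def)
      fix u assume "u \<in> E"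
      then obtain a s where u: "a \<in> N" "s \<in> S" "u = fraction R S a s" by (auto simp: E_def)
      have "fraction R S (\<ominus> a) s \<oplus>\<^bsub>localization R S\<^esub> u = \<zero>\<^bsub>localization R S\<^esub>"
        using u Nc S.one_in S.mult_in
        by (simp add: S.localization_simps) (intro S.fraction_eqI[of \<one>]; simp add: l_minus l_neg)
      then have "\<ominus>\<^bsub>localization R S\<^esub> u = fraction R S (\<ominus> a) s"
        using u Nc by (intro L.minus_equality) auto
      then show "\<ominus>\<^bsub>localization R S\<^esub> u \<in> E" using u ideal_neg_closed[OF N] by (auto simp: E_def)
      fix v assume "v \<in> E"
      then obtain b t where v: "b \<in> N" "t \<in> S" "v = fraction R S b t" by (auto simp: E_def)
      have "a \<otimes> t \<oplus> b \<otimes> s \<in> N" using u v N by (auto intro!: ideal_add_closed simp: ideal.I_r_closed)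
      then show "u \<oplus>\<^bsub>localization R S\<^esub> v \<in> E"
        using u v Nc S.mult_in[OF u(2) v(2)] unfolding E_def by (simp add: S.localization_add) blast
    qed
    fix u z assume "u \<in> E" "z \<in> carrier (localization R S)"
    then obtain a s b t where u: "a \<in> N" "s \<in> S" "u = fraction R S a s"
      and z: "b \<in> carrier R" "t \<in> S" "z = fraction R S b t"
      by (auto simp: E_def elim: S.localization_cases)
    show "z \<otimes>\<^bsub>localization R S\<^esub> u \<in> E" "u \<otimes>\<^bsub>localization R S\<^esub> z \<in> E"
      using u z Nc S.mult_in[OF u(2) z(2)] S.mult_in[OF z(2) u(2)] ideal.I_l_closed[OF N u(1) z(1)]
        ideal.I_r_closed[OF N u(1) z(1)]
      unfolding E_def by (simp_all add: S.localization_mult) blast+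
  qed
  let ?\<iota> = "\<lambda>r. fraction R S r \<one>"
  have img: "?\<iota> ` N \<subseteq> carrier (localization R S)" using Nc S.one_in by auto
  have sp: "symbolic_power R P n = {r \<in> carrier R. ?\<iota> r \<in> genideal (localization R S) (?\<iota> ` N)}"
    by (simp add: symbolic_power_def Let_def S_def N_def)
  show ?thesis
    unfolding sp N_def[symmetric] S_def[symmetric]
  proof (intro Collect_cong conj_cong refl iffI)
    fix r assume r: "r \<in> carrier R" and "?\<iota> r \<in> genideal (localization R S) (?\<iota> ` N)"
    moreover have "genideal (localization R S) (?\<iota> ` N) \<subseteq> E"
      using S.one_in by (intro L.genideal_minimal E_ideal) (auto simp: E_def)
    ultimately obtain a s where a: "a \<in> N" "s \<in> S" "?\<iota> r = fraction R S a s" by (auto simp: E_def)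
    then obtain u where u: "u \<in> S" "u \<otimes> (r \<otimes> s) = u \<otimes> (a \<otimes> \<one>)"
      using S.fraction_eq_iff[of r a \<one> s] r Nc S.one_in by auto
    have "(u \<otimes> s) \<otimes> r = u \<otimes> a" using u a r Nc by (simp add: m_ac)
    also have "\<dots> \<in> N" using a u N by (simp add: ideal.I_l_closed)
    finally show "\<exists>s\<in>S. s \<otimes> r \<in> N" using u a S.mult_in by blast
  next
    fix r assume r: "r \<in> carrier R" and "\<exists>s\<in>S. s \<otimes> r \<in> N"
    then obtain s where s: "s \<in> S" "s \<otimes> r \<in> N" by blast
    \<comment> \<open>Dividing by \<open>s\<close> in the localization recovers \<open>r\<close>
      from an element of \<open>P^n\<close>.\<close>
    have "?\<iota> r = fraction R S \<one> s \<otimes>\<^bsub>localization R S\<^esub> ?\<iota> (s \<otimes> r)"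
      using r s S.one_in by (simp add: S.localization_mult) (intro S.fraction_eqI[of \<one>]; simp add: m_ac)
    also have "\<dots> \<in> genideal (localization R S) (?\<iota> ` N)"
      using s S.one_in L.genideal_self[OF img]
      by (intro ideal.I_l_closed[OF L.genideal_ideal[OF img]]) auto
    finally show "?\<iota> r \<in> genideal (localization R S) (?\<iota> ` N)" .
  qed
qed

text \<open>The correspondence theorem: image and preimage under the coset map \<open>c\<close>
  preserve strict inclusions. A general \<open>H\<close> serves \<open>P^(n)/P^n\<close> and, with
  \<open>H = carrier R\<close>, the cyclic quotients.\<close>

lemma module_length_quotient:
  assumes I: "ideal I R" and H: "ideal H R" and IH: "I \<subseteq> H"
  shows "module_length R (quotient_module ((regular_module R)\<lparr>carrier := H\<rparr>) I) = ideal_length R I H"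
proof -
  let ?A = "regular_module R"
  define M where "M = (regular_module R)\<lparr>carrier := H\<rparr>"
  define Q where "Q = quotient_module M I"
  interpret A: module R ?A by (rule regular_module_is_module)
  have "submodule H R ?A" using H submodule_regular_module_iff by simp
  then interpret M: module R M
    unfolding M_def using regular_module_is_module by (rule submodule.submodule_is_module)
  have M_simps [simp]: "carrier M = H" "ring.add M = ring.add R" "\<zero>\<^bsub>M\<^esub> = \<zero>" "smult M = monoid.mult R"
    by (auto simp: M_def regular_module_def)
  note Hc = ideal.Icarr[OF H] and Ic = ideal.Icarr[OF I]
  have "submodule I R M"
  proof (rule M.submoduleI)
    fix a assume a: "a \<in> I"
    \<comment> \<open>The inverse in \<open>M\<close> is sought within the smaller carrier
      \<open>H\<close>, so its agreement with the one of \<open>R\<close> has to be proved.\<close>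
    have "\<ominus> a = \<ominus>\<^bsub>M\<^esub> a"
      using a IH I Hc ideal_neg_closed[OF I a] by (intro M.minus_equality[symmetric]) (auto simp: l_neg Ic)
    then show "\<ominus>\<^bsub>M\<^esub> a \<in> I" using ideal_neg_closed[OF I a] by simp
  qed (use I IH in \<open>auto simp: ideal_zero_closed ideal_add_closed ideal.I_l_closed\<close>)
  note IM = this
  interpret Q: module R Q unfolding Q_def by (rule M.quotient_module_is_module[OF IM])
  interpret I: abelian_subgroup I M
    using submodule.axioms(1)[OF IM]
    by (intro abelian_subgroupI3 additive_subgroup.intro M.abelian_group_axioms)
  define c where "c = (\<lambda>x. I +>\<^bsub>M\<^esub> x)"
  have Qcar: "carrier Q = c ` H"
    by (auto simp: Q_def quotient_module_def A_RCOSETS_def' c_def)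
  have Qzero: "\<zero>\<^bsub>Q\<^esub> = I" by (simp add: Q_def quotient_module_def)
  have Qadd: "c x \<oplus>\<^bsub>Q\<^esub> c y = c (x \<oplus> y)" if "x \<in> H" "y \<in> H" for x y
    using I.a_rcos_sum[of x y] that by (simp add: Q_def quotient_module_def c_def)
  have Qsmult: "r \<odot>\<^bsub>Q\<^esub> c x = c (r \<otimes> x)" if "r \<in> carrier R" "x \<in> H" for r x
    using M.quotient_module_smult[OF IM, of r x] that by (simp add: Q_def c_def)
  have c_eq: "\<exists>h\<in>I. x = h \<oplus> y" if "x \<in> H" "c x = c y" for x y
    using I.a_rcos_self[of x] that by (auto simp: c_def a_r_coset_def')
  have cI: "c x = I" if "x \<in> I" for x
    unfolding c_def using that I.a_subgroup IH by (intro M.a_coset_join2) auto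
  have neg: "\<ominus>\<^bsub>Q\<^esub> c x = c (\<ominus> x)" if "x \<in> H" for x
  proof (rule Q.minus_equality)
    have n: "\<ominus> x \<in> H" using that by (rule ideal_neg_closed[OF H])
    then show "c (\<ominus> x) \<oplus>\<^bsub>Q\<^esub> c x = \<zero>\<^bsub>Q\<^esub>"
      using that Hc by (simp add: Qadd Qzero l_neg cI ideal_zero_closed[OF I])
    show "c x \<in> carrier Q" "c (\<ominus> x) \<in> carrier Q" using that n by (auto simp: Qcar)
  qed
  define f where "f = (\<lambda>U. c ` U)"
  define g where "g = (\<lambda>N. {x \<in> H. c x \<in> N})"
  have g_mono: "g N \<subset> g N'" if "N \<subset> N'" "N' \<subseteq> carrier Q" for N N'
    using that by (auto simp: g_def Qcar)
  have f_mono: "f U \<subset> f U'" if U: "U \<subset> U'" "ideal U R" "I \<subseteq> U" "U' \<subseteq> H" for U U'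
  proof -
    obtain x where x: "x \<in> U'" "x \<notin> U" using U(1) by blast
    have "c x \<notin> f U"
    proof
      assume "c x \<in> f U"
      then obtain u where u: "u \<in> U" "c x = c u" by (auto simp: f_def)
      have "u \<in> H" "x \<in> H" using u x U by auto
      then obtain h where "h \<in> I" "x = h \<oplus> u" using c_eq u by blast
      then have "x \<in> U" using u U by (auto intro: ideal_add_closed)
      then show False using x by simp
    qed
    then show ?thesis using U x by (auto simp: f_def)
  qed
  have g_ideal: "ideal (g N) R \<and> I \<subseteq> g N \<and> g N \<subseteq> H" if N: "submodule N R Q" for N
  proof -
    note E = Q.submoduleE[OF N]
    have z: "I \<in> N" using subgroup.one_closed[OF submodule.axioms(1)[OF N]] Qzero by simp
    have "ideal (g N) R"
    proof (rule idealI[OF ring_axioms])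
      show "subgroup (g N) (add_monoid R)"
      proof (rule add.subgroupI)
        show "g N \<subseteq> carrier R" using Hc by (auto simp: g_def)
        show "g N \<noteq> {}" using z cI[OF ideal_zero_closed[OF I]] ideal_zero_closed[OF H] by (auto simp: g_def)
        fix a assume a: "a \<in> g N"
        then show "\<ominus> a \<in> g N"
          using E(3)[of "c a"] neg[of a] ideal_neg_closed[OF H, of a] by (auto simp: g_def)
        fix b assume "b \<in> g N"
        then show "a \<oplus> b \<in> g N"
          using a E(5)[of "c a" "c b"] Qadd[of a b] ideal_add_closed[OF H, of a b] by (auto simp: g_def)
      qed
      fix a x assume a: "a \<in> g N" and x: "x \<in> carrier R"
      then show "x \<otimes> a \<in> g N"
        using E(4)[of x "c a"] Qsmult[of x a] ideal.I_l_closed[OF H, of a x] by (auto simp: g_def)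
      then show "a \<otimes> x \<in> g N" using a x Hc m_comm by (auto simp: g_def)
    qed
    moreover have "I \<subseteq> g N" using z cI IH by (auto simp: g_def)
    ultimately show ?thesis by (auto simp: g_def)
  qed
  have f_sub: "submodule (f U) R Q" if U: "ideal U R" "I \<subseteq> U" "U \<subseteq> H" for U
  proof (rule Q.submoduleI)
    show "f U \<subseteq> carrier Q" using U by (auto simp: f_def Qcar)
    show "\<zero>\<^bsub>Q\<^esub> \<in> f U" using cI[OF ideal_zero_closed[OF I]] ideal_zero_closed[OF U(1)] by (force simp: f_def Qzero)
    fix a assume "a \<in> f U"
    then obtain u where u: "u \<in> U" "a = c u" by (auto simp: f_def)
    then show "\<ominus>\<^bsub>Q\<^esub> a \<in> f U" using neg[of u] ideal_neg_closed[OF U(1)] U by (auto simp: f_def)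
    { fix b assume "b \<in> f U"
      then obtain v where v: "v \<in> U" "b = c v" by (auto simp: f_def)
      then have "a \<oplus>\<^bsub>Q\<^esub> b = c (u \<oplus> v)" using u v Qadd[of u v] U by auto
      then show "a \<oplus>\<^bsub>Q\<^esub> b \<in> f U" using ideal_add_closed[OF U(1) u(1) v(1)] by (auto simp: f_def) }
    { fix r assume "r \<in> carrier R"
      then have "r \<odot>\<^bsub>Q\<^esub> a = c (r \<otimes> u)" "r \<otimes> u \<in> U"
        using u Qsmult[of r u] ideal.I_l_closed[OF U(1) u(1)] U by auto
      then show "r \<odot>\<^bsub>Q\<^esub> a \<in> f U" by (auto simp: f_def) }
  qed
  have "(\<exists>N. (\<forall>i\<le>n. submodule (N i) R Q) \<and> (\<forall>i<n. N i \<subset> N (Suc i))) \<longleftrightarrow> (\<exists>N. ideal_chain R I H n N)" for n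
  proof
    assume "\<exists>N. (\<forall>i\<le>n. submodule (N i) R Q) \<and> (\<forall>i<n. N i \<subset> N (Suc i))"
    then obtain N where N: "\<And>i. i \<le> n \<Longrightarrow> submodule (N i) R Q" "\<And>i. i < n \<Longrightarrow> N i \<subset> N (Suc i)" by blast
    have "ideal_chain R I H n (\<lambda>i. g (N i))"
      using g_ideal[OF N(1)] g_mono[OF N(2) Q.submoduleE(1)[OF N(1)]] by (simp add: ideal_chain_def)
    then show "\<exists>N. ideal_chain R I H n N" by blast
  next
    assume "\<exists>N. ideal_chain R I H n N"
    then obtain N where N: "\<And>i. i \<le> n \<Longrightarrow> ideal (N i) R \<and> I \<subseteq> N i \<and> N i \<subseteq> H" "\<And>i. i < n \<Longrightarrow> N i \<subset> N (Suc i)"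
      by (auto simp: ideal_chain_def)
    have "submodule (f (N i)) R Q" if "i \<le> n" for i using N(1)[OF that] f_sub by blast
    moreover have "f (N i) \<subset> f (N (Suc i))" if "i < n" for i
      using N(1)[of i] N(1)[of "Suc i"] that by (intro f_mono N(2)) auto
    ultimately show "\<exists>N. (\<forall>i\<le>n. submodule (N i) R Q) \<and> (\<forall>i<n. N i \<subset> N (Suc i))"
      by (intro exI[of _ "\<lambda>i. f (N i)"]) blast
  qed
  then show ?thesis
    unfolding module_length_def ideal_length_def Q_def[symmetric] M_def[symmetric] by simp
qed

end

section \<open>Noetherian rings\<close>

text \<open>Ideals of a subset \<open>A\<close>, computed with the operations of the ambient ring,
  so that subrings can be enlarged repeatedly without changing the type or the record. If
  \<open>A\<close> is a subring, negatives come from multiplying by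
  \<open>\<ominus> \<one>\<close>.\<close>

definition subideal :: "('a, 'c) ring_scheme \<Rightarrow> 'a set \<Rightarrow> 'a set \<Rightarrow> bool" where
  "subideal R A I \<longleftrightarrow> I \<subseteq> A \<and> \<zero>\<^bsub>R\<^esub> \<in> I \<and> (\<forall>x\<in>I. \<forall>y\<in>I. x \<oplus>\<^bsub>R\<^esub> y \<in> I) \<and> (\<forall>a\<in>A. \<forall>x\<in>I. a \<otimes>\<^bsub>R\<^esub> x \<in> I)"

definition noetherian_on :: "('a, 'c) ring_scheme \<Rightarrow> 'a set \<Rightarrow> bool" where
  "noetherian_on R A \<longleftrightarrow>
     (\<forall>I. (\<forall>n::nat. subideal R A (I n)) \<and> (\<forall>n. I n \<subseteq> I (Suc n)) \<longrightarrow> (\<exists>m. \<forall>n\<ge>m. I n = I m))"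

text \<open>Values at \<open>b\<close> of the polynomials over \<open>A\<close> of degree less than
  \<open>n\<close>. As \<open>b\<close> may be algebraic over \<open>A\<close>, an element has no
  degree of its own; this filtration stands in for it.\<close>

primrec polys_below :: "('a, 'c) ring_scheme \<Rightarrow> 'a set \<Rightarrow> 'a \<Rightarrow> nat \<Rightarrow> 'a set" where
  "polys_below R A b 0 = {\<zero>\<^bsub>R\<^esub>}"
| "polys_below R A b (Suc n) = {w \<oplus>\<^bsub>R\<^esub> a \<otimes>\<^bsub>R\<^esub> b [^]\<^bsub>R\<^esub> n | w a. w \<in> polys_below R A b n \<and> a \<in> A}"

definition adjoin :: "('a, 'c) ring_scheme \<Rightarrow> 'a set \<Rightarrow> 'a \<Rightarrow> 'a set" where
  "adjoin R A b = (\<Union>n. polys_below R A b n)"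

text \<open>An element of \<open>I\<close> can have several expressions in \<open>b\<close>. All
  coefficients of \<open>b^n\<close> over expressions of degree at most \<open>n\<close> are
  collected, including \<open>\<zero>\<close>, which makes the collection an ideal of
  \<open>A\<close>.\<close>

definition leading_coeffs :: "('a, 'c) ring_scheme \<Rightarrow> 'a set \<Rightarrow> 'a \<Rightarrow> nat \<Rightarrow> 'a set \<Rightarrow> 'a set" where
  "leading_coeffs R A b n I = {a \<in> A. \<exists>w\<in>polys_below R A b n. w \<oplus>\<^bsub>R\<^esub> a \<otimes>\<^bsub>R\<^esub> b [^]\<^bsub>R\<^esub> n \<in> I}"

lemma noetherian_on_maximal:
  assumes N: "noetherian_on R A" and ne: "I \<in> C" and C: "\<And>I. I \<in> C \<Longrightarrow> subideal R A I"
  obtains M where "M \<in> C" "\<And>J. J \<in> C \<Longrightarrow> M \<subseteq> J \<Longrightarrow> J = M"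
proof (rule ccontr)
  assume "\<not> thesis"
  then have "\<forall>M\<in>C. \<exists>J\<in>C. M \<subset> J" using that by blast
  then obtain f where f: "\<And>n. f n \<in> C \<and> f n \<subset> f (Suc n)"
    using dependent_nat_choice[of "\<lambda>_ M. M \<in> C" "\<lambda>_ M J. M \<subset> J"] ne by blast
  then obtain m where "\<forall>n\<ge>m. f n = f m"
    using N C unfolding noetherian_on_def by (metis psubset_imp_subset)
  then show False using f[of m] by (metis le_SucI order.refl psubset_eq)
qed

lemma noetherian_onD:
  assumes "noetherian_on R A" "\<And>n. subideal R A (I n)" "\<And>n. I n \<subseteq> I (Suc n)"
  obtains m where "\<And>n. n \<ge> m \<Longrightarrow> I n = I m"
  using assms unfolding noetherian_on_def by blast

section \<open>Hilbert's basis theorem for adjoining one element\<close>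

context cring
begin

lemma subideal_carrier_iff: "subideal R (carrier R) I \<longleftrightarrow> ideal I R"
proof
  assume I: "subideal R (carrier R) I"
  show "ideal I R"
  proof (rule idealI[OF ring_axioms])
    show "subgroup I (add_monoid R)"
    proof (rule add.subgroupI)
      fix a assume a: "a \<in> I"
      then have "\<ominus> \<one> \<otimes> a \<in> I" using I by (simp add: subideal_def)
      then show "\<ominus> a \<in> I" using a I by (auto simp: subideal_def l_minus subset_iff)
    qed (use I in \<open>auto simp: subideal_def\<close>)
    fix a x assume "a \<in> I" "x \<in> carrier R"
    then show "x \<otimes> a \<in> I" "a \<otimes> x \<in> I" using I m_comm[of a x] by (auto simp: subideal_def)
  qed
next
  assume I: "ideal I R"
  then show "subideal R (carrier R) I"
    by (auto simp: subideal_def ideal.Icarr ideal_zero_closed ideal_add_closed ideal.I_l_closed)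
qed

context
  fixes A b
  assumes A: "subring A R" and b: "b \<in> carrier R"
begin

lemma subring_carrier: "a \<in> A \<Longrightarrow> a \<in> carrier R"
  using subringE(1)[OF A] by blast

lemma polys_below_SucI:
  "\<lbrakk>w \<in> polys_below R A b n; a \<in> A\<rbrakk> \<Longrightarrow> w \<oplus> a \<otimes> b [^] n \<in> polys_below R A b (Suc n)"
  by auto

lemma polys_below_carrier: "w \<in> polys_below R A b n \<Longrightarrow> w \<in> carrier R"
  by (induction n arbitrary: w) (auto simp: subring_carrier b)

lemma polys_below_Suc_mono: "polys_below R A b n \<subseteq> polys_below R A b (Suc n)"
proof
  fix w assume "w \<in> polys_below R A b n"
  then show "w \<in> polys_below R A b (Suc n)"
    using polys_below_SucI[of w n \<zero>] subringE(2)[OF A] polys_below_carrier[of w n] b by simp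
qed

lemma polys_below_mono: "m \<le> n \<Longrightarrow> polys_below R A b m \<subseteq> polys_below R A b n"
  by (rule lift_Suc_mono_le[of "polys_below R A b"]) (rule polys_below_Suc_mono)

lemma polys_below_zero: "\<zero> \<in> polys_below R A b n"
  using polys_below_mono[of 0 n] by auto

lemma polys_below_add:
  "\<lbrakk>v \<in> polys_below R A b n; w \<in> polys_below R A b n\<rbrakk> \<Longrightarrow> v \<oplus> w \<in> polys_below R A b n"
proof (induction n arbitrary: v w)
  case (Suc n)
  then obtain v' a w' c where *: "v' \<in> polys_below R A b n" "a \<in> A" "v = v' \<oplus> a \<otimes> b [^] n"
    "w' \<in> polys_below R A b n" "c \<in> A" "w = w' \<oplus> c \<otimes> b [^] n" by auto
  then have "v \<oplus> w = (v' \<oplus> w') \<oplus> (a \<oplus> c) \<otimes> b [^] n"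
    using polys_below_carrier subring_carrier b by (simp add: l_distr a_ac)
  then show ?case
    using polys_below_SucI[OF Suc.IH[OF *(1,4)] subringE(7)[OF A *(2,5)]] by simp
qed simp

lemma polys_below_smult: "\<lbrakk>w \<in> polys_below R A b n; a \<in> A\<rbrakk> \<Longrightarrow> a \<otimes> w \<in> polys_below R A b n"
proof (induction n arbitrary: w)
  case 0 then show ?case using subring_carrier by simp
next
  case (Suc n)
  then obtain w' c where *: "w' \<in> polys_below R A b n" "c \<in> A" "w = w' \<oplus> c \<otimes> b [^] n" by auto
  then have "a \<otimes> w = a \<otimes> w' \<oplus> (a \<otimes> c) \<otimes> b [^] n"
    using polys_below_carrier subring_carrier b Suc.prems by (simp add: r_distr m_assoc)
  then show ?case
    using polys_below_SucI[OF Suc.IH[OF *(1) Suc.prems(2)] subringE(6)[OF A Suc.prems(2) *(2)]] by simp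
qed

lemma polys_below_neg: "w \<in> polys_below R A b n \<Longrightarrow> \<ominus> w \<in> polys_below R A b n"
  using polys_below_smult[of w n "\<ominus> \<one>"] subringE(3,5)[OF A] polys_below_carrier[of w n] by (simp add: l_minus)

lemma polys_below_mult_gen: "w \<in> polys_below R A b n \<Longrightarrow> b \<otimes> w \<in> polys_below R A b (Suc n)"
proof (induction n arbitrary: w)
  case 0 then show ?case using polys_below_zero[of 1] b by simp
next
  case (Suc n)
  then obtain w' c where *: "w' \<in> polys_below R A b n" "c \<in> A" "w = w' \<oplus> c \<otimes> b [^] n" by auto
  then have "b \<otimes> w = b \<otimes> w' \<oplus> c \<otimes> b [^] Suc n"
    using polys_below_carrier subring_carrier b by (simp add: r_distr m_ac)
  then show ?case using polys_below_SucI[OF Suc.IH[OF *(1)] *(2)] by simp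
qed

lemma polys_below_mult_gen_power:
  "w \<in> polys_below R A b n \<Longrightarrow> b [^] m \<otimes> w \<in> polys_below R A b (m + n)"
proof (induction m)
  case 0 then show ?case using polys_below_carrier by simp
next
  case (Suc m)
  have "b [^] Suc m \<otimes> w = b \<otimes> (b [^] m \<otimes> w)"
    using b polys_below_carrier[OF Suc.prems] by (simp add: m_ac)
  then show ?case using polys_below_mult_gen[OF Suc.IH[OF Suc.prems]] by simp
qed

lemma adjoin_add:
  assumes "v \<in> adjoin R A b" "w \<in> adjoin R A b"
  shows "v \<oplus> w \<in> adjoin R A b"
proof -
  from assms obtain m n where "v \<in> polys_below R A b m" "w \<in> polys_below R A b n"
    by (auto simp: adjoin_def)
  then have "v \<in> polys_below R A b (max m n)" "w \<in> polys_below R A b (max m n)"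
    using polys_below_mono[of m "max m n"] polys_below_mono[of n "max m n"] by auto
  then show ?thesis using polys_below_add unfolding adjoin_def by blast
qed

lemma adjoin_mult:
  assumes v: "v \<in> adjoin R A b" and "w \<in> adjoin R A b"
  shows "v \<otimes> w \<in> adjoin R A b"
proof -
  from v obtain m where vm: "v \<in> polys_below R A b m" by (auto simp: adjoin_def)
  have vc: "v \<in> carrier R" using polys_below_carrier[OF vm] .
  have "v \<otimes> w \<in> adjoin R A b" if "w \<in> polys_below R A b n" for n
    using that
  proof (induction n arbitrary: w)
    case 0 then show ?case using vc polys_below_zero by (auto simp: adjoin_def)
  next
    case (Suc n)
    then obtain w' c where *: "w' \<in> polys_below R A b n" "c \<in> A" "w = w' \<oplus> c \<otimes> b [^] n" by auto
    then have "v \<otimes> w = v \<otimes> w' \<oplus> c \<otimes> (b [^] n \<otimes> v)"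
      using polys_below_carrier subring_carrier b vc by (simp add: r_distr m_ac)
    moreover have "c \<otimes> (b [^] n \<otimes> v) \<in> adjoin R A b"
      using polys_below_smult[OF polys_below_mult_gen_power[OF vm] *(2)] by (auto simp: adjoin_def)
    ultimately show ?case using adjoin_add Suc.IH[OF *(1)] by simp
  qed
  then show ?thesis using assms by (auto simp: adjoin_def)
qed

lemma subset_adjoin: "A \<subseteq> adjoin R A b"
proof
  fix a assume "a \<in> A"
  then have "\<zero> \<oplus> a \<otimes> b [^] (0::nat) \<in> polys_below R A b (Suc 0)" and "a \<in> carrier R"
    by (blast intro: polys_below_SucI[OF polys_below_zero] subring_carrier)+
  then have "a \<in> polys_below R A b (Suc 0)" by (simp del: polys_below.simps)
  then show "a \<in> adjoin R A b" unfolding adjoin_def by blast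
qed

lemma gen_in_adjoin: "b \<in> adjoin R A b"
proof -
  have "\<zero> \<oplus> \<one> \<otimes> b [^] (1::nat) \<in> polys_below R A b (Suc 1)"
    by (rule polys_below_SucI[OF polys_below_zero subringE(3)[OF A]])
  then have "b \<in> polys_below R A b (Suc 1)" using b by (simp del: polys_below.simps)
  then show ?thesis unfolding adjoin_def by blast
qed

lemma adjoin_subring: "subring (adjoin R A b) R"
proof (rule subringI)
  show "adjoin R A b \<subseteq> carrier R" using polys_below_carrier by (auto simp: adjoin_def)
  show "\<one> \<in> adjoin R A b" using subset_adjoin subringE(3)[OF A] by blast
  show "\<ominus> v \<in> adjoin R A b" if "v \<in> adjoin R A b" for v
    using that polys_below_neg by (auto simp: adjoin_def)
qed (use adjoin_add adjoin_mult in auto)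

lemma adjoin_minimal:
  assumes C: "subring C R" "A \<subseteq> C" "b \<in> C"
  shows "adjoin R A b \<subseteq> C"
proof -
  have bn: "b [^] n \<in> C" for n :: nat
    by (induction n) (use C subringE(3,6)[OF C(1)] in auto)
  have "polys_below R A b n \<subseteq> C" for n
    by (induction n) (use C(2) bn subringE(2,6,7)[OF C(1)] in \<open>auto dest!: subsetD\<close>)
  then show ?thesis by (auto simp: adjoin_def)
qed

lemma leading_coeffs_subideal:
  assumes I: "subideal R (adjoin R A b) I"
  shows "subideal R A (leading_coeffs R A b n I)"
  unfolding subideal_def
proof (intro conjI ballI)
  show "leading_coeffs R A b n I \<subseteq> A" by (auto simp: leading_coeffs_def)
  show "\<zero> \<in> leading_coeffs R A b n I"
    using I subringE(2)[OF A] polys_below_zero b by (auto simp: leading_coeffs_def subideal_def intro!: bexI[of _ \<zero>])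
  fix a assume "a \<in> leading_coeffs R A b n I"
  then obtain w where a: "a \<in> A" "w \<in> polys_below R A b n" "w \<oplus> a \<otimes> b [^] n \<in> I"
    by (auto simp: leading_coeffs_def)
  note wc = polys_below_carrier[OF a(2)] and ac = subring_carrier[OF a(1)]
  { fix c assume "c \<in> leading_coeffs R A b n I"
    then obtain v where c: "c \<in> A" "v \<in> polys_below R A b n" "v \<oplus> c \<otimes> b [^] n \<in> I"
      by (auto simp: leading_coeffs_def)
    have "(w \<oplus> v) \<oplus> (a \<oplus> c) \<otimes> b [^] n = (w \<oplus> a \<otimes> b [^] n) \<oplus> (v \<oplus> c \<otimes> b [^] n)"
      using wc ac polys_below_carrier[OF c(2)] subring_carrier[OF c(1)] b by (simp add: l_distr a_ac)
    also have "\<dots> \<in> I" using I a c by (simp add: subideal_def)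
    finally show "a \<oplus> c \<in> leading_coeffs R A b n I"
      using polys_below_add[OF a(2) c(2)] subringE(7)[OF A a(1) c(1)] by (auto simp: leading_coeffs_def) }
  { fix c assume c: "c \<in> A"
    have "(c \<otimes> w) \<oplus> (c \<otimes> a) \<otimes> b [^] n = c \<otimes> (w \<oplus> a \<otimes> b [^] n)"
      using wc ac subring_carrier[OF c] b by (simp add: r_distr m_ac)
    also have "\<dots> \<in> I" using I a subset_adjoin c by (auto simp: subideal_def)
    finally show "c \<otimes> a \<in> leading_coeffs R A b n I"
      using polys_below_smult[OF a(2) c] subringE(6)[OF A c a(1)] by (auto simp: leading_coeffs_def) }
qed

lemma leading_coeffs_mono: "I \<subseteq> J \<Longrightarrow> leading_coeffs R A b n I \<subseteq> leading_coeffs R A b n J"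
  by (auto simp: leading_coeffs_def)

lemma leading_coeffs_Suc:
  assumes I: "subideal R (adjoin R A b) I"
  shows "leading_coeffs R A b n I \<subseteq> leading_coeffs R A b (Suc n) I"
proof
  fix a assume "a \<in> leading_coeffs R A b n I"
  then obtain w where a: "a \<in> A" "w \<in> polys_below R A b n" "w \<oplus> a \<otimes> b [^] n \<in> I"
    by (auto simp: leading_coeffs_def)
  have "b \<otimes> w \<oplus> a \<otimes> b [^] Suc n = b \<otimes> (w \<oplus> a \<otimes> b [^] n)"
    using polys_below_carrier[OF a(2)] subring_carrier[OF a(1)] b by (simp add: r_distr m_ac)
  also have "\<dots> \<in> I" using I a gen_in_adjoin by (auto simp: subideal_def)
  finally show "a \<in> leading_coeffs R A b (Suc n) I"
    using polys_below_mult_gen[OF a(2)] a(1) unfolding leading_coeffs_def by blast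
qed

text \<open>Descent on the degree: some element of \<open>I\<close> has the same leading term as a
  given \<open>x \<in> J\<close>, and their difference is an element of \<open>J\<close> of smaller
  degree.\<close>

lemma subideal_eqI_leading_coeffs:
  assumes I: "subideal R (adjoin R A b) I" and J: "subideal R (adjoin R A b) J" and IJ: "I \<subseteq> J"
    and L: "\<And>n. leading_coeffs R A b n J \<subseteq> leading_coeffs R A b n I"
  shows "I = J"
proof -
  have "x \<in> I" if "x \<in> J" "x \<in> polys_below R A b n" for x n
    using that
  proof (induction n arbitrary: x)
    case 0 then show ?case using I by (simp add: subideal_def)
  next
    case (Suc n)
    then obtain w a where *: "w \<in> polys_below R A b n" "a \<in> A" "x = w \<oplus> a \<otimes> b [^] n" by auto
    then have "a \<in> leading_coeffs R A b n J" using Suc.prems by (auto simp: leading_coeffs_def)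
    then obtain v where v: "v \<in> polys_below R A b n" "v \<oplus> a \<otimes> b [^] n \<in> I"
      using L by (auto simp: leading_coeffs_def)
    note c = polys_below_carrier[OF *(1)] subring_carrier[OF *(2)] polys_below_carrier[OF v(1)] b
    have m1: "\<ominus> \<one> \<in> adjoin R A b" using subringE(3,5)[OF adjoin_subring] by simp
    have "\<ominus> \<one> \<otimes> (v \<oplus> a \<otimes> b [^] n) \<in> J" using J IJ v m1 by (auto simp: subideal_def)
    then have "x \<oplus> \<ominus> \<one> \<otimes> (v \<oplus> a \<otimes> b [^] n) \<in> J" using J Suc.prems by (simp add: subideal_def)
    moreover have "x \<oplus> \<ominus> \<one> \<otimes> (v \<oplus> a \<otimes> b [^] n) = w \<oplus> \<ominus> v"
    proof -
      have "x \<oplus> \<ominus> \<one> \<otimes> (v \<oplus> a \<otimes> b [^] n) = (w \<oplus> \<ominus> v) \<oplus> (a \<otimes> b [^] n \<oplus> \<ominus> (a \<otimes> b [^] n))"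
        using c by (simp add: * l_minus minus_add a_ac)
      then show ?thesis using c by (simp add: r_neg)
    qed
    ultimately have "w \<oplus> \<ominus> v \<in> J" by simp
    moreover have "w \<oplus> \<ominus> v \<in> polys_below R A b n"
      using polys_below_add[OF *(1) polys_below_neg[OF v(1)]] .
    ultimately have "w \<oplus> \<ominus> v \<in> I" by (rule Suc.IH)
    then have "(w \<oplus> \<ominus> v) \<oplus> (v \<oplus> a \<otimes> b [^] n) \<in> I" using I v by (simp add: subideal_def)
    moreover have "(w \<oplus> \<ominus> v) \<oplus> (v \<oplus> a \<otimes> b [^] n) = x"
    proof -
      have "(w \<oplus> \<ominus> v) \<oplus> (v \<oplus> a \<otimes> b [^] n) = x \<oplus> (v \<oplus> \<ominus> v)"
        using c by (simp add: * a_ac)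
      then show ?thesis using c * by (simp add: r_neg)
    qed
    ultimately show ?case by simp
  qed
  moreover have "J \<subseteq> adjoin R A b" using J by (simp add: subideal_def)
  ultimately show ?thesis using IJ by (auto simp: adjoin_def)
qed

text \<open>Hilbert's basis theorem: the ideals of leading coefficients increase with the degree and
  along the chain, so that the diagonal and finitely many rows control the whole array.\<close>

lemma noetherian_on_adjoin:
  assumes N: "noetherian_on R A"
  shows "noetherian_on R (adjoin R A b)"
  unfolding noetherian_on_def
proof (intro allI impI, elim conjE)
  fix I :: "nat \<Rightarrow> 'a set"
  assume I: "\<forall>n. subideal R (adjoin R A b) (I n)" and inc: "\<forall>n. I n \<subseteq> I (Suc n)"
  let ?L = "\<lambda>n k. leading_coeffs R A b n (I k)"
  have Imono: "I k \<subseteq> I l" if "k \<le> l" for k l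
    by (rule lift_Suc_mono_le[OF _ that]) (use inc in auto)
  have Lmono: "?L m k \<subseteq> ?L n l" if "m \<le> n" "k \<le> l" for m n k l
  proof -
    have "?L m k \<subseteq> ?L n k"
      by (rule lift_Suc_mono_le[OF _ that(1)]) (use leading_coeffs_Suc I in auto)
    also have "\<dots> \<subseteq> ?L n l" using Imono[OF that(2)] by (rule leading_coeffs_mono)
    finally show ?thesis .
  qed
  obtain m where m: "\<And>n. n \<ge> m \<Longrightarrow> ?L n n = ?L m m"
    using noetherian_onD[OF N, of "\<lambda>n. ?L n n"] leading_coeffs_subideal I Lmono by (metis le_SucI order.refl)
  have "\<exists>k. \<forall>l\<ge>k. ?L n l = ?L n k" for n
    using noetherian_onD[OF N, of "\<lambda>k. ?L n k"] leading_coeffs_subideal I Lmono by (metis le_SucI order.refl)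
  then obtain r where r: "\<And>n l. l \<ge> r n \<Longrightarrow> ?L n l = ?L n (r n)" by metis
  \<comment> \<open>Rows below \<open>m\<close> stop growing at their own bounds \<open>r n\<close>.
    A row from \<open>m\<close> on is squeezed: each entry lies in a diagonal entry equal to
    \<open>?L m m\<close>, which is already contained in \<open>?L n M\<close>.\<close>
  define M where "M = Max (insert m (r ` {..<m}))"
  have M: "m \<le> M" "\<And>n. n < m \<Longrightarrow> r n \<le> M" by (auto simp: M_def)
  have "?L n l \<subseteq> ?L n M" if "l \<ge> M" for n l
  proof (cases "n < m")
    case True
    then show ?thesis using r[of n l] r[of n M] M(2)[OF True] that by simp
  next
    case False
    have "?L n l \<subseteq> ?L (max n l) (max n l)" by (rule Lmono) auto
    also have "\<dots> = ?L m m" using M(1) that by (intro m) simp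
    also have "\<dots> \<subseteq> ?L n M" using False M by (intro Lmono) auto
    finally show ?thesis .
  qed
  then have "I M = I l" if "l \<ge> M" for l
    using that I Imono by (intro subideal_eqI_leading_coeffs) auto
  then show "\<exists>m. \<forall>n\<ge>m. I n = I m" by metis
qed

end

section \<open>Finitely generated algebras over noetherian rings and fields\<close>

lemma noetherian_on_generate_ring:
  assumes "finite B" "B \<subseteq> carrier R" "subring A R" "noetherian_on R A"
  shows "noetherian_on R (generate_ring R (A \<union> B))"
  using assms(1,2)
proof (induction B rule: finite_induct)
  case empty
  have "generate_ring R A = A"
    using generate_ringI[of A A] subringE(1)[OF assms(3)] assms(3) by auto
  then show ?case using assms by simp
next
  case (insert b B)
  let ?S = "generate_ring R (A \<union> B)"
  have AB: "A \<union> B \<subseteq> carrier R" using insert subringE(1)[OF assms(3)] by auto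
  have S: "subring ?S R" "A \<union> B \<subseteq> ?S" using generate_ringE[OF AB refl] by auto
  have b: "b \<in> carrier R" using insert by simp
  have "adjoin R ?S b = generate_ring R (A \<union> insert b B)"
  proof (rule generate_ringI)
    show "A \<union> insert b B \<subseteq> carrier R" using AB b by auto
    show "subring (adjoin R ?S b) R" by (rule adjoin_subring[OF S(1) b])
    show "A \<union> insert b B \<subseteq> adjoin R ?S b"
      using S(2) subset_adjoin[OF S(1) b] gen_in_adjoin[OF S(1) b] by auto
    show "adjoin R ?S b \<subseteq> C" if "subring C R" "A \<union> insert b B \<subseteq> C" for C
      using that generate_ring_min_subring1[OF AB that(1)] by (intro adjoin_minimal[OF S(1) b]) auto
  qed
  then show ?case using noetherian_on_adjoin[OF S(1) b] insert by simp
qed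

text \<open>A nonzero element of an ideal is invertible in \<open>K\<close>, so an increasing chain
  jumps at most once, from zero to \<open>K\<close>.\<close>

lemma noetherian_on_subfield:
  assumes K: "subfield K R"
  shows "noetherian_on R K"
  unfolding noetherian_on_def
proof (intro allI impI, elim conjE)
  fix I :: "nat \<Rightarrow> 'a set"
  assume I: "\<forall>n. subideal R K (I n)" and inc: "\<forall>n. I n \<subseteq> I (Suc n)"
  have Imono: "I k \<subseteq> I l" if "k \<le> l" for k l
    by (rule lift_Suc_mono_le[OF _ that]) (use inc in auto)
  have sub: "I n \<subseteq> K" and zero: "\<zero> \<in> I n" for n
    using I unfolding subideal_def by blast+
  have smult: "a \<otimes> x \<in> I n" if "a \<in> K" "x \<in> I n" for a x n
    using I that unfolding subideal_def by blast
  have full: "I n = K" if "x \<in> I n" "x \<noteq> \<zero>" for n x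
  proof
    show "I n \<subseteq> K" by (rule sub)
    have x: "x \<in> K - {\<zero>}" using that sub by blast
    have "inv x \<otimes> x = \<one>" "inv x \<in> K" using subfield_m_inv[OF K x] by auto
    then have one: "\<one> \<in> I n" using smult[of "inv x" x n] that(1) by simp
    show "K \<subseteq> I n"
    proof
      fix k assume k: "k \<in> K"
      then have "k \<otimes> \<one> \<in> I n" using one smult by blast
      moreover have "k \<in> carrier R" using k subfieldE(3)[OF K] by blast
      ultimately show "k \<in> I n" by simp
    qed
  qed
  show "\<exists>m. \<forall>n\<ge>m. I n = I m"
  proof (cases "\<exists>m. \<exists>x\<in>I m. x \<noteq> \<zero>")
    case True
    then obtain m x where mx: "x \<in> I m" "x \<noteq> \<zero>" by blast
    then have "I n = K" if "n \<ge> m" for n using full Imono[OF that] by blast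
    then show ?thesis by (metis order.refl)
  next
    case False
    then have "I n = {\<zero>}" for n using zero[of n] by blast
    then show ?thesis by simp
  qed
qed

text \<open>A maximal member among the finitely generated ideals inside \<open>P\<close> absorbs
  every \<open>p \<in> P\<close>, since adding \<open>p\<close> to its generators cannot enlarge
  it.\<close>

lemma noetherian_on_finitely_generated:
  assumes N: "noetherian_on R (carrier R)" and P: "ideal P R"
  obtains F where "finite F" "F \<subseteq> P" "P = Idl F"
proof -
  let ?C = "{Idl F | F. finite F \<and> F \<subseteq> P}"
  have Pc: "P \<subseteq> carrier R" using ideal.Icarr[OF P] by blast
  have ne: "Idl {} \<in> ?C" by blast
  have C: "subideal R (carrier R) I" if "I \<in> ?C" for I
  proof -
    from that obtain F where "F \<subseteq> P" "I = Idl F" by blast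
    then show ?thesis using genideal_ideal[of F] Pc by (simp add: subideal_carrier_iff)
  qed
  obtain M where M: "M \<in> ?C" "\<And>J. J \<in> ?C \<Longrightarrow> M \<subseteq> J \<Longrightarrow> J = M"
    by (rule noetherian_on_maximal[OF N ne C]) auto
  then obtain F where F: "finite F" "F \<subseteq> P" "M = Idl F" by blast
  have "P \<subseteq> Idl F"
  proof
    fix p assume p: "p \<in> P"
    have "F \<subseteq> Idl (insert p F)" "insert p F \<subseteq> carrier R"
      using genideal_self[of "insert p F"] F p Pc by auto
    then have "M \<subseteq> Idl (insert p F)" using F by (simp add: genideal_minimal genideal_ideal)
    moreover have "Idl (insert p F) \<in> ?C" using F p by blast
    ultimately have "Idl (insert p F) = M" using M by blast
    then show "p \<in> Idl F" using F genideal_self[of "insert p F"] p Pc by auto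
  qed
  moreover have "Idl F \<subseteq> P" using F P by (simp add: genideal_minimal)
  ultimately show thesis using that F by blast
qed

end

section \<open>Powers of an ideal and the Rees algebra\<close>

context cring
begin

lemma ideals_set_one: "\<one>\<^bsub>ideals_set R\<^esub> = carrier R"
  by (simp add: ideals_set_def)

lemma ideals_set_mult: "I \<otimes>\<^bsub>ideals_set R\<^esub> J = I \<cdot>\<^bsub>R\<^esub> J"
  by (simp add: ideals_set_def)

lemma ideal_power_ideal:
  assumes "ideal P R"
  shows "ideal (P [^]\<^bsub>ideals_set R\<^esub> (n::nat)) R"
  by (induction n) (simp_all add: ideals_set_one ideals_set_mult oneideal ideal_prod_is_ideal assms)

lemma ideal_power_add:
  assumes P: "ideal P R" and a: "a \<in> P [^]\<^bsub>ideals_set R\<^esub> (m::nat)" and b: "b \<in> P [^]\<^bsub>ideals_set R\<^esub> (n::nat)"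
  shows "a \<otimes> b \<in> P [^]\<^bsub>ideals_set R\<^esub> (m + n)"
  using b
proof (induction n arbitrary: b)
  case 0
  then show ?case using ideal.I_r_closed[OF ideal_power_ideal[OF P] a] by (simp add: ideals_set_one)
next
  case (Suc n)
  note ac = ideal.Icarr[OF ideal_power_ideal[OF P] a]
  have sub: "(P [^]\<^bsub>ideals_set R\<^esub> n) \<cdot>\<^bsub>R\<^esub> P \<subseteq> carrier R"
    by (rule ideal_prod_in_carrier[OF ideal_power_ideal[OF P] P])
  from Suc.prems have "b \<in> (P [^]\<^bsub>ideals_set R\<^esub> n) \<cdot>\<^bsub>R\<^esub> P" by (simp add: ideals_set_mult)
  then show ?case
  proof (induction b rule: ideal_prod.induct)
    case (prod u v)
    have "a \<otimes> (u \<otimes> v) = (a \<otimes> u) \<otimes> v"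
      using ac ideal.Icarr[OF ideal_power_ideal[OF P] prod(1)] ideal.Icarr[OF P prod(2)] by (simp add: m_assoc)
    then show ?case using Suc.IH[OF prod(1)] prod(2) by (simp add: ideals_set_mult ideal_prod.prod)
  next
    case (sum u v)
    have "a \<otimes> (u \<oplus> v) = a \<otimes> u \<oplus> a \<otimes> v" using sum.hyps(1,2) sub ac by (intro r_distr) auto
    then show ?case using ideal_add_closed[OF ideal_power_ideal[OF P] sum.IH] by simp
  qed
qed

lemma ideal_power_1:
  assumes "ideal P R"
  shows "P [^]\<^bsub>ideals_set R\<^esub> (1::nat) = P"
  using ideal_prod_commute[OF oneideal assms] ideal_prod_one[OF assms] 
  by (simp add: ideals_set_one ideals_set_mult)

lemma ideal_power_antimono:
  assumes P: "ideal P R" and "m \<le> n"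
  shows "P [^]\<^bsub>ideals_set R\<^esub> (n::nat) \<subseteq> P [^]\<^bsub>ideals_set R\<^esub> (m::nat)"
  using assms(2)
proof (rule lift_Suc_antimono_le[rotated])
  fix n
  show "P [^]\<^bsub>ideals_set R\<^esub> (Suc n) \<subseteq> P [^]\<^bsub>ideals_set R\<^esub> (n::nat)"
    using ideal_prod_inter[OF ideal_power_ideal[OF P, of n] P] by (simp add: ideals_set_mult)
qed

lemma element_power_in_ideal_power:
  assumes P: "ideal P R" and "a \<in> P"
  shows "a [^] n \<in> P [^]\<^bsub>ideals_set R\<^esub> (n::nat)"
proof (induction n)
  case 0 show ?case by (simp add: ideals_set_one)
next
  case (Suc n)
  then show ?case
    using ideal_power_add[OF P Suc, of a 1] assms by (simp add: ideal_power_1[OF P, simplified])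
qed

text \<open>The ideals \<open>{f \<in> A. \<forall>k. c \<cdot> coeff f k \<in> P\<^sup>k\<^sup>+\<^sup>1}\<close> of the Rees algebra \<open>A = \<Oplus>\<^sub>k P\<^sup>k t\<^sup>k\<close>,
  indexed by \<open>c \<in> U\<close>, form a directed family; a maximal member gives a \<open>c\<close> that works for all degrees.\<close>

lemma uniform_annihilator:
  assumes N: "noetherian_on R (carrier R)" and P: "ideal P R"
    and U: "u \<in> U" "U \<subseteq> carrier R" "\<And>c d. \<lbrakk>c \<in> U; d \<in> U\<rbrakk> \<Longrightarrow> c \<otimes> d \<in> U"
  obtains c where "c \<in> U"
    "\<And>d a (k::nat). \<lbrakk>d \<in> U; a \<in> P [^]\<^bsub>ideals_set R\<^esub> k; d \<otimes> a \<in> P [^]\<^bsub>ideals_set R\<^esub> Suc k\<rbrakk>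
       \<Longrightarrow> c \<otimes> a \<in> P [^]\<^bsub>ideals_set R\<^esub> Suc k"
proof -
  let ?S = "UP R" and ?m = "UnivPoly.monom (UP R)" and ?c = "UnivPoly.coeff (UP R)"
  let ?P = "\<lambda>k::nat. P [^]\<^bsub>ideals_set R\<^esub> k"
  interpret S: UP_cring R ?S by unfold_locales simp
  note Pid = ideal_power_ideal[OF P]
  \<comment> \<open>The copy of \<open>R\<close> formed by the constants of \<open>R[t]\<close>;
    being noetherian is transported along it.\<close>
  define B0 where "B0 = (\<lambda>r. ?m r 0) ` carrier R"
  have B0: "subring B0 ?S"
  proof (rule S.P.subringI)
    show "B0 \<subseteq> carrier ?S" by (auto simp: B0_def)
    show "\<one>\<^bsub>?S\<^esub> \<in> B0" using S.monom_one by (auto simp: B0_def intro!: image_eqI[of _ _ \<one>])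
    fix f assume "f \<in> B0"
    then obtain r where r: "r \<in> carrier R" "f = ?m r 0" by (auto simp: B0_def)
    then have "\<ominus>\<^bsub>?S\<^esub> f = ?m (\<ominus> r) 0" by simp
    then show "\<ominus>\<^bsub>?S\<^esub> f \<in> B0" using r unfolding B0_def by (metis a_inv_closed image_eqI)
    fix g assume "g \<in> B0"
    then obtain s where s: "s \<in> carrier R" "g = ?m s 0" by (auto simp: B0_def)
    have "f \<otimes>\<^bsub>?S\<^esub> g = ?m (r \<otimes> s) 0" using r s S.monom_mult[of r s 0 0] by simp
    then show "f \<otimes>\<^bsub>?S\<^esub> g \<in> B0" using r s by (auto simp: B0_def)
    have eq: "f \<oplus>\<^bsub>?S\<^esub> g = ?m (r \<oplus> s) 0" using r s by simp
    show "f \<oplus>\<^bsub>?S\<^esub> g \<in> B0" unfolding eq B0_def using r s by (intro imageI a_closed)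
  qed
  have NB0: "noetherian_on ?S B0"
    unfolding noetherian_on_def
  proof (intro allI impI, elim conjE)
    fix I :: "nat \<Rightarrow> (nat \<Rightarrow> 'a) set"
    assume I: "\<forall>n. subideal ?S B0 (I n)" and inc: "\<forall>n. I n \<subseteq> I (Suc n)"
    let ?J = "\<lambda>n. {r \<in> carrier R. ?m r 0 \<in> I n}"
    have I': "I n \<subseteq> B0" "\<zero>\<^bsub>?S\<^esub> \<in> I n" "\<And>f g. f \<in> I n \<Longrightarrow> g \<in> I n \<Longrightarrow> f \<oplus>\<^bsub>?S\<^esub> g \<in> I n"
      "\<And>f g. f \<in> B0 \<Longrightarrow> g \<in> I n \<Longrightarrow> f \<otimes>\<^bsub>?S\<^esub> g \<in> I n" for n
      using I unfolding subideal_def by blast+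
    have "subideal R (carrier R) (?J n)" for n
      unfolding subideal_def
    proof (intro conjI ballI)
      show "\<zero> \<in> ?J n" using I'(2)[of n] S.monom_zero by simp
      fix a assume a: "a \<in> ?J n"
      { fix b assume "b \<in> ?J n"
        then show "a \<oplus> b \<in> ?J n" using I'(3)[of "?m a 0" n "?m b 0"] a by simp }
      { fix b assume b: "b \<in> carrier R"
        then show "b \<otimes> a \<in> ?J n"
          using I'(4)[of "?m b 0" "?m a 0" n] a S.monom_mult[of b a 0 0] by (simp add: B0_def) }
    qed auto
    moreover have "?J n \<subseteq> ?J (Suc n)" for n using inc by blast
    ultimately obtain m where m: "\<And>n. n \<ge> m \<Longrightarrow> ?J n = ?J m" by (rule noetherian_onD[OF N]) blast
    have img: "I n = (\<lambda>r. ?m r 0) ` ?J n" for n using I'(1)[of n] by (auto simp: B0_def)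
    have "I n = I m" if "n \<ge> m" for n using img[of n] img[of m] m[OF that] by simp
    then show "\<exists>m. \<forall>n\<ge>m. I n = I m" by blast
  qed
  obtain F where F: "finite F" "F \<subseteq> P" "P = Idl F"
    by (rule noetherian_on_finitely_generated[OF N P])
  have Fc: "F \<subseteq> carrier R" using F(2) ideal.Icarr[OF P] by blast
  \<comment> \<open>The Rees algebra inside \<open>R[t]\<close>. Taking \<open>f t\<close> only for
    the finitely many generators \<open>f\<close> of \<open>P\<close> makes it noetherian; that it
    contains all of \<open>P^k t^k\<close> is then the content of \<open>mono_A\<close>.\<close>
  define A where "A = generate_ring ?S (B0 \<union> (\<lambda>f. ?m f 1) ` F)"
  have gens: "B0 \<union> (\<lambda>f. ?m f 1) ` F \<subseteq> carrier ?S" using Fc by (auto simp: B0_def)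
  have A: "subring A ?S" "B0 \<subseteq> A" "\<And>f. f \<in> F \<Longrightarrow> ?m f 1 \<in> A"
    using S.P.generate_ringE[OF gens A_def] by auto
  have NA: "noetherian_on ?S A"
    unfolding A_def using gens F(1) B0 NB0 by (intro S.P.noetherian_on_generate_ring) auto
  have mono_A: "?m a k \<in> A" if "a \<in> ?P k" for a k
    using that
  proof (induction k arbitrary: a)
    case 0 then show ?case using A(2) by (auto simp: ideals_set_one B0_def)
  next
    case (Suc k)
    have deg1: "?m p 1 \<in> A" if "p \<in> P" for p
    proof -
      have "ideal {p \<in> carrier R. ?m p 1 \<in> A} R"
        unfolding subideal_carrier_iff[symmetric] subideal_def
      proof (intro conjI ballI)
        show "\<zero> \<in> {p \<in> carrier R. ?m p 1 \<in> A}" using subringE(2)[OF A(1)] by simp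
        fix a assume a: "a \<in> {p \<in> carrier R. ?m p 1 \<in> A}"
        { fix b assume "b \<in> {p \<in> carrier R. ?m p 1 \<in> A}"
          then show "a \<oplus> b \<in> {p \<in> carrier R. ?m p 1 \<in> A}"
            using a subringE(7)[OF A(1), of "?m a 1" "?m b 1"] by simp }
        { fix b assume b: "b \<in> carrier R"
          have "?m b 0 \<in> A" using A(2) b by (auto simp: B0_def)
          then show "b \<otimes> a \<in> {p \<in> carrier R. ?m p 1 \<in> A}"
            using a b subringE(6)[OF A(1), of "?m b 0" "?m a 1"] S.monom_mult[of b a 0 1] by simp }
      qed auto
      then have "Idl F \<subseteq> {p \<in> carrier R. ?m p 1 \<in> A}" using A(3) Fc by (intro genideal_minimal) auto
      then show ?thesis using that F(3) by blast
    qed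
    have sub: "(?P k) \<cdot>\<^bsub>R\<^esub> P \<subseteq> carrier R"
      by (rule ideal_prod_in_carrier[OF Pid P])
    from Suc.prems have "a \<in> (?P k) \<cdot>\<^bsub>R\<^esub> P" by (simp add: ideals_set_mult)
    then show ?case
    proof (induction a rule: ideal_prod.induct)
      case (prod u v)
      have "?m (u \<otimes> v) (Suc k) = ?m u k \<otimes>\<^bsub>?S\<^esub> ?m v 1"
        using S.monom_mult[of u v k 1] ideal.Icarr[OF Pid prod(1)] ideal.Icarr[OF P prod(2)] by simp
      then show ?case using subringE(6)[OF A(1) Suc.IH[OF prod(1)] deg1[OF prod(2)]] by simp
    next
      case (sum u v)
      have "u \<in> carrier R" "v \<in> carrier R" using sum.hyps(1,2) sub by auto
      then show ?case using subringE(7)[OF A(1) sum.IH] by simp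
    qed
  qed
  \<comment> \<open>The coefficient of a product is a convolution. In the proof the summation bound
    \<open>k\<close> varies while \<open>n\<close> stays fixed, because the summands involve
    \<open>n - i\<close>.\<close>
  have conv: "(\<Oplus>i\<in>{..n}. f i \<otimes> g (n - i)) \<in> J"
    if J: "ideal J R" and fg: "\<And>i. i \<le> n \<Longrightarrow> f i \<otimes> g (n - i) \<in> J" for f g J and n :: nat
  proof -
    have "(\<Oplus>i\<in>{..k}. f i \<otimes> g (n - i)) \<in> J" if "k \<le> n" for k
      using that
    proof (induction k)
      case 0 then show ?case using fg[of 0] ideal.Icarr[OF J fg[of 0]] by simp
    next
      case (Suc k)
      have c: "f i \<otimes> g (n - i) \<in> carrier R" if "i \<le> Suc k" for i
        using ideal.Icarr[OF J fg] that Suc.prems by simp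
      then have "(\<Oplus>i\<in>{..Suc k}. f i \<otimes> g (n - i))
         = f (Suc k) \<otimes> g (n - Suc k) \<oplus> (\<Oplus>i\<in>{..k}. f i \<otimes> g (n - i))"
        by (intro finsum_Suc) auto
      also have "\<dots> \<in> J" using Suc fg by (intro ideal_add_closed[OF J]) auto
      finally show ?case .
    qed
    then show ?thesis by simp
  qed
  \<comment> \<open>The inclusion opposite to \<open>mono_A\<close>. It is what lets multiplication
    by an element of \<open>A\<close> preserve the condition defining \<open>T c\<close>.\<close>
  have coeff_A: "?c f k \<in> ?P k" if "f \<in> A" for f k
  proof -
    let ?E = "{f \<in> carrier ?S. \<forall>k. ?c f k \<in> ?P k}"
    have "A \<subseteq> ?E"
      unfolding A_def
    proof (rule S.P.generate_ring_min_subring1[OF gens])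
      show "subring ?E ?S"
      proof (rule S.P.subringI)
        show "\<one>\<^bsub>?S\<^esub> \<in> ?E" using ideal_zero_closed[OF Pid] by (simp add: ideals_set_one)
        fix f assume f: "f \<in> ?E"
        then show "\<ominus>\<^bsub>?S\<^esub> f \<in> ?E" using ideal_neg_closed[OF Pid] by simp
        fix g assume g: "g \<in> ?E"
        show "f \<oplus>\<^bsub>?S\<^esub> g \<in> ?E" using f g ideal_add_closed[OF Pid] by simp
        have "?c f i \<otimes> ?c g (k - i) \<in> ?P k" if "i \<le> k" for i k
          using f g ideal_power_add[OF P, of "?c f i" i "?c g (k - i)" "k - i"] that by simp
        then have "(\<Oplus>i\<in>{..k}. ?c f i \<otimes> ?c g (k - i)) \<in> ?P k" for k
          by (intro conv[OF Pid]) simp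
        then show "f \<otimes>\<^bsub>?S\<^esub> g \<in> ?E" using f g by simp
      qed auto
      have "?m r 0 \<in> ?E" if "r \<in> carrier R" for r
        using that ideal_zero_closed[OF Pid] by (simp add: ideals_set_one)
      moreover have "?m f 1 \<in> ?E" if "f \<in> F" for f
      proof -
        have "f \<in> carrier R" "f \<in> ?P 1" using that Fc F(2) ideal_power_1[OF P] by auto
        then show ?thesis using ideal_zero_closed[OF Pid] by simp
      qed
      ultimately show "B0 \<union> (\<lambda>f. ?m f 1) ` F \<subseteq> ?E" unfolding B0_def by blast
    qed
    then show ?thesis using that by blast
  qed
  have Ac: "f \<in> A \<Longrightarrow> f \<in> carrier ?S" for f using subringE(1)[OF A(1)] by blast
  define T where "T = (\<lambda>c. {f \<in> A. \<forall>k. c \<otimes> ?c f k \<in> ?P (Suc k)})"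
  have T: "subideal ?S A (T c)" if c: "c \<in> U" for c
    unfolding subideal_def
  proof (intro conjI ballI)
    have cc: "c \<in> carrier R" using c U by blast
    show "\<zero>\<^bsub>?S\<^esub> \<in> T c" using subringE(2)[OF A(1)] ideal_zero_closed[OF Pid] cc by (simp add: T_def del: Group.nat_pow_Suc)
    fix f assume f: "f \<in> T c"
    then have fA: "f \<in> A" and fT: "\<And>k. c \<otimes> ?c f k \<in> ?P (Suc k)"
      by (auto simp: T_def simp del: Group.nat_pow_Suc)
    { fix g assume "g \<in> T c"
      then have gA: "g \<in> A" and gT: "\<And>k. c \<otimes> ?c g k \<in> ?P (Suc k)"
        by (auto simp: T_def simp del: Group.nat_pow_Suc)
      have "c \<otimes> ?c (f \<oplus>\<^bsub>?S\<^esub> g) k = c \<otimes> ?c f k \<oplus> c \<otimes> ?c g k" for k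
        using Ac[OF fA] Ac[OF gA] cc by (simp add: r_distr)
      then show "f \<oplus>\<^bsub>?S\<^esub> g \<in> T c"
        using subringE(7)[OF A(1) fA gA] ideal_add_closed[OF Pid fT gT] by (simp add: T_def del: Group.nat_pow_Suc) }
    { fix g assume gA: "g \<in> A"
      have "c \<otimes> ?c (g \<otimes>\<^bsub>?S\<^esub> f) k \<in> ?P (Suc k)" for k
      proof -
        have gc: "?c g i \<in> carrier R" "?c f i \<in> carrier R" for i using Ac[OF fA] Ac[OF gA] by auto
        have "?c g i \<otimes> (c \<otimes> ?c f (k - i)) \<in> ?P (Suc k)" if "i \<le> k" for i
          using ideal_power_add[OF P coeff_A[OF gA, of i] fT[of "k - i"]] that by (simp del: Group.nat_pow_Suc)
        then have "(\<Oplus>i\<in>{..k}. ?c g i \<otimes> (c \<otimes> ?c f (k - i))) \<in> ?P (Suc k)"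
          by (intro conv[OF Pid])
        moreover have "c \<otimes> ?c (g \<otimes>\<^bsub>?S\<^esub> f) k = (\<Oplus>i\<in>{..k}. ?c g i \<otimes> (c \<otimes> ?c f (k - i)))"
          using gc cc Ac[OF fA] Ac[OF gA]
          by (simp add: finsum_rdistr Pi_def) (intro finsum_cong'; simp add: m_lcomm)
        ultimately show ?thesis by simp
      qed
      then show "g \<otimes>\<^bsub>?S\<^esub> f \<in> T c" using subringE(6)[OF A(1) gA fA] by (simp add: T_def del: Group.nat_pow_Suc) }
  qed (auto simp: T_def)
  obtain M where M: "M \<in> T ` U" "\<And>J. J \<in> T ` U \<Longrightarrow> M \<subseteq> J \<Longrightarrow> J = M"
    by (rule noetherian_on_maximal[OF NA imageI[OF U(1), of T]]) (use T in auto)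
  then obtain c where c: "c \<in> U" "M = T c" by blast
  have "c \<otimes> a \<in> ?P (Suc k)" if d: "d \<in> U" and a: "a \<in> ?P k" and da: "d \<otimes> a \<in> ?P (Suc k)" for d a k
  proof -
    have cd: "c \<in> carrier R" "d \<in> carrier R" using c d U by auto
    have ac: "a \<in> carrier R" using ideal.Icarr[OF Pid a] .
    \<comment> \<open>Directedness: \<open>T (c \<otimes> d)\<close> contains both
      \<open>T c\<close> and \<open>T d\<close>. Maximality of \<open>T c\<close> makes it equal to
      \<open>T c\<close>, so \<open>T d \<subseteq> T c\<close> for every
      \<open>d \<in> U\<close>.\<close>
    have "T c \<subseteq> T (c \<otimes> d)" "T d \<subseteq> T (c \<otimes> d)"
    proof -
      show "T c \<subseteq> T (c \<otimes> d)"
      proof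
        fix f assume f: "f \<in> T c"
        have "c \<otimes> d \<otimes> ?c f k = d \<otimes> (c \<otimes> ?c f k)" for k
          using cd f Ac[of f] by (simp add: T_def m_ac)
        then show "f \<in> T (c \<otimes> d)" using f ideal.I_l_closed[OF Pid _ cd(2)] by (simp add: T_def del: Group.nat_pow_Suc)
      qed
      show "T d \<subseteq> T (c \<otimes> d)"
      proof
        fix f assume f: "f \<in> T d"
        have "c \<otimes> d \<otimes> ?c f k = c \<otimes> (d \<otimes> ?c f k)" for k
          using cd f Ac[of f] by (simp add: T_def m_ac)
        then show "f \<in> T (c \<otimes> d)" using f ideal.I_l_closed[OF Pid _ cd(1)] by (simp add: T_def del: Group.nat_pow_Suc)
      qed
    qed
    moreover from this have "T (c \<otimes> d) = T c" using M(2)[of "T (c \<otimes> d)"] c U(3)[OF c(1) d] by blast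
    \<comment> \<open>The monomial \<open>a t^k\<close> turns the inclusion
      \<open>T d \<subseteq> T c\<close> into the statement about the single element
      \<open>a\<close>.\<close>
    moreover have "?m a k \<in> T d"
      using mono_A[OF a] da ac cd ideal_zero_closed[OF Pid] by (simp add: T_def del: Group.nat_pow_Suc)
    ultimately have "?m a k \<in> T c" by blast
    then have "c \<otimes> ?c (?m a k) k \<in> ?P (Suc k)" unfolding T_def by blast
    then show ?thesis using ac by simp
  qed
  then show thesis using that c(1) by blast
qed

end

section \<open>Graded rings\<close>

definition component :: "('a, 'c) ring_scheme \<Rightarrow> (nat \<Rightarrow> 'a set) \<Rightarrow> 'a \<Rightarrow> nat \<Rightarrow> 'a" where
  "component R G r = (THE f. (\<forall>i. f i \<in> G i) \<and> finite {i. f i \<noteq> \<zero>\<^bsub>R\<^esub>} \<and>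
     r = (\<Oplus>\<^bsub>R\<^esub>i\<in>{i. f i \<noteq> \<zero>\<^bsub>R\<^esub>}. f i))"

text \<open>Adding one homogeneous element at a time gives an induction rule in place of finite sums
  over a support.\<close>

inductive_set homogeneous_sums :: "('a, 'c) ring_scheme \<Rightarrow> (nat \<Rightarrow> 'a set) \<Rightarrow> 'a set \<Rightarrow> 'a set"
  for R G I where
    zero: "\<zero>\<^bsub>R\<^esub> \<in> homogeneous_sums R G I"
  | add: "\<lbrakk>u \<in> homogeneous_sums R G I; g \<in> I; g \<in> G i\<rbrakk> \<Longrightarrow> u \<oplus>\<^bsub>R\<^esub> g \<in> homogeneous_sums R G I"

text \<open>Every element is a sum of homogeneous elements of the ideal itself. Unlike a homogeneous
  generating set, this form passes directly to sums, products and components;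
  \<open>graded_ideal_genideal\<close> derives it from generators.\<close>

definition graded_ideal :: "('a, 'c) ring_scheme \<Rightarrow> (nat \<Rightarrow> 'a set) \<Rightarrow> 'a set \<Rightarrow> bool" where
  "graded_ideal R G I \<longleftrightarrow> ideal I R \<and> I \<subseteq> homogeneous_sums R G I"

text \<open>Because \<open>P \<subseteq> Q\<close>, a coset in the image of \<open>Q\<close> has all
  its representatives in \<open>Q\<close> (fact \<open>mem\<close>), so primality can be tested on
  representatives.\<close>

lemma (in cring) primeideal_quotient:
  assumes P: "ideal P R" and Q: "primeideal Q R" and PQ: "P \<subseteq> Q"
  shows "primeideal ((+>) P ` Q) (R Quot P)"
proof -
  interpret P: ideal P R by (rule P)
  interpret Q: primeideal Q R by (rule Q)
  have mem: "x \<in> Q" if "x \<in> carrier R" "P +> x \<in> (+>) P ` Q" for x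
  proof -
    from that obtain z where z: "z \<in> Q" "P +> x = P +> z" by blast
    then have "x \<in> P +> z" using P.a_rcos_self[OF that(1)] by simp
    then obtain h where "h \<in> P" "x = h \<oplus> z" by (auto simp: a_r_coset_def')
    then show ?thesis using PQ z ideal_add_closed[OF Q.is_ideal] by blast
  qed
  have car: "carrier (R Quot P) = (+>) P ` carrier R"
    by (auto simp: FactRing_def A_RCOSETS_def')
  show ?thesis
  proof (rule primeidealI)
    show "ideal ((+>) P ` Q) (R Quot P)" by (rule ring_ideal_imp_quot_ideal[OF P Q.is_ideal])
    show "cring (R Quot P)" using P.quotient_is_cring is_cring by blast
    show "carrier (R Quot P) \<noteq> (+>) P ` Q"
    proof
      assume "carrier (R Quot P) = (+>) P ` Q"
      then have "P +> \<one> \<in> (+>) P ` Q" using car by blast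
      then have "\<one> \<in> Q" by (rule mem[OF one_closed])
      then show False using Q.one_imp_carrier Q.I_notcarr by blast
    qed
    fix a b assume "a \<in> carrier (R Quot P)" "b \<in> carrier (R Quot P)" and ab: "a \<otimes>\<^bsub>R Quot P\<^esub> b \<in> (+>) P ` Q"
    then obtain x y where xy: "x \<in> carrier R" "a = P +> x" "y \<in> carrier R" "b = P +> y"
      unfolding car by blast
    have "a \<otimes>\<^bsub>R Quot P\<^esub> b = P +> (x \<otimes> y)"
      using xy P.rcoset_mult_add[of x y] by (simp add: FactRing_def)
    then have "x \<otimes> y \<in> Q" using mem[OF m_closed[OF xy(1,3)]] ab by simp
    then have "x \<in> Q \<or> y \<in> Q" using Q.I_prime xy by blast
    then show "a \<in> (+>) P ` Q \<or> b \<in> (+>) P ` Q" unfolding xy(2,4) by blast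
  qed
qed

text \<open>The form in which the dimension enters: the images of the three primes would be a chain
  of length two in \<open>R Quot P\<close>.\<close>

lemma (in cring) krull_dim_quotient_one:
  assumes dim: "krull_dim (R Quot P) = 1" and P: "primeideal P R" "primeideal Q R" "primeideal M R"
    and chain: "P \<subset> Q" "Q \<subset> M"
  shows False
proof -
  have Pi: "ideal P R" using P(1) by (rule primeideal.axioms(1))
  let ?f = "\<lambda>Q. (+>) P ` Q"
  have strict: "?f A \<subset> ?f B" if A: "ideal A R" "P \<subseteq> A" and B: "ideal B R" and AB: "A \<subset> B" for A B
  proof -
    from AB obtain x where x: "x \<in> B" "x \<notin> A" by blast
    have "P +> x \<notin> ?f A"
    proof
      assume "P +> x \<in> ?f A"
      then obtain z where z: "z \<in> A" "P +> x = P +> z" by blast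
      interpret P: ideal P R by (rule Pi)
      have "x \<in> P +> z" using z P.a_rcos_self[OF ideal.Icarr[OF B x(1)]] by simp
      then obtain h where "h \<in> P" "x = h \<oplus> z" by (auto simp: a_r_coset_def')
      then show False using A z x ideal_add_closed by blast
    qed
    then show ?thesis using x AB by blast
  qed
  define N where "N = (\<lambda>i::nat. if i = 0 then ?f P else if i = 1 then ?f Q else ?f M)"
  note ids = P[THEN primeideal.axioms(1)]
  have "primeideal (N i) (R Quot P)" for i
    using primeideal_quotient[OF Pi] P chain by (auto simp: N_def)
  moreover have "N i \<subset> N (Suc i)" if "i < 2" for i
    using that strict[of P Q] strict[of Q M] ids chain by (cases i) (auto simp: N_def less_2_cases_iff)
  ultimately have "(2::enat) \<in> {enat n | n. \<exists>P'. (\<forall>i\<le>n. primeideal (P' i) (R Quot P)) \<and> (\<forall>i<n. P' i \<subset> P' (Suc i))}"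
    by (auto intro!: exI[of _ 2] exI[of _ N] simp: numeral_eq_enat)
  then have "2 \<le> krull_dim (R Quot P)" unfolding krull_dim_def by (rule Sup_upper)
  then show False using dim by (simp add: one_enat_def numeral_eq_enat)
qed

lemma (in primeideal) power_mem:
  assumes "a \<in> carrier R" "a [^] (n::nat) \<in> I"
  shows "a \<in> I"
  using assms(2)
proof (induction n)
  case 0 then show ?case using one_imp_carrier I_notcarr by simp
next
  case (Suc n) then show ?case using I_prime[of "a [^] n" a] assms(1) by auto
qed

section \<open>Homogeneous components and the filtration by degree\<close>

context standard_graded_algebra
begin

lemma G_carrier: "g \<in> G i \<Longrightarrow> g \<in> carrier R"
  using additive_subgroup.a_Hcarr[OF additive_subgroup_G] .

lemma G_zero: "\<zero> \<in> G i"
  using additive_subgroup.zero_closed[OF additive_subgroup_G] .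

lemma G_add: "\<lbrakk>g \<in> G i; h \<in> G i\<rbrakk> \<Longrightarrow> g \<oplus> h \<in> G i"
  using additive_subgroup.a_closed[OF additive_subgroup_G] .

lemma one_in_G0: "\<one> \<in> G 0"
  using subfieldE(1)[OF subfield_K] subringE(3) degree_zero subcringE by (metis subfieldE(1) subcringE(3))

lemma component_props:
  assumes "r \<in> carrier R"
  shows "component R G r i \<in> G i" "finite {i. component R G r i \<noteq> \<zero>}"
    "r = (\<Oplus>i\<in>{i. component R G r i \<noteq> \<zero>}. component R G r i)"
proof -
  from theI'[OF direct_sum[OF assms]] show "component R G r i \<in> G i" "finite {i. component R G r i \<noteq> \<zero>}"
    "r = (\<Oplus>i\<in>{i. component R G r i \<noteq> \<zero>}. component R G r i)"
    unfolding component_def by blast+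
qed

text \<open>Allowing any finite set \<open>A\<close> that contains the support lets two
  decompositions be added over a common index set.\<close>

lemma component_eqI:
  assumes f: "\<And>i. f i \<in> G i" and A: "finite A" "\<And>i. i \<notin> A \<Longrightarrow> f i = \<zero>" and r: "r = (\<Oplus>i\<in>A. f i)"
  shows "component R G r = f"
proof -
  have sub: "{i. f i \<noteq> \<zero>} \<subseteq> A" using A(2) by blast
  have "r = (\<Oplus>i\<in>{i. f i \<noteq> \<zero>}. f i)"
    unfolding r using A(1) sub f G_carrier by (intro add.finprod_mono_neutral_cong_right) auto
  moreover have "finite {i. f i \<noteq> \<zero>}" using A(1) sub by (rule rev_finite_subset)
  moreover have rc: "r \<in> carrier R" unfolding r using f G_carrier by (intro finsum_closed) auto
  ultimately show ?thesis
    unfolding component_def using f by (intro the1_equality[OF direct_sum[OF rc]]) auto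
qed

lemma component_homogeneous:
  assumes "g \<in> G n"
  shows "component R G g = (\<lambda>i. if i = n then g else \<zero>)"
proof (rule component_eqI[where A = "{n}"])
  show "g = (\<Oplus>i\<in>{n}. if i = n then g else \<zero>)" using G_carrier[OF assms] by simp
qed (use assms G_zero in auto)

lemma component_add:
  assumes r: "r \<in> carrier R" and s: "s \<in> carrier R"
  shows "component R G (r \<oplus> s) i = component R G r i \<oplus> component R G s i"
proof -
  let ?r = "component R G r" and ?s = "component R G s"
  let ?A = "{i. ?r i \<noteq> \<zero>} \<union> {i. ?s i \<noteq> \<zero>}"
  have c: "?r i \<in> carrier R" "?s i \<in> carrier R" for i
    using component_props(1) r s G_carrier by blast+
  have fin: "finite ?A" using component_props(2) r s by simp
  have "r = (\<Oplus>i\<in>?A. ?r i)"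
    by (subst component_props(3)[OF r], rule add.finprod_mono_neutral_cong_left) (use fin c in auto)
  moreover have "s = (\<Oplus>i\<in>?A. ?s i)"
    by (subst component_props(3)[OF s], rule add.finprod_mono_neutral_cong_left) (use fin c in auto)
  ultimately have "r \<oplus> s = (\<Oplus>i\<in>?A. ?r i \<oplus> ?s i)"
    using finsum_addf[of ?r ?A ?s] c by auto
  then have "component R G (r \<oplus> s) = (\<lambda>i. ?r i \<oplus> ?s i)"
    using fin component_props(1)[OF r] component_props(1)[OF s] G_add
    by (intro component_eqI[where A = ?A]) auto
  then show ?thesis by simp
qed

lemma component_zero: "component R G \<zero> i = \<zero>"
  using component_homogeneous[OF G_zero[of 0]] by simp

lemma component_diff:
  assumes "r \<in> carrier R" "g \<in> carrier R"
  shows "component R G (r \<ominus> g) i = component R G r i \<ominus> component R G g i"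
proof -
  have c: "component R G x i \<in> carrier R" if "x \<in> carrier R" for x
    using component_props(1)[OF that] G_carrier by blast
  have e: "r \<ominus> g \<oplus> g = r" using assms by (simp add: a_minus_def a_assoc l_neg)
  have "component R G (r \<ominus> g) i \<oplus> component R G g i = component R G r i"
    using component_add[of "r \<ominus> g" g i] assms by (simp add: e)
  then have "component R G r i \<ominus> component R G g i
      = component R G (r \<ominus> g) i \<oplus> component R G g i \<oplus> \<ominus> component R G g i"
    by (simp add: a_minus_def)
  also have "\<dots> = component R G (r \<ominus> g) i" using c assms by (simp add: a_assoc r_neg)
  finally show ?thesis by simp
qed

text \<open>Elements of degree less than \<open>n\<close>, with \<open>below 0\<close> reduced to
  zero. Induction along this filtration avoids assigning a degree to zero.\<close>

definition below :: "nat \<Rightarrow> 'a set" where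
  "below n = {r \<in> carrier R. \<forall>i\<ge>n. component R G r i = \<zero>}"

lemma below_carrier: "u \<in> below n \<Longrightarrow> u \<in> carrier R"
  by (simp add: below_def)

lemma below_exhaustive:
  assumes "r \<in> carrier R"
  obtains n where "r \<in> below n"
proof -
  obtain n where "\<And>i. component R G r i \<noteq> \<zero> \<Longrightarrow> i < n"
    using component_props(2)[OF assms] by (auto simp: finite_nat_set_iff_bounded)
  then have "r \<in> below n" using assms by (auto simp: below_def not_less[symmetric])
  then show thesis by (rule that)
qed

lemma below_0: "u \<in> below 0 \<Longrightarrow> u = \<zero>"
  using component_props(3)[of u] by (simp add: below_def)

lemma below_mono: "m \<le> n \<Longrightarrow> u \<in> below m \<Longrightarrow> u \<in> below n"
  by (auto simp: below_def)

lemma below_add: "\<lbrakk>u \<in> below n; v \<in> below n\<rbrakk> \<Longrightarrow> u \<oplus> v \<in> below n"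
  by (auto simp: below_def component_add)

lemma below_zero: "\<zero> \<in> below n"
  by (simp add: below_def component_zero)

lemma homogeneous_below: "g \<in> G n \<Longrightarrow> n < m \<Longrightarrow> g \<in> below m"
  by (auto simp: below_def component_homogeneous G_carrier)

lemma below_SucE:
  assumes r: "r \<in> below (Suc n)"
  obtains u g where "u \<in> below n" "g \<in> G n" "r = u \<oplus> g"
proof -
  have rc: "r \<in> carrier R" using r by (rule below_carrier)
  let ?g = "component R G r n"
  have g: "?g \<in> G n" by (rule component_props(1)[OF rc])
  note gc = G_carrier[OF g]
  have "component R G (r \<ominus> ?g) i = \<zero>" if "i \<ge> n" for i
    using component_diff[OF rc gc, of i] component_homogeneous[OF g] r that gc
    by (cases "i = n") (auto simp: below_def a_minus_def r_neg)
  then have "r \<ominus> ?g \<in> below n" using rc gc by (simp add: below_def)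
  moreover have "r = (r \<ominus> ?g) \<oplus> ?g" using rc gc by (simp add: a_minus_def a_assoc l_neg)
  ultimately show thesis using that g by blast
qed

lemma below_mult_homogeneous:
  assumes g: "g \<in> G m"
  shows "u \<in> below n \<Longrightarrow> u \<otimes> g \<in> below (n + m)"
proof (induction n arbitrary: u)
  case 0 then show ?case using below_0[of u] below_zero G_carrier[OF g] by simp
next
  case (Suc n)
  then obtain v h where vh: "v \<in> below n" "h \<in> G n" "u = v \<oplus> h" by (rule_tac below_SucE)
  have "u \<otimes> g = v \<otimes> g \<oplus> h \<otimes> g" using vh below_carrier G_carrier g by (simp add: l_distr)
  moreover have "h \<otimes> g \<in> below (Suc n + m)" using mult_G[OF vh(2) g] by (rule homogeneous_below) simp
  ultimately show ?case using below_add below_mono[OF _ Suc.IH[OF vh(1)], of "Suc n + m"] by simp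
qed

lemma below_mult: "u \<in> below n \<Longrightarrow> v \<in> below m \<Longrightarrow> u \<otimes> v \<in> below (n + m)"
proof (induction m arbitrary: v)
  case 0 then show ?case using below_0[of v] below_zero below_carrier by simp
next
  case (Suc m)
  then obtain w h where wh: "w \<in> below m" "h \<in> G m" "v = w \<oplus> h" by (rule_tac below_SucE)
  have "u \<otimes> v = u \<otimes> w \<oplus> u \<otimes> h" using wh below_carrier G_carrier Suc.prems by (simp add: r_distr)
  then show ?case
    using below_add below_mono[OF _ Suc.IH[OF Suc.prems(1) wh(1)], of "n + Suc m"]
      below_mono[OF _ below_mult_homogeneous[OF wh(2) Suc.prems(1)], of "n + Suc m"] by simp
qed

text \<open>Only the component of highest degree is required to stay in the ideal. That is all the
  degree induction strips off, and it is easy to verify for ideals given by a colon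
  condition.\<close>

abbreviation top_closed :: "'a set \<Rightarrow> bool" where
  "top_closed I \<equiv> \<forall>n u g. u \<in> below n \<longrightarrow> g \<in> G n \<longrightarrow> u \<oplus> g \<in> I \<longrightarrow> g \<in> I"

text \<open>Compare the top degree parts \<open>g\<close> of \<open>s\<close> and \<open>h\<close> of \<open>a\<close>: either \<open>g \<in> P\<close> and \<open>g\<close> can be
  dropped from \<open>s\<close>, or \<open>g h \<in> T\<close> and \<open>h\<close> can be dropped from \<open>a\<close>.\<close>

lemma cancel_from_homogeneous:
  assumes P: "ideal P R" and M: "ideal M R" "top_closed M" and T: "ideal T R" "top_closed T"
    and PM: "\<And>p a. \<lbrakk>p \<in> P; a \<in> M\<rbrakk> \<Longrightarrow> p \<otimes> a \<in> T"
    and hom: "\<And>i j s a. \<lbrakk>s \<in> G i; s \<notin> P; a \<in> G j; a \<in> M; s \<otimes> a \<in> T\<rbrakk> \<Longrightarrow> a \<in> T"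
    and s: "s \<in> carrier R" "s \<notin> P" and a: "a \<in> M" "s \<otimes> a \<in> T"
  shows "a \<in> T"
proof -
  have "a \<in> T" if "s \<in> below e" "a \<in> below m" "s \<notin> P" "a \<in> M" "s \<otimes> a \<in> T" for s a e m
    using that
  proof (induction "e + m" arbitrary: e m s a rule: less_induct)
    case less
    note sc = below_carrier[OF less.prems(1)] and ac = below_carrier[OF less.prems(2)]
    show ?case
    proof (cases e)
      case 0
      then show ?thesis using less.prems below_0 ideal_zero_closed[OF P] by blast
    next
      case e: (Suc e')
      show ?thesis
      proof (cases m)
        case 0
        then show ?thesis using less.prems below_0 ideal_zero_closed[OF T(1)] by blast
      next
        case m: (Suc m')
        obtain s' g where s: "s' \<in> below e'" "g \<in> G e'" "s = s' \<oplus> g"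
          using less.prems(1) unfolding e by (rule below_SucE)
        obtain a' h where a: "a' \<in> below m'" "h \<in> G m'" "a = a' \<oplus> h"
          using less.prems(2) unfolding m by (rule below_SucE)
        note c = below_carrier[OF s(1)] G_carrier[OF s(2)] below_carrier[OF a(1)] G_carrier[OF a(2)]
        show ?thesis
        \<comment> \<open>\<open>g\<close> may be zero, since \<open>e\<close> is only an upper
          bound for the degree; zero lies in \<open>P\<close>, so this case merely lowers the
          bound.\<close>
        proof (cases "g \<in> P")
          case True
          have s': "s' \<notin> P" using True s less.prems(3) ideal_add_closed[OF P] by blast
          have "g \<otimes> a \<oplus> s' \<otimes> a = s \<otimes> a" using s c ac by (simp add: l_distr a_comm)
          then have "s' \<otimes> a \<in> T"
            using ideal_diff_mem[OF T(1) PM[OF True less.prems(4)], of "s' \<otimes> a"] less.prems(5) c ac by simp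
          then show ?thesis using less.hyps[of e' m s' a] e s(1) s' less.prems by simp
        next
          case False
          have hM: "h \<in> M" using M(2) a less.prems(4) by blast
          \<comment> \<open>The other three products have degree below \<open>e' + m'\<close>, so
            \<open>g \<otimes> h\<close> is the top part of \<open>s \<otimes> a\<close> and
            \<open>top_closed T\<close> puts it in \<open>T\<close>.\<close>
          have "s' \<otimes> a' \<oplus> s' \<otimes> h \<oplus> g \<otimes> a' \<in> below (e' + m')"
            using below_mult[OF s(1) a(1)] below_mult_homogeneous[OF a(2) s(1)]
              below_mult_homogeneous[OF s(2) a(1)] c
            by (intro below_add) (simp_all add: m_comm add.commute)
          moreover have "g \<otimes> h \<in> G (e' + m')" by (rule mult_G[OF s(2) a(2)])
          moreover have "(s' \<otimes> a' \<oplus> s' \<otimes> h \<oplus> g \<otimes> a') \<oplus> g \<otimes> h = s \<otimes> a"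
            using s a c by (simp add: l_distr r_distr a_ac)
          ultimately have "g \<otimes> h \<in> T" using T(2) less.prems(5) by metis
          then have hT: "h \<in> T" using hom s(2) False a(2) hM by blast
          have "h \<oplus> a' = a" using a c by (simp add: a_comm)
          then have a'M: "a' \<in> M" using ideal_diff_mem[OF M(1) hM, of a'] less.prems(4) c by simp
          have "s \<otimes> h \<oplus> s \<otimes> a' = s \<otimes> a" using a c sc by (simp add: r_distr a_comm)
          then have "s \<otimes> a' \<in> T"
            using ideal_diff_mem[OF T(1) ideal.I_l_closed[OF T(1) hT sc], of "s \<otimes> a'"] less.prems(5) c sc by simp
          then have "a' \<in> T" using less.hyps[of e m' s a'] m a(1) a'M less.prems by simp
          then show ?thesis using a hT ideal_add_closed[OF T(1)] by simp
        qed
      qed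
    qed
  qed
  moreover have "a \<in> carrier R" using ideal.Icarr[OF M(1) a(1)] .
  ultimately show ?thesis using below_exhaustive s a by metis
qed

end

section \<open>Graded ideals and the homogeneous annihilator\<close>

context standard_graded_algebra
begin

lemma homogeneous_sums_carrier: "u \<in> homogeneous_sums R G I \<Longrightarrow> u \<in> carrier R"
  by (induction rule: homogeneous_sums.induct) (auto simp: G_carrier)

lemma homogeneous_sums_mono: "I \<subseteq> J \<Longrightarrow> u \<in> homogeneous_sums R G I \<Longrightarrow> u \<in> homogeneous_sums R G J"
  by (rotate_tac, induction rule: homogeneous_sums.induct) (auto intro: homogeneous_sums.intros)

lemma homogeneous_sums_add:
  assumes "v \<in> homogeneous_sums R G I" "u \<in> homogeneous_sums R G I"
  shows "u \<oplus> v \<in> homogeneous_sums R G I"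
  using assms(1)
proof (induction rule: homogeneous_sums.induct)
  case zero then show ?case using assms(2) homogeneous_sums_carrier by simp
next
  case (add v g i)
  have "u \<oplus> (v \<oplus> g) = (u \<oplus> v) \<oplus> g"
    using add homogeneous_sums_carrier[OF assms(2)] homogeneous_sums_carrier G_carrier by (simp add: a_assoc)
  then show ?case using homogeneous_sums.add[OF add.IH add.hyps(2,3)] by simp
qed

lemma homogeneous_sums_homogeneous: "\<lbrakk>g \<in> I; g \<in> G i\<rbrakk> \<Longrightarrow> g \<in> homogeneous_sums R G I"
  using homogeneous_sums.add[OF homogeneous_sums.zero, of g I G i R] G_carrier[of g i] by simp

lemma carrier_homogeneous_sums: "r \<in> carrier R \<Longrightarrow> r \<in> homogeneous_sums R G (carrier R)"
proof -
  have "r \<in> homogeneous_sums R G (carrier R)" if "r \<in> below n" for n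
    using that
  proof (induction n arbitrary: r)
    case 0 then show ?case using below_0 homogeneous_sums.zero by blast
  next
    case (Suc n)
    obtain u g where "u \<in> below n" "g \<in> G n" "r = u \<oplus> g" using Suc.prems by (rule below_SucE)
    then show ?case using homogeneous_sums.add[OF Suc.IH G_carrier] by simp
  qed
  then show "r \<in> homogeneous_sums R G (carrier R)" if "r \<in> carrier R"
    using below_exhaustive[OF that] by blast
qed

lemma homogeneous_sums_mult:
  assumes u: "u \<in> homogeneous_sums R G I" and v: "v \<in> homogeneous_sums R G J"
    and IJ: "\<And>g h. \<lbrakk>g \<in> I; h \<in> J\<rbrakk> \<Longrightarrow> g \<otimes> h \<in> L"
  shows "u \<otimes> v \<in> homogeneous_sums R G L"
  using u
proof (induction rule: homogeneous_sums.induct)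
  case zero then show ?case using homogeneous_sums_carrier[OF v] homogeneous_sums.zero by simp
next
  case (add u g i)
  have "g \<otimes> v \<in> homogeneous_sums R G L"
    using v
  proof (induction rule: homogeneous_sums.induct)
    case zero then show ?case using G_carrier[OF add.hyps(3)] homogeneous_sums.zero by simp
  next
    case (add w h j)
    have "g \<otimes> (w \<oplus> h) = g \<otimes> w \<oplus> g \<otimes> h"
      using add.hyps(1,3) homogeneous_sums_carrier G_carrier \<open>g \<in> G i\<close> by (simp add: r_distr)
    then show ?case
      using homogeneous_sums.add[OF add.IH IJ[OF \<open>g \<in> I\<close> add.hyps(2)] mult_G[OF \<open>g \<in> G i\<close> add.hyps(3)]] by simp
  qed
  moreover have "(u \<oplus> g) \<otimes> v = u \<otimes> v \<oplus> g \<otimes> v"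
    using add.hyps(1,3) homogeneous_sums_carrier v G_carrier by (simp add: l_distr)
  ultimately show ?case using homogeneous_sums_add add.IH by simp
qed

text \<open>The sums of homogeneous elements of \<open>Idl H\<close> form an ideal, as ring elements
  are themselves such sums, and this ideal contains \<open>H\<close>.\<close>

lemma graded_ideal_genideal:
  assumes H: "\<forall>h\<in>H. homogeneous G h"
  shows "graded_ideal R G (Idl H)"
proof -
  have Hc: "H \<subseteq> carrier R" using H G_carrier by (auto simp: homogeneous_def)
  note id = genideal_ideal[OF Hc]
  let ?S = "homogeneous_sums R G (Idl H)"
  have "ideal ?S R"
    unfolding subideal_carrier_iff[symmetric] subideal_def
  proof (intro conjI ballI)
    show "?S \<subseteq> carrier R" using homogeneous_sums_carrier by blast
    show "\<zero> \<in> ?S" by (rule homogeneous_sums.zero)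
    fix u assume u: "u \<in> ?S"
    show "u \<oplus> v \<in> ?S" if "v \<in> ?S" for v using u that by (rule homogeneous_sums_add[rotated])
    show "r \<otimes> u \<in> ?S" if "r \<in> carrier R" for r
      using carrier_homogeneous_sums[OF that] u
      by (rule homogeneous_sums_mult) (rule ideal.I_l_closed[OF id])
  qed
  moreover have "H \<subseteq> ?S"
  proof
    fix h assume h: "h \<in> H"
    then obtain i where "h \<in> G i" using H by (auto simp: homogeneous_def)
    moreover have "h \<in> Idl H" using genideal_self[OF Hc] h by blast
    ultimately show "h \<in> ?S" by (rule homogeneous_sums_homogeneous[rotated])
  qed
  ultimately show ?thesis using id by (simp add: graded_ideal_def genideal_minimal)
qed

lemma graded_idealD: "graded_ideal R G I \<Longrightarrow> ideal I R"
  by (simp add: graded_ideal_def)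

lemma graded_ideal_carrier: "graded_ideal R G (carrier R)"
  unfolding graded_ideal_def using carrier_homogeneous_sums oneideal by blast

lemma graded_ideal_cgenideal:
  assumes "x \<in> G i"
  shows "graded_ideal R G (PIdl x)"
  unfolding cgenideal_eq_genideal[OF G_carrier[OF assms]]
  by (rule graded_ideal_genideal) (use assms in \<open>auto simp: homogeneous_def\<close>)

lemma graded_ideal_sum:
  assumes "graded_ideal R G I" "graded_ideal R G J"
  shows "graded_ideal R G (I <+>\<^bsub>R\<^esub> J)"
proof -
  note ids = graded_idealD[OF assms(1)] graded_idealD[OF assms(2)]
  have "a \<oplus> b \<in> homogeneous_sums R G (I <+>\<^bsub>R\<^esub> J)" if "a \<in> I" "b \<in> J" for a b
  proof (rule homogeneous_sums_add)
    have "a \<in> homogeneous_sums R G I" "b \<in> homogeneous_sums R G J"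
      using assms that unfolding graded_ideal_def by blast+
    then show "a \<in> homogeneous_sums R G (I <+>\<^bsub>R\<^esub> J)" "b \<in> homogeneous_sums R G (I <+>\<^bsub>R\<^esub> J)"
      using homogeneous_sums_mono[OF set_add_upper(1)[OF ids]]
        homogeneous_sums_mono[OF set_add_upper(2)[OF ids]] by blast+
  qed
  then have "I <+>\<^bsub>R\<^esub> J \<subseteq> homogeneous_sums R G (I <+>\<^bsub>R\<^esub> J)" by (blast elim: set_addE)
  then show ?thesis using add_ideals[OF ids] unfolding graded_ideal_def by blast
qed

lemma graded_ideal_prod:
  assumes "graded_ideal R G I" "graded_ideal R G J"
  shows "graded_ideal R G (I \<cdot>\<^bsub>R\<^esub> J)"
proof -
  note ids = graded_idealD[OF assms(1)] graded_idealD[OF assms(2)]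
  have "u \<in> homogeneous_sums R G (I \<cdot>\<^bsub>R\<^esub> J)" if "u \<in> I \<cdot>\<^bsub>R\<^esub> J" for u
    using that
  proof (induction rule: ideal_prod.induct)
    case (prod i j)
    show ?case
    proof (rule homogeneous_sums_mult)
      show "i \<in> homogeneous_sums R G I" "j \<in> homogeneous_sums R G J"
        using assms prod by (auto simp: graded_ideal_def)
    qed (rule ideal_prod.prod)
  next
    case (sum u v) then show ?case by (rule_tac homogeneous_sums_add)
  qed
  then show ?thesis using ideal_prod_is_ideal[OF ids] by (auto simp: graded_ideal_def)
qed

lemma graded_ideal_power:
  assumes "graded_ideal R G P"
  shows "graded_ideal R G (P [^]\<^bsub>ideals_set R\<^esub> (n::nat))"
  by (induction n) (simp_all add: ideals_set_one ideals_set_mult graded_ideal_carrier graded_ideal_prod assms)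

lemma component_mem:
  assumes I: "graded_ideal R G I" and r: "r \<in> I"
  shows "component R G r n \<in> I"
proof -
  from I r have "r \<in> homogeneous_sums R G I" by (auto simp: graded_ideal_def)
  then show ?thesis
  proof (induction rule: homogeneous_sums.induct)
    case zero then show ?case using ideal_zero_closed[OF graded_idealD[OF I]] by (simp add: component_zero)
  next
    case (add u g i)
    have "component R G (u \<oplus> g) n = component R G u n \<oplus> (if n = i then g else \<zero>)"
      using add.hyps homogeneous_sums_carrier G_carrier component_add component_homogeneous by simp
    then show ?case
      using add ideal_add_closed[OF graded_idealD[OF I]] ideal_zero_closed[OF graded_idealD[OF I]] by simp
  qed
qed

lemma graded_ideal_top_closed:
  assumes I: "graded_ideal R G I"
  shows "top_closed I"
proof (intro allI impI)
  fix n u g assume u: "u \<in> below n" and g: "g \<in> G n" and ug: "u \<oplus> g \<in> I"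
  have "component R G (u \<oplus> g) n = \<zero> \<oplus> g"
    using component_add[OF below_carrier[OF u] G_carrier[OF g], of n] u
    by (simp add: component_homogeneous[OF g] below_def)
  then show "g \<in> I" using component_mem[OF I ug, of n] G_carrier[OF g] by simp
qed

text \<open>Primality need only be tested on homogeneous elements: this is
  \<open>cancel_from_homogeneous\<close> with \<open>Q\<close> as both \<open>P\<close> and
  \<open>T\<close>, and the whole ring as \<open>M\<close>.\<close>

lemma graded_primeidealI:
  assumes Q: "graded_ideal R G Q" and proper: "\<one> \<notin> Q"
    and prime: "\<And>i j f g. \<lbrakk>f \<in> G i; g \<in> G j; f \<otimes> g \<in> Q\<rbrakk> \<Longrightarrow> f \<in> Q \<or> g \<in> Q"
  shows "primeideal Q R"
proof (rule primeidealI[OF graded_idealD[OF Q] is_cring])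
  show "carrier R \<noteq> Q" using proper by auto
  fix a b assume a: "a \<in> carrier R" and b: "b \<in> carrier R" and ab: "a \<otimes> b \<in> Q"
  note id = graded_idealD[OF Q]
  have "b \<in> Q" if "a \<notin> Q"
  proof (rule cancel_from_homogeneous[OF id oneideal _ id _ _ _ a that b ab])
    show "top_closed (carrier R)" using G_carrier by blast
    show "top_closed Q" by (rule graded_ideal_top_closed[OF Q])
    show "p \<otimes> a \<in> Q" if "p \<in> Q" "a \<in> carrier R" for p a using ideal.I_r_closed[OF id] that .
  qed (use prime in blast)
  then show "a \<in> Q \<or> b \<in> Q" by blast
qed

lemma noetherian: "noetherian_on R (carrier R)"
proof -
  obtain B where B: "finite B" "B \<subseteq> G 1" "generate_ring R (K \<union> B) = carrier R"
    using generated_in_degree_one by blast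
  have "subring K R" using subfield_K by (meson subcring.axioms(1) subdomain.axioms(1) subfield.axioms(1))
  moreover have "B \<subseteq> carrier R" using B(2) G_carrier by blast
  ultimately show ?thesis
    using noetherian_on_generate_ring[OF B(1) _ _ noetherian_on_subfield[OF subfield_K]] B(3) by simp
qed

text \<open>By \<open>symbolic_power_eq\<close> this says that \<open>c^n\<close> carries
  \<open>P^(n)\<close> into \<open>P^n\<close>. The exponent counts the passages from
  \<open>P^k\<close> to \<open>P^(k+1)\<close>, each of which uses up one factor
  \<open>c\<close>.\<close>

lemma homogeneous_annihilator:
  assumes P: "primeideal P R" "graded_ideal R G P"
  obtains c where "homogeneous G c" "c \<in> carrier R - P"
    "\<And>n s a. \<lbrakk>s \<in> carrier R - P; a \<in> carrier R; s \<otimes> a \<in> P [^]\<^bsub>ideals_set R\<^esub> (n::nat)\<rbrakk>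
       \<Longrightarrow> c [^] n \<otimes> a \<in> P [^]\<^bsub>ideals_set R\<^esub> n"
proof -
  interpret P: primeideal P R by (rule P(1))
  let ?P = "\<lambda>k::nat. P [^]\<^bsub>ideals_set R\<^esub> k"
  note Pid = ideal_power_ideal[OF P.is_ideal]
  \<comment> \<open>Restricting the multipliers to homogeneous elements makes the resulting
    \<open>c\<close> homogeneous; primality of \<open>P\<close> keeps products in
    \<open>U\<close>.\<close>
  define U where "U = {c \<in> carrier R - P. homogeneous G c}"
  have one: "\<one> \<in> U"
    using one_in_G0 P.one_imp_carrier P.I_notcarr by (auto simp: U_def homogeneous_def)
  have mult: "c \<otimes> d \<in> U" if "c \<in> U" "d \<in> U" for c d
  proof -
    from that obtain i j where "c \<in> G i" "d \<in> G j" by (auto simp: U_def homogeneous_def)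
    then have "homogeneous G (c \<otimes> d)" using mult_G unfolding homogeneous_def by blast
    then show ?thesis using that P.I_prime[of c d] unfolding U_def by blast
  qed
  have Uc: "U \<subseteq> carrier R" by (auto simp: U_def)
  obtain c where c: "c \<in> U" and ann: "\<And>d a k. \<lbrakk>d \<in> U; a \<in> ?P k; d \<otimes> a \<in> ?P (Suc k)\<rbrakk> \<Longrightarrow> c \<otimes> a \<in> ?P (Suc k)"
    by (rule uniform_annihilator[OF noetherian P.is_ideal one Uc mult]) blast+
  obtain e where e: "c \<in> G e" and cc: "c \<in> carrier R" using c by (auto simp: U_def homogeneous_def)
  \<comment> \<open>From homogeneous multipliers to arbitrary \<open>s \<notin> P\<close>:
    cancellation is applied inside \<open>P^k\<close>, with \<open>T\<close> the elements that
    \<open>c\<close> moves into \<open>P^(k+1)\<close>.\<close>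
  have step: "c \<otimes> a \<in> ?P (Suc k)" if s: "s \<in> carrier R" "s \<notin> P" and a: "a \<in> ?P k" and sa: "s \<otimes> a \<in> ?P (Suc k)" for s a k
  proof -
    define T where "T = {a \<in> ?P k. c \<otimes> a \<in> ?P (Suc k)}"
    have Tc: "a \<in> carrier R" if "a \<in> T" for a using that ideal.Icarr[OF Pid] unfolding T_def by blast
    have T: "ideal T R"
      unfolding subideal_carrier_iff[symmetric] subideal_def
    proof (intro conjI ballI)
      show "T \<subseteq> carrier R" using Tc by blast
      show "\<zero> \<in> T" using ideal_zero_closed[OF Pid] cc unfolding T_def by (simp del: Group.nat_pow_Suc)
      fix a assume a: "a \<in> T"
      { fix b assume b: "b \<in> T"
        have "c \<otimes> (a \<oplus> b) = c \<otimes> a \<oplus> c \<otimes> b" using Tc a b cc by (simp add: r_distr)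
        then show "a \<oplus> b \<in> T"
          using a b ideal_add_closed[OF Pid] unfolding T_def by (simp del: Group.nat_pow_Suc) }
      { fix r assume r: "r \<in> carrier R"
        have "c \<otimes> (r \<otimes> a) = r \<otimes> (c \<otimes> a)" using Tc a r cc by (simp add: m_lcomm)
        then show "r \<otimes> a \<in> T"
          using a r ideal.I_l_closed[OF Pid] unfolding T_def by (simp del: Group.nat_pow_Suc) }
    qed
    have T_top: "top_closed T"
    proof (intro allI impI)
      fix n u g assume u: "u \<in> below n" and g: "g \<in> G n" and ug: "u \<oplus> g \<in> T"
      note c' = below_carrier[OF u] G_carrier[OF g]
      have "g \<in> ?P k"
        using graded_ideal_top_closed[OF graded_ideal_power[OF P(2), of k]] u g ug unfolding T_def by blast
      moreover have "u \<otimes> c \<oplus> g \<otimes> c \<in> ?P (Suc k)"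
      proof -
        have "u \<otimes> c \<oplus> g \<otimes> c = c \<otimes> (u \<oplus> g)" using c' cc by (simp add: r_distr m_comm)
        then show ?thesis using ug unfolding T_def by (simp del: Group.nat_pow_Suc)
      qed
      then have "g \<otimes> c \<in> ?P (Suc k)"
        using graded_ideal_top_closed[OF graded_ideal_power[OF P(2), of "Suc k"]]
          below_mult_homogeneous[OF e u] mult_G[OF g e] by blast
      ultimately show "g \<in> T" using c' cc unfolding T_def by (simp add: m_comm del: Group.nat_pow_Suc)
    qed
    have "a \<in> T"
    proof (rule cancel_from_homogeneous[OF P.is_ideal Pid _ T T_top _ _ s a])
      show "top_closed (?P k)" by (rule graded_ideal_top_closed[OF graded_ideal_power[OF P(2)]])
      show "p \<otimes> a \<in> T" if p: "p \<in> P" and a: "a \<in> ?P k" for p a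
      proof -
        have "a \<otimes> p \<in> ?P (Suc k)" using ideal_power_add[OF P.is_ideal a, of p 1] p ideal_power_1[OF P.is_ideal] by simp
        moreover have "a \<otimes> p = p \<otimes> a" using ideal.Icarr[OF Pid a] P.Icarr[OF p] by (rule m_comm)
        ultimately have *: "p \<otimes> a \<in> ?P (Suc k)" by simp
        then have "p \<otimes> a \<in> ?P k" using ideal_power_antimono[OF P.is_ideal, of k "Suc k"] by auto
        then show ?thesis using ideal.I_l_closed[OF Pid * cc] unfolding T_def by blast
      qed
      \<comment> \<open>The hypothesis says that \<open>c \<otimes> s\<close> moves \<open>a\<close>
        into \<open>P^(k+1)\<close>. This product is again a member of \<open>U\<close>, so by the
        choice of \<open>c\<close> the factor \<open>c\<close> alone suffices.\<close>
      show "a \<in> T" if "s \<in> G i" "s \<notin> P" "a \<in> ?P k" "s \<otimes> a \<in> T" for i s a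
      proof -
        have s: "s \<in> U" using that G_carrier by (auto simp: U_def homogeneous_def)
        have "(c \<otimes> s) \<otimes> a \<in> ?P (Suc k)"
          using that(4) cc Uc s ideal.Icarr[OF Pid that(3)] unfolding T_def
          by (auto simp: m_assoc simp del: Group.nat_pow_Suc)
        then show ?thesis using ann[OF mult[OF c s] that(3)] that(3) unfolding T_def by blast
      qed
      show "s \<otimes> a \<in> T"
        using sa ideal.I_l_closed[OF Pid a s(1)] ideal.I_l_closed[OF Pid sa cc] unfolding T_def by blast
    qed
    then show ?thesis unfolding T_def by blast
  qed
  have "c [^] n \<otimes> a \<in> ?P n" if s: "s \<in> carrier R - P" and a: "a \<in> carrier R" and sa: "s \<otimes> a \<in> ?P n" for n s a
  proof -
    have "c [^] k \<otimes> a \<in> ?P k" if "k \<le> n" for k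
      using that
    proof (induction k)
      case 0 then show ?case using a by (simp add: ideals_set_one)
    next
      case (Suc k)
      \<comment> \<open>The same \<open>s\<close> works at every level: \<open>s\<close> still sends
        \<open>c^k a\<close> into \<open>P^n\<close>, hence into \<open>P^(k+1)\<close> as long as
        \<open>k < n\<close>.\<close>
      have "s \<otimes> (c [^] k \<otimes> a) = c [^] k \<otimes> (s \<otimes> a)" using s a cc by (simp add: m_lcomm)
      moreover have "c [^] k \<otimes> (s \<otimes> a) \<in> ?P n" by (rule ideal.I_l_closed[OF Pid sa]) (simp add: cc)
      ultimately have "s \<otimes> (c [^] k \<otimes> a) \<in> ?P (Suc k)"
        using ideal_power_antimono[OF P.is_ideal Suc.prems] by auto
      then have "c \<otimes> (c [^] k \<otimes> a) \<in> ?P (Suc k)" using step s Suc by auto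
      moreover have "c \<otimes> (c [^] k \<otimes> a) = c [^] Suc k \<otimes> a" using a cc by (simp add: m_ac)
      ultimately show ?case by simp
    qed
    then show ?thesis by simp
  qed
  moreover have "homogeneous G c" "c \<in> carrier R - P" using c by (auto simp: U_def)
  ultimately show thesis using that by blast
qed

end

section \<open>Finiteness of the lengths\<close>

context standard_graded_algebra
begin

text \<open>Keeps the unit out of \<open>Q + (b)\<close> below, since the degree zero part of such a
  sum comes from \<open>Q\<close> alone.\<close>

lemma component_0_mult_degree_one:
  assumes "r \<in> carrier R" "b \<in> G 1"
  shows "component R G (r \<otimes> b) 0 = \<zero>"
  using carrier_homogeneous_sums[OF assms(1)]
proof (induction rule: homogeneous_sums.induct)
  case zero then show ?case using G_carrier[OF assms(2)] by (simp add: component_zero)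
next
  case (add u g i)
  note c = homogeneous_sums_carrier[OF add.hyps(1)] add.hyps(2) G_carrier[OF assms(2)]
  have "(u \<oplus> g) \<otimes> b = u \<otimes> b \<oplus> g \<otimes> b" using c by (simp add: l_distr)
  moreover have "component R G (g \<otimes> b) 0 = \<zero>"
    using component_homogeneous[OF mult_G[OF add.hyps(3) assms(2)]] by simp
  ultimately show ?case using add.IH c by (simp add: component_add)
qed

lemma exists_maximal_ideal:
  assumes I: "ideal I R" and proper: "\<one> \<notin> I"
  obtains M where "maximalideal M R" "I \<subseteq> M"
proof -
  let ?C = "{M. ideal M R \<and> I \<subseteq> M \<and> \<one> \<notin> M}"
  have ne: "I \<in> ?C" using I proper by simp
  have C: "subideal R (carrier R) J" if "J \<in> ?C" for J using that by (simp add: subideal_carrier_iff)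
  obtain M where M: "M \<in> ?C" "\<And>J. J \<in> ?C \<Longrightarrow> M \<subseteq> J \<Longrightarrow> J = M"
    by (rule noetherian_on_maximal[OF noetherian ne C]) auto
  have "maximalideal M R"
  proof (rule maximalidealI)
    show "ideal M R" using M(1) by simp
    show "carrier R \<noteq> M" using M(1) by auto
    fix J assume J: "ideal J R" "M \<subseteq> J" "J \<subseteq> carrier R"
    show "J = M \<or> J = carrier R"
    proof (cases "\<one> \<in> J")
      case True then show ?thesis using ideal.one_imp_carrier[OF J(1)] by blast
    next
      case False then show ?thesis using M(2)[of J] J M(1) by blast
    qed
  qed
  then show thesis using that M(1) by blast
qed

text \<open>A graded ideal maximal among those avoiding the powers of \<open>b\<close> is prime and is not maximal
  as an ideal, so that \<open>dim R/P = 1\<close> leaves no room for it above \<open>P\<close>.\<close>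

lemma degree_one_nilpotent:
  assumes P: "primeideal P R" "graded_ideal R G P" and dim: "krull_dim (R Quot P) = 1"
    and c: "c \<in> G e" "c \<notin> P" and b: "b \<in> G 1"
  shows "\<exists>N::nat. b [^] N \<in> P [^]\<^bsub>ideals_set R\<^esub> (n::nat) <+>\<^bsub>R\<^esub> PIdl (c [^] (m::nat))"
proof (rule ccontr)
  let ?J = "P [^]\<^bsub>ideals_set R\<^esub> n <+>\<^bsub>R\<^esub> PIdl (c [^] m)"
  assume no: "\<not> (\<exists>N::nat. b [^] N \<in> ?J)"
  interpret P: primeideal P R by (rule P(1))
  have cc: "c \<in> carrier R" and bc: "b \<in> carrier R" using c b G_carrier by auto
  have cm: "c [^] m \<in> G (m * e)"
  proof (induction m)
    case 0 then show ?case using one_in_G0 by simp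
  next
    case (Suc m) then show ?case using mult_G[OF Suc c(1)] by (simp add: add.commute)
  qed
  have J: "graded_ideal R G ?J"
    by (intro graded_ideal_sum graded_ideal_power P(2) graded_ideal_cgenideal[OF cm])
  define C where "C = {Q. graded_ideal R G Q \<and> ?J \<subseteq> Q \<and> (\<forall>N::nat. b [^] N \<notin> Q)}"
  have ne: "?J \<in> C" using J no unfolding C_def by blast
  have Cid: "subideal R (carrier R) Q" if "Q \<in> C" for Q
    using that graded_idealD unfolding subideal_carrier_iff C_def by blast
  obtain Q where QC: "Q \<in> C" and Qmax: "\<And>Q'. Q' \<in> C \<Longrightarrow> Q \<subseteq> Q' \<Longrightarrow> Q' = Q"
    by (rule noetherian_on_maximal[OF noetherian ne Cid]) auto
  have Q: "graded_ideal R G Q" "?J \<subseteq> Q" "\<And>N::nat. b [^] N \<notin> Q" using QC unfolding C_def by blast+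
  note Qid = graded_idealD[OF Q(1)]
  have proper: "\<one> \<notin> Q" using Q(3)[of 0] by simp
  \<comment> \<open>By maximality, enlarging \<open>Q\<close> by a homogeneous element lets in a
    power of \<open>b\<close>. Two such powers multiply to a power in \<open>Q\<close> as soon as
    \<open>f \<otimes> g \<in> Q\<close>, which gives primality.\<close>
  have hits: "\<exists>N::nat. b [^] N \<in> Q <+>\<^bsub>R\<^esub> PIdl f" if f: "f \<in> G i" "f \<notin> Q" for f i
  proof (rule ccontr)
    assume no: "\<not> ?thesis"
    have up: "Q \<subseteq> Q <+>\<^bsub>R\<^esub> PIdl f" "PIdl f \<subseteq> Q <+>\<^bsub>R\<^esub> PIdl f"
      using set_add_upper[OF Qid cgenideal_ideal[OF G_carrier[OF f(1)]]] by auto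
    have "Q <+>\<^bsub>R\<^esub> PIdl f \<in> C"
      using graded_ideal_sum[OF Q(1) graded_ideal_cgenideal[OF f(1)]] up Q(2) no unfolding C_def by blast
    then have "Q <+>\<^bsub>R\<^esub> PIdl f = Q" using Qmax up(1) by blast
    then show False using up(2) cgenideal_self[OF G_carrier[OF f(1)]] f(2) by blast
  qed
  have Qprime: "primeideal Q R"
  proof (rule graded_primeidealI[OF Q(1) proper], rule ccontr)
    fix i j f g assume f: "f \<in> G i" and g: "g \<in> G j" and fg: "f \<otimes> g \<in> Q" and "\<not> (f \<in> Q \<or> g \<in> Q)"
    then have nf: "f \<notin> Q" and ng: "g \<notin> Q" by auto
    obtain N :: nat where N: "b [^] N \<in> Q <+>\<^bsub>R\<^esub> PIdl f" using hits[OF f nf] by blast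
    obtain M :: nat where M: "b [^] M \<in> Q <+>\<^bsub>R\<^esub> PIdl g" using hits[OF g ng] by blast
    obtain u r where u: "u \<in> Q" "r \<in> carrier R" "b [^] N = u \<oplus> r \<otimes> f"
      using N by (auto simp: cgenideal_def elim!: set_addE)
    obtain v s where v: "v \<in> Q" "s \<in> carrier R" "b [^] M = v \<oplus> s \<otimes> g"
      using M by (auto simp: cgenideal_def elim!: set_addE)
    note cs = ideal.Icarr[OF Qid u(1)] ideal.Icarr[OF Qid v(1)] G_carrier[OF f] G_carrier[OF g] u(2) v(2)
    have "b [^] (N + M) = b [^] N \<otimes> b [^] M" using bc by (simp add: nat_pow_mult)
    also have "\<dots> = u \<otimes> (v \<oplus> s \<otimes> g) \<oplus> ((r \<otimes> f) \<otimes> v \<oplus> (r \<otimes> s) \<otimes> (f \<otimes> g))"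
      unfolding u(3) v(3) using cs by (simp add: l_distr r_distr m_ac a_ac)
    also have "\<dots> \<in> Q"
      using cs ideal.I_r_closed[OF Qid u(1)] ideal.I_l_closed[OF Qid v(1)] ideal.I_l_closed[OF Qid fg]
      by (intro ideal_add_closed[OF Qid]) auto
    finally show False using Q(3) by blast
  qed
  interpret Q: primeideal Q R by (rule Qprime)
  note up = set_add_upper[OF ideal_power_ideal[OF P.is_ideal] cgenideal_ideal[OF G_carrier[OF cm]], of n]
  have "P \<subseteq> Q"
  proof
    fix a assume a: "a \<in> P"
    have "a [^] n \<in> Q" using element_power_in_ideal_power[OF P.is_ideal a, of n] up(1) Q(2) by blast
    then show "a \<in> Q" by (rule Q.power_mem[OF P.Icarr[OF a]])
  qed
  moreover have "c \<in> Q"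
  proof -
    have "c [^] m \<in> Q" using cgenideal_self[OF G_carrier[OF cm]] up(2) Q(2) by blast
    then show ?thesis by (rule Q.power_mem[OF cc])
  qed
  \<comment> \<open>The element \<open>c\<close> lies in \<open>Q\<close> but not in
    \<open>P\<close>, which makes the inclusion strict.\<close>
  ultimately have PQ: "P \<subset> Q" using c(2) by blast
  have bi: "ideal (PIdl b) R" by (rule cgenideal_ideal[OF bc])
  have "\<one> \<notin> Q <+>\<^bsub>R\<^esub> PIdl b"
  proof
    assume "\<one> \<in> Q <+>\<^bsub>R\<^esub> PIdl b"
    then obtain u r where u: "u \<in> Q" "r \<in> carrier R" "\<one> = u \<oplus> r \<otimes> b"
      by (auto simp: cgenideal_def elim!: set_addE)
    \<comment> \<open>Comparing components of degree zero shows that \<open>\<one>\<close> is the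
      degree zero component of \<open>u\<close>, which lies in the graded ideal
      \<open>Q\<close>.\<close>
    have uc: "u \<in> carrier R" using ideal.Icarr[OF Qid u(1)] .
    have "component R G (u \<oplus> r \<otimes> b) 0 = component R G u 0 \<oplus> component R G (r \<otimes> b) 0"
      using uc u(2) bc by (intro component_add) auto
    then have "component R G \<one> 0 = component R G u 0 \<oplus> \<zero>"
      using u(3) component_0_mult_degree_one[OF u(2) b] by simp
    then have "\<one> = component R G u 0"
      using component_homogeneous[OF one_in_G0] G_carrier[OF component_props(1)[OF uc]] by simp
    then show False using component_mem[OF Q(1) u(1)] proper by metis
  qed
  then obtain M where M: "maximalideal M R" "Q <+>\<^bsub>R\<^esub> PIdl b \<subseteq> M"
    using exists_maximal_ideal[OF add_ideals[OF Qid bi]] by blast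
  have "Q \<subseteq> M" "b \<in> M"
    using set_add_upper[OF Qid bi] cgenideal_self[OF bc] M(2) by blast+
  moreover have "b \<notin> Q" using Q(3)[of 1] bc by simp
  ultimately have "Q \<subset> M" by blast
  then show False using krull_dim_quotient_one[OF dim P(1) Qprime maximalideal_prime[OF M(1)] PQ] by blast
qed

text \<open>The generators are treated one at a time: \<open>v\<close> is multiplied by the last
  power of \<open>b\<close> that keeps it outside \<open>J\<close>. By commutativity, what earlier
  generators killed stays killed.\<close>

lemma socle_element:
  assumes J: "ideal J R" and v: "\<one> \<notin> J" and B: "finite B" "B \<subseteq> carrier R"
    and nil: "\<And>b. b \<in> B \<Longrightarrow> \<exists>N::nat. b [^] N \<in> J"
  obtains v where "v \<in> carrier R" "v \<notin> J" "\<And>b. b \<in> B \<Longrightarrow> b \<otimes> v \<in> J"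
proof -
  have "\<exists>v\<in>carrier R - J. \<forall>b\<in>B. b \<otimes> v \<in> J"
    using B nil
  proof (induction B rule: finite_induct)
    case empty then show ?case using v by blast
  next
    case (insert b B)
    then obtain v where v: "v \<in> carrier R" "v \<notin> J" "\<And>b. b \<in> B \<Longrightarrow> b \<otimes> v \<in> J" by auto
    have bc: "b \<in> carrier R" using insert.prems by simp
    obtain N :: nat where N: "b [^] N \<in> J" using insert.prems by blast
    have ex: "b [^] N \<otimes> v \<in> J" using ideal.I_r_closed[OF J N v(1)] .
    define k where "k = (LEAST k::nat. b [^] k \<otimes> v \<in> J)"
    have k: "b [^] k \<otimes> v \<in> J" unfolding k_def using ex by (rule LeastI)
    have "k \<noteq> 0" using k v by (intro notI) simp
    then obtain l where l: "k = Suc l" using not0_implies_Suc by blast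
    have nl: "b [^] l \<otimes> v \<notin> J" using not_less_Least[of l "\<lambda>k. b [^] k \<otimes> v \<in> J"] l unfolding k_def by simp
    have "b \<otimes> (b [^] l \<otimes> v) \<in> J" using k bc v(1) unfolding l by (simp add: m_ac)
    moreover have "d \<otimes> (b [^] l \<otimes> v) \<in> J" if "d \<in> B" for d
    proof -
      have "d \<in> carrier R" using that insert.prems by blast
      then have "d \<otimes> (b [^] l \<otimes> v) = b [^] l \<otimes> (d \<otimes> v)" using bc v(1) by (simp add: m_lcomm)
      then show ?thesis using ideal.I_l_closed[OF J v(3)[OF that]] bc by simp
    qed
    ultimately show ?case using nl bc v(1) by (intro bexI[of _ "b [^] l \<otimes> v"]) auto
  qed
  then show thesis using that by blast
qed

text \<open>Modulo \<open>J\<close> the generators in \<open>B\<close> annihilate \<open>v\<close>,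
  so \<open>R\<close> acts on \<open>v\<close> through the field \<open>K\<close>. The interval is
  thus at most one-dimensional over \<open>K\<close>.\<close>

lemma ideal_length_socle_step:
  assumes J: "ideal J R" and v: "v \<in> carrier R" "v \<notin> J"
    and B: "B \<subseteq> carrier R" "generate_ring R (K \<union> B) = carrier R" "\<And>b. b \<in> B \<Longrightarrow> b \<otimes> v \<in> J"
  shows "ideal_length R J (J <+>\<^bsub>R\<^esub> PIdl v) \<le> 1"
proof (rule ideal_length_le)
  have K: "subring K R" using subfield_K by (meson subcring.axioms(1) subdomain.axioms(1) subfield.axioms(1))
  have Kc: "k \<in> carrier R" if "k \<in> K" for k using that subringE(1)[OF K] by blast
  have KB: "K \<union> B \<subseteq> carrier R" using Kc B(1) by blast
  have scalar: "\<exists>k\<in>K. \<exists>j\<in>J. r \<otimes> v = j \<oplus> k \<otimes> v" if "r \<in> generate_ring R (K \<union> B)" for r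
    using that
  proof (induction rule: generate_ring.induct)
    case one
    show ?case
      using subringE(3)[OF K] ideal_zero_closed[OF J] v by (intro bexI[of _ \<one>] bexI[of _ \<zero>]) auto
  next
    case (incl h)
    show ?case
    proof (cases "h \<in> K")
      case True
      then show ?thesis
        using ideal_zero_closed[OF J] v Kc by (intro bexI[of _ h] bexI[of _ \<zero>]) auto
    next
      case False
      then have "h \<otimes> v \<in> J" using incl B(3) by blast
      then show ?thesis
        using subringE(2)[OF K] v ideal.Icarr[OF J] by (intro bexI[of _ \<zero>] bexI[of _ "h \<otimes> v"]) auto
    qed
  next
    case (a_inv h)
    then obtain k j where kj: "k \<in> K" "j \<in> J" "h \<otimes> v = j \<oplus> k \<otimes> v" by blast
    have hc: "h \<in> carrier R" using generate_ring_in_carrier[OF KB a_inv.hyps] .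
    have "\<ominus> h \<otimes> v = \<ominus> (h \<otimes> v)" using hc v by (simp add: l_minus)
    also have "\<dots> = \<ominus> j \<oplus> \<ominus> k \<otimes> v"
      unfolding kj(3) using Kc[OF kj(1)] ideal.Icarr[OF J kj(2)] v by (simp add: minus_add l_minus)
    finally show ?case using subringE(5)[OF K kj(1)] ideal_neg_closed[OF J kj(2)] by blast
  next
    case (eng_add h1 h2)
    then obtain k j k' j' where kj: "k \<in> K" "j \<in> J" "h1 \<otimes> v = j \<oplus> k \<otimes> v"
      "k' \<in> K" "j' \<in> J" "h2 \<otimes> v = j' \<oplus> k' \<otimes> v" by blast
    have hc: "h1 \<in> carrier R" "h2 \<in> carrier R" using generate_ring_in_carrier[OF KB] eng_add.hyps by blast+
    have "(h1 \<oplus> h2) \<otimes> v = h1 \<otimes> v \<oplus> h2 \<otimes> v" using hc v by (simp add: l_distr)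
    also have "\<dots> = (j \<oplus> j') \<oplus> (k \<oplus> k') \<otimes> v"
      unfolding kj(3,6) using Kc[OF kj(1)] Kc[OF kj(4)] ideal.Icarr[OF J kj(2)] ideal.Icarr[OF J kj(5)] v
      by (simp add: l_distr a_ac)
    finally show ?case using subringE(7)[OF K kj(1,4)] ideal_add_closed[OF J kj(2,5)] by blast
  next
    case (eng_mult h1 h2)
    then obtain k j k' j' where kj: "k \<in> K" "j \<in> J" "h1 \<otimes> v = j \<oplus> k \<otimes> v"
      "k' \<in> K" "j' \<in> J" "h2 \<otimes> v = j' \<oplus> k' \<otimes> v" by blast
    have hc: "h1 \<in> carrier R" "h2 \<in> carrier R" using generate_ring_in_carrier[OF KB] eng_mult.hyps by blast+
    note cs = hc Kc[OF kj(1)] Kc[OF kj(4)] ideal.Icarr[OF J kj(2)] ideal.Icarr[OF J kj(5)] v(1)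
    have "(h1 \<otimes> h2) \<otimes> v = h1 \<otimes> (h2 \<otimes> v)" using cs by (simp add: m_assoc)
    also have "\<dots> = h1 \<otimes> j' \<oplus> k' \<otimes> (h1 \<otimes> v)" unfolding kj(6) using cs by (simp add: r_distr m_lcomm)
    also have "\<dots> = (h1 \<otimes> j' \<oplus> k' \<otimes> j) \<oplus> (k' \<otimes> k) \<otimes> v"
      unfolding kj(3) using cs by (simp add: r_distr m_assoc a_assoc)
    finally show ?case
      using subringE(6)[OF K kj(4,1)] ideal_add_closed[OF J ideal.I_l_closed[OF J kj(5) hc(1)]
        ideal.I_l_closed[OF J kj(2) cs(4)]] by blast
  qed
  fix n N assume N: "ideal_chain R J (J <+>\<^bsub>R\<^esub> PIdl v) n N"
  show "enat n \<le> 1"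
  proof (rule ccontr)
    assume "\<not> enat n \<le> 1"
    then have n: "2 \<le> n" by (simp add: one_enat_def)
    have N0: "J \<subseteq> N 0" and N01: "N 0 \<subset> N 1" and N12: "N 1 \<subset> N 2"
      and N2: "N 2 \<subseteq> J <+>\<^bsub>R\<^esub> PIdl v" and id: "ideal (N 1) R"
      using N n unfolding ideal_chain_def by (auto simp: numeral_2_eq_2 simp del: psubset_eq)
    \<comment> \<open>A chain of length two has a proper middle term; an element of it outside
      \<open>N 0\<close> is, modulo \<open>J\<close>, a nonzero scalar multiple of \<open>v\<close>.
      Inverting the scalar puts \<open>v\<close>, and so everything, into that term.\<close>
    obtain z where z: "z \<in> N 1" "z \<notin> N 0" using N01 by blast
    then have zJ: "z \<notin> J" using N0 by blast
    have "z \<in> J <+>\<^bsub>R\<^esub> PIdl v" using z N12 N2 by blast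
    then obtain i r where i: "i \<in> J" "r \<in> carrier R" "z = i \<oplus> r \<otimes> v"
      by (auto simp: cgenideal_def elim!: set_addE)
    obtain k j where kj: "k \<in> K" "j \<in> J" "r \<otimes> v = j \<oplus> k \<otimes> v" using scalar[of r] i(2) B(2) by blast
    note cs = ideal.Icarr[OF J i(1)] ideal.Icarr[OF J kj(2)] Kc[OF kj(1)] v(1)
    have z_eq: "z = (i \<oplus> j) \<oplus> k \<otimes> v" using i(3) kj(3) cs by (simp add: a_assoc)
    have ij: "i \<oplus> j \<in> J" using ideal_add_closed[OF J i(1) kj(2)] .
    have JN: "J \<subseteq> N 1" using N0 N01 by blast
    have "k \<otimes> v \<in> N 1" using ideal_diff_mem[OF id, of "i \<oplus> j" "k \<otimes> v"] ij JN z(1) z_eq cs by auto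
    moreover have "k \<noteq> \<zero>" using zJ z_eq ij ideal.Icarr[OF J ij] v(1) by (intro notI) simp
    ultimately have "inv k \<otimes> (k \<otimes> v) \<in> N 1" and inv: "inv k \<otimes> k = \<one>" "inv k \<in> carrier R"
      using subfield_m_inv[OF subfield_K, of k] kj(1) Kc ideal.I_l_closed[OF id] by auto
    moreover have "inv k \<otimes> (k \<otimes> v) = v" using inv cs by (simp add: m_assoc[symmetric])
    ultimately have "v \<in> N 1" by simp
    then have "PIdl v \<subseteq> N 1" by (rule cgenideal_minimal[OF id])
    then have "J <+>\<^bsub>R\<^esub> PIdl v \<subseteq> N 1" using JN by (intro set_add_least[OF id])
    then show False using N12 N2 by blast
  qed
qed

text \<open>Noetherian induction: an ideal maximal among those above \<open>J\<close> of infinite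
  colength is proper. A socle element enlarges it by length at most one to an ideal of finite
  colength, contradicting additivity.\<close>

lemma ideal_length_finite:
  assumes J: "ideal J R" and nil: "\<And>b. b \<in> G 1 \<Longrightarrow> \<exists>N::nat. b [^] N \<in> J"
  shows "ideal_length R J (carrier R) \<noteq> \<infinity>"
proof
  assume inf: "ideal_length R J (carrier R) = \<infinity>"
  obtain B where B: "finite B" "B \<subseteq> G 1" "generate_ring R (K \<union> B) = carrier R"
    using generated_in_degree_one by blast
  have Bc: "B \<subseteq> carrier R" using B(2) G_carrier by blast
  define C where "C = {I. ideal I R \<and> J \<subseteq> I \<and> ideal_length R I (carrier R) = \<infinity>}"
  have ne: "J \<in> C" using J inf unfolding C_def by blast
  have Cid: "subideal R (carrier R) I" if "I \<in> C" for I
    using that unfolding subideal_carrier_iff C_def by blast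
  obtain I where IC: "I \<in> C" and Imax: "\<And>I'. I' \<in> C \<Longrightarrow> I \<subseteq> I' \<Longrightarrow> I' = I"
    by (rule noetherian_on_maximal[OF noetherian ne Cid]) auto
  have I: "ideal I R" "J \<subseteq> I" "ideal_length R I (carrier R) = \<infinity>" using IC unfolding C_def by blast+
  have "\<one> \<notin> I"
  proof
    assume "\<one> \<in> I"
    then have "I = carrier R" by (rule ideal.one_imp_carrier[OF I(1)])
    moreover have "ideal_length R (carrier R) (carrier R) \<le> 0"
    proof (rule ideal_length_le)
      fix n N assume N: "ideal_chain R (carrier R) (carrier R) n N"
      show "enat n \<le> 0"
      proof (rule ccontr)
        assume "\<not> enat n \<le> 0"
        then have "0 < n" by (simp add: zero_enat_def)
        then have "N 0 \<subset> N 1" "carrier R \<subseteq> N 0" "N 1 \<subseteq> carrier R"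
          using N unfolding ideal_chain_def by (auto simp del: psubset_eq)
        then show False by blast
      qed
    qed
    ultimately show False using I(3) by simp
  qed
  moreover have "\<exists>N::nat. b [^] N \<in> I" if "b \<in> B" for b using nil that B(2) I(2) by blast
  ultimately obtain v where v: "v \<in> carrier R" "v \<notin> I" "\<And>b. b \<in> B \<Longrightarrow> b \<otimes> v \<in> I"
    using socle_element[OF I(1) _ B(1) Bc] by blast
  let ?I = "I <+>\<^bsub>R\<^esub> PIdl v"
  have vi: "ideal (PIdl v) R" by (rule cgenideal_ideal[OF v(1)])
  have I': "ideal ?I R" by (rule add_ideals[OF I(1) vi])
  note up = set_add_upper[OF I(1) vi]
  have "v \<in> ?I" using up(2) cgenideal_self[OF v(1)] by blast
  then have "?I \<notin> C" using Imax[of ?I] up(1) v(2) by blast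
  then have "ideal_length R ?I (carrier R) \<noteq> \<infinity>"
    using I' subset_trans[OF I(2) up(1)] by (simp add: C_def)
  moreover have "ideal_length R I ?I \<noteq> \<infinity>"
    using ideal_length_socle_step[OF I(1) v(1,2) Bc B(3) v(3)]
    by (cases "ideal_length R I ?I") (auto simp: one_enat_def)
  moreover have "?I \<subseteq> carrier R" using ideal.Icarr[OF I'] by blast
  ultimately show False
    using ideal_length_add[OF I(1) I' oneideal up(1)] I(3) by auto
qed

end

section \<open>Assembly of the length formula\<close>

theorem corollary10p2:
  fixes R :: "('a, 'c) ring_scheme" (structure)
    and K :: "'a set" and G :: "nat \<Rightarrow> 'a set" and P :: "'a set"
  assumes "standard_graded_algebra K R G"
    and "primeideal P R" and "homogeneous_ideal R G P"
    and "krull_dim (R Quot P) = 1"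
  shows "\<exists>x. homogeneous G x \<and> (\<forall>n\<ge>1.
    (let I = P [^]\<^bsub>ideals_set R\<^esub> n;
         lsym = module_length R
           (quotient_module ((regular_module R)\<lparr>carrier := symbolic_power R P n\<rparr>) I);
         len = (\<lambda>m. module_length R
           (quotient_module (regular_module R) (I <+>\<^bsub>R\<^esub> PIdl\<^bsub>R\<^esub> (x [^]\<^bsub>R\<^esub> m))))
     in lsym \<noteq> \<infinity> \<and> len n \<noteq> \<infinity> \<and> len (2 * n) \<noteq> \<infinity> \<and>
        int (the_enat lsym) = 2 * int (the_enat (len n)) - int (the_enat (len (2 * n)))))"
proof -
  interpret standard_graded_algebra K R G by (rule assms(1))
  interpret P: primeideal P R by (rule assms(2))
  have gP: "graded_ideal R G P"
    using assms(3) graded_ideal_genideal unfolding homogeneous_ideal_def by blast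
  obtain c where c: "homogeneous G c" "c \<in> carrier R - P"
    and ann: "\<And>n s a. \<lbrakk>s \<in> carrier R - P; a \<in> carrier R; s \<otimes> a \<in> P [^]\<^bsub>ideals_set R\<^esub> (n::nat)\<rbrakk>
       \<Longrightarrow> c [^] n \<otimes> a \<in> P [^]\<^bsub>ideals_set R\<^esub> n"
    by (rule homogeneous_annihilator[OF assms(2) gP]) blast
  obtain e where e: "c \<in> G e" using c(1) unfolding homogeneous_def by blast
  have cc: "c \<in> carrier R" using c(2) by blast
  show ?thesis
  proof (intro exI[of _ c] conjI allI impI)
    show "homogeneous G c" by (rule c(1))
    fix n :: nat
    define I where "I = P [^]\<^bsub>ideals_set R\<^esub> n"
    define H where "H = symbolic_power R P n"
    define L where "L = (\<lambda>m::nat. ideal_length R (I <+>\<^bsub>R\<^esub> PIdl (c [^] m)) (carrier R))"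
    have I: "ideal I R" unfolding I_def by (rule ideal_power_ideal[OF P.is_ideal])
    have H_iff: "a \<in> H \<longleftrightarrow> a \<in> carrier R \<and> (\<exists>s\<in>carrier R - P. s \<otimes> a \<in> I)" for a
      unfolding H_def symbolic_power_eq[OF assms(2) I[unfolded I_def]] I_def by blast
    have prime: "s \<otimes> t \<in> carrier R - P" if "s \<in> carrier R - P" "t \<in> carrier R - P" for s t
      using that P.I_prime[of s t] by auto
    have one: "\<one> \<in> carrier R - P" using P.one_imp_carrier P.I_notcarr by auto
    have H: "ideal H R"
      unfolding subideal_carrier_iff[symmetric] subideal_def
    proof (intro conjI ballI)
      show "H \<subseteq> carrier R" using H_iff by blast
      show "\<zero> \<in> H" using one ideal_zero_closed[OF I] unfolding H_iff by (intro conjI bexI[of _ \<one>]) auto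
      fix a assume "a \<in> H"
      then obtain s where s: "s \<in> carrier R - P" "s \<otimes> a \<in> I" and a: "a \<in> carrier R" using H_iff by blast
      { fix b assume "b \<in> H"
        then obtain t where t: "t \<in> carrier R - P" "t \<otimes> b \<in> I" and b: "b \<in> carrier R" using H_iff by blast
        have "(s \<otimes> t) \<otimes> (a \<oplus> b) = t \<otimes> (s \<otimes> a) \<oplus> s \<otimes> (t \<otimes> b)"
          using s(1) t(1) a b by (simp add: r_distr m_ac)
        also have "\<dots> \<in> I"
          using s(1) t(1)
          by (intro ideal_add_closed[OF I] ideal.I_l_closed[OF I s(2)] ideal.I_l_closed[OF I t(2)]) auto
        finally show "a \<oplus> b \<in> H" using prime[OF s(1) t(1)] a b unfolding H_iff by blast }
      { fix r assume r: "r \<in> carrier R"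
        have "s \<otimes> (r \<otimes> a) = r \<otimes> (s \<otimes> a)" using s(1) a r by (simp add: m_lcomm)
        then have "s \<otimes> (r \<otimes> a) \<in> I" using ideal.I_l_closed[OF I s(2) r] by simp
        then show "r \<otimes> a \<in> H" using s(1) a r unfolding H_iff by blast }
    qed
    have IH: "I \<subseteq> H"
    proof
      fix a assume a: "a \<in> I"
      then have "a \<in> carrier R" "\<one> \<otimes> a \<in> I" using ideal.Icarr[OF I a] by auto
      then show "a \<in> H" using one unfolding H_iff by blast
    qed
    \<comment> \<open>Being outside \<open>P\<close>, the power \<open>c^n\<close> can be absorbed
      into the denominators of \<open>H\<close>, so it is a nonzerodivisor modulo \<open>H\<close>.
      It plays the role of \<open>y\<close>, and \<open>y \<otimes> y\<close> is the source of the
      exponent \<open>2 * n\<close>.\<close>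
    have cn: "c [^] n \<in> carrier R - P" using cc c(2) P.power_mem[OF cc] by auto
    have "ideal_length R (I <+>\<^bsub>R\<^esub> PIdl (c [^] n \<otimes> c [^] n)) (carrier R) + ideal_length R I H
        = 2 * ideal_length R (I <+>\<^bsub>R\<^esub> PIdl (c [^] n)) (carrier R)"
    proof (rule ideal_length_annihilator[OF I H _ _ _ IH])
      show "c [^] n \<in> carrier R" using cc by simp
      show "c [^] n \<otimes> a \<in> I" if "a \<in> H" for a using that ann unfolding H_iff I_def by blast
      show "a \<in> H" if a: "a \<in> carrier R" and ca: "c [^] n \<otimes> a \<in> H" for a
      proof -
        obtain s where s: "s \<in> carrier R - P" "s \<otimes> (c [^] n \<otimes> a) \<in> I"
          using ca unfolding H_iff by blast
        have "(s \<otimes> c [^] n) \<otimes> a \<in> I" using s a cc by (simp add: m_assoc)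
        then show ?thesis using prime[OF s(1) cn] a unfolding H_iff by blast
      qed
    qed
    moreover have "c [^] n \<otimes> c [^] n = c [^] (2 * n)" using cc by (simp add: nat_pow_mult mult_2)
    ultimately have key: "L (2 * n) + ideal_length R I H = 2 * L n" unfolding L_def by simp
    have Jid: "ideal (I <+>\<^bsub>R\<^esub> PIdl (c [^] m)) R" for m :: nat
      using cc by (intro add_ideals[OF I cgenideal_ideal]) simp
    have fin: "L m \<noteq> \<infinity>" for m
      unfolding L_def
    proof (rule ideal_length_finite[OF Jid])
      show "\<exists>N::nat. b [^] N \<in> I <+>\<^bsub>R\<^esub> PIdl (c [^] m)" if "b \<in> G 1" for b
        unfolding I_def using c(2) by (intro degree_one_nilpotent[OF assms(2) gP assms(4) e _ that]) blast
    qed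
    have reg: "(regular_module R)\<lparr>carrier := carrier R\<rparr> = regular_module R"
      by (simp add: regular_module_def)
    have len: "module_length R (quotient_module (regular_module R) (I <+>\<^bsub>R\<^esub> PIdl (c [^] m))) = L m" for m
      using module_length_quotient[OF Jid oneideal, of m] ideal.Icarr[OF Jid, of _ m]
      unfolding reg L_def by blast
    have sym: "module_length R (quotient_module ((regular_module R)\<lparr>carrier := H\<rparr>) I) = ideal_length R I H"
      by (rule module_length_quotient[OF I H IH])
    obtain p q where pq: "L n = enat p" "L (2 * n) = enat q" using fin[of n] fin[of "2 * n"] by auto
    \<comment> \<open>Finiteness of the symbolic quotient needs no separate argument: it is a
      summand of the finite number \<open>2 * L n\<close>.\<close>
    then obtain l where l: "ideal_length R I H = enat l"
      using key by (cases "ideal_length R I H") (auto simp: numeral_eq_enat)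
    have "q + l = 2 * p" using key by (simp add: pq l numeral_eq_enat)
    then show "let I = P [^]\<^bsub>ideals_set R\<^esub> n;
         lsym = module_length R
           (quotient_module ((regular_module R)\<lparr>carrier := symbolic_power R P n\<rparr>) I);
         len = (\<lambda>m. module_length R
           (quotient_module (regular_module R) (I <+>\<^bsub>R\<^esub> PIdl\<^bsub>R\<^esub> (c [^]\<^bsub>R\<^esub> m))))
     in lsym \<noteq> \<infinity> \<and> len n \<noteq> \<infinity> \<and> len (2 * n) \<noteq> \<infinity> \<and>
        int (the_enat lsym) = 2 * int (the_enat (len n)) - int (the_enat (len (2 * n)))"
      unfolding Let_def I_def[symmetric] H_def[symmetric] len sym pq l by simp
  qed
qed

end
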